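(* Let $f$ be a Schwarz-Christoffel mapping of the unit disk $\mathbb{D}$ onto a convex $(n+1)$-gon, with $$\frac{f''}{f'}(z)=\frac{2B(z)}{1-zB(z)},\qquad B(z)=\prod_{k=1}^n\frac{z-a_k}{1-\overline{a_k}z},$$ so that the pre-vertices $z_1,\dots,z_{n+1}\in\partial\mathbb{D}$ are the roots of $zB(z)=1$. Suppose that $|a_k|\leq r<1$ for all $k$. Then the following hold. (i) The minimum separation in argument of consecutive pre-vertices is given by $2\theta$, where $\theta$ is the unique root in $(0,\pi/2)$ of the equation $$\pi=\theta+2n\arctan\left\{\frac{1+r}{1-r}\tan\left(\frac{\theta}{2}\right)\right\}.$$ The result is sharp. The optimal configuration occurs when $a_1=\cdots=a_n=rc$ for some root $c$ of the equation $c^{n+1}=-1$, and the lower bound is attained for the pre-vertices $e^{i\theta}c,\ e^{-i\theta}c$. The distance between any other pair of consecutive pre-vertices will be larger. (ii) The maximum separation in argument of consecutive pre-vertices is given by $2\psi$, where $\psi$ is the unique root in $(0,\pi)$ of the equation $$\pi=\psi+2n\arctan\left\{\frac{1-r}{1+r}\tan\left(\frac{\psi}{2}\right)\right\}.$$ The result is sharp. The optimal configuration occurs when $a_1=\cdots=a_n=rd$ for some root $d$ of the equation $d^{n+1}=(-1)^n$, and the upper bound is attained for the pre-vertices $-e^{i\psi}d,\ -e^{-i\psi}d$. The distance between any other pair of consecutive pre-vertices will be smaller.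
   Context: $\mathbb{D}=\{|z|<1\}$. Every Schwarz-Christoffel mapping $f$ of $\mathbb{D}$ onto a convex $(n+1)$-gon satisfies $\frac{f''}{f'}(z)=\frac{2B(z)}{1-zB(z)}$ with a Blaschke product $B(z)=c_0\prod_{k=1}^n\frac{z-a_k}{1-\overline{a_k}z}$, $|c_0|=1$, $|a_k|<1$, of degree $n$; after rotating $f$ one may assume $c_0=1$, and this normalization is in force. Conversely, any choice of such $B$ results in a univalent mapping $f$. The pre-vertices are the points of $\partial\mathbb{D}$ mapped to the vertices; they are exactly the roots of $zB(z)=1$. The separation of two consecutive pre-vertices $z_k,z_{k+1}$ is understood as $\arg\{\overline{z_k}z_{k+1}\}\in(0,2\pi)$. The minimum and maximum are over all such mappings with $|a_k|\le r$ for all $k$.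
   Formalization: The claims that any other pair of consecutive pre-vertices is at strictly larger (smaller) distance are stated for r > 0 only, since for r = 0 all separations equal 2π/(n+1); n ≥ 2 is assumed, so that the (n+1)-gon has at least three vertices, infinity counted as a vertex. *)

theory Defs
  imports "HOL-Complex_Analysis.Complex_Analysis"
begin

definition blaschke :: "nat \<Rightarrow> (nat \<Rightarrow> complex) \<Rightarrow> complex \<Rightarrow> complex" where
  "blaschke n a z = (\<Prod>k=1..n. (z - a k) / (1 - cnj (a k) * z))"

(* Schwarz-Christoffel images may be unbounded (an exterior angle may be at least pi),
   and infinity is then one of the vertices, so an unbounded polygon gets one vertex
   more than it has corners in the plane.  This count is the usual one for m \<ge> 3; only
   regions containing a line, which have no corners, could have two vertices at infinity. *)
definition convex_polygon :: "nat \<Rightarrow> complex set \<Rightarrow> bool" where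
  "convex_polygon m S \<longleftrightarrow>
     S \<noteq> {} \<and> polyhedron (closure S) \<and> S = interior (closure S) \<and>
     card {v. v extreme_point_of closure S} + (if bounded S then 0 else 1) = m"

definition schwarz_christoffel :: "nat \<Rightarrow> (complex \<Rightarrow> complex) \<Rightarrow> bool" where
  "schwarz_christoffel m f \<longleftrightarrow>
     f holomorphic_on ball 0 1 \<and> inj_on f (ball 0 1) \<and> convex_polygon m (f ` ball 0 1)"

(* The boundary value of f at \<zeta> is its limit at \<zeta> from inside the disk. *)
definition prevertices :: "(complex \<Rightarrow> complex) \<Rightarrow> complex set" where
  "prevertices f = {\<zeta>. norm \<zeta> = 1 \<and>
     ((\<exists>v. v extreme_point_of closure (f ` ball 0 1) \<and> (f \<longlongrightarrow> v) (at \<zeta> within ball 0 1)) \<or>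
      filterlim f at_infinity (at \<zeta> within ball 0 1))}"

definition separation :: "complex \<Rightarrow> complex \<Rightarrow> real" where
  "separation u v = Arg2pi (cnj u * v)"

(* v is the first pre-vertex met when moving counterclockwise from u. *)
definition consecutive :: "(complex \<Rightarrow> complex) \<Rightarrow> complex \<Rightarrow> complex \<Rightarrow> bool" where
  "consecutive f u v \<longleftrightarrow>
     u \<in> prevertices f \<and> v \<in> prevertices f \<and> u \<noteq> v \<and>
     (\<forall>w\<in>prevertices f. w \<noteq> u \<longrightarrow> separation u v \<le> separation u w)"

definition sc_with_blaschke :: "nat \<Rightarrow> (nat \<Rightarrow> complex) \<Rightarrow> (complex \<Rightarrow> complex) \<Rightarrow> bool" where
  "sc_with_blaschke n a f \<longleftrightarrow>
     schwarz_christoffel (n + 1) f \<and>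
     (\<forall>z\<in>ball 0 1. deriv (deriv f) z / deriv f z
                     = 2 * blaschke n a z / (1 - z * blaschke n a z))"

definition separations :: "nat \<Rightarrow> real \<Rightarrow> real set" where
  "separations n r = {separation u v | f a u v.
     sc_with_blaschke n a f \<and> (\<forall>k\<in>{1..n}. norm (a k) \<le> r) \<and> consecutive f u v}"

end

theory Submission
  imports Defs "HOL-Real_Asymp.Real_Asymp"
begin

text \<open>
  On the unit circle \<open>z * blaschke n a z\<close> is \<open>cis\<close> of a continuous increasing function of the argument,
  and two pre-vertices are consecutive exactly if this function grows by \<open>2 * pi\<close> between them. Over an
  arc of half-length \<open>\<sigma>\<close> a Blaschke factor with zero \<open>a\<close> contributes (up to normalization) the harmonic
  measure of the arc seen from \<open>a\<close>; over the disk \<open>norm a \<le> r\<close> this is largest only when \<open>a\<close> is \<open>r\<close> times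
  the centre of the arc and smallest only when it is \<open>- r\<close> times the centre. The two equations of the
  theorem say that all \<open>n\<close> factors are extremal at once.

  That the pre-vertices are the roots of \<open>z * blaschke n a z = 1\<close>, and that every \<open>blaschke n a\<close> occurs,
  comes from the partial fractions \<open>2 B / (1 - z B) = (\<Sum>k. 2 t\<^sub>k / (z\<^sub>k - z))\<close> with \<open>t\<^sub>k > 0\<close> and
  \<open>(\<Sum>k. t\<^sub>k) = 1\<close>. They make \<open>f'\<close> a constant times a product of powers of \<open>1 - cnj z\<^sub>k * z\<close>, so that \<open>f\<close>
  extends to the circle, maps each arc between roots into a line, and turns by the angle \<open>2 * pi * t\<^sub>k\<close>
  at \<open>z\<^sub>k\<close>. To see that the image lies on one side of the line belonging to an arc, choose \<open>\<zeta>\<^sub>1\<close> on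
  the arc and \<open>\<zeta>\<^sub>2\<close> among the roots such that the turning is split evenly. Then the argument of
  \<open>f'(z) * (1 - cnj \<zeta>\<^sub>1 * z) * (1 - cnj \<zeta>\<^sub>2 * z)\<close> varies by less than \<open>pi\<close>, which means that in the strip
  coordinate with ends \<open>\<zeta>\<^sub>1\<close> and \<open>\<zeta>\<^sub>2\<close> the derivative of \<open>f\<close> stays in a half-plane. This gives both
  injectivity and the supporting line.
\<close>

section \<open>Arguments of linear factors\<close>

text \<open>Two obstacles shape the argument. A convex polygon is described here by half-planes and
  extreme points and may be unbounded, so injectivity is not enough: a supporting line is needed at
  every regular boundary point, and the image has to fill the intersection of the resulting
  half-planes. The latter is a connectedness argument. A limit point of the image outside the image
  lies on the edge of one of the half-planes, so inside the interior of the intersection the image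
  is both open and closed. A vertex with \<open>t \<ge> 1/2\<close> turns the boundary by at least
  \<open>pi\<close> and is sent to infinity; since the weights sum to \<open>1\<close> over at least
  three points, there is at most one.

  The second obstacle is that angles are determined only modulo \<open>2 * pi\<close>. They are
  built from principal logarithms of numbers with positive real part, hence of modulus below
  \<open>pi/2\<close>, so that the sign of a sine decides inequalities between angles. The
  half-angle tangent in the two equations is the Cayley coordinate of the circle, in which a
  Blaschke factor with real zero \<open>\<rho>\<close> is multiplication by
  \<open>(1 + \<rho>) / (1 - \<rho>)\<close>.\<close>

lemma Im_Ln_polar:
  assumes "0 < s" "- pi < \<phi>" "\<phi> \<le> pi"
  shows "Im (Ln (of_real s * cis \<phi>)) = \<phi>"
proof -
  have "of_real s * cis \<phi> = exp (Complex (ln s) \<phi>)"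
    using assms by (simp add: exp_eq_polar)
  moreover have "Ln (exp (Complex (ln s) \<phi>)) = Complex (ln s) \<phi>"
    using assms by (intro Ln_exp) auto
  ultimately show ?thesis by simp
qed

lemma polar_Ln: "z \<noteq> 0 \<Longrightarrow> z = of_real (norm z) * cis (Im (Ln z))"
  by (metis Re_Ln exp_Ln exp_eq_polar exp_ln zero_less_norm_iff)

lemma cis_int_pi: "cis (2 * pi * of_int k) = 1"
  by (metis cis_multiple_2pi Ints_of_int)

lemma cis_eq_1_iff: "cis y = 1 \<longleftrightarrow> (\<exists>k::int. y = 2 * pi * of_int k)"
proof
  assume "cis y = 1"
  then have "cos y = 1" by (metis cis.simps(1) one_complex.simps(1))
  then show "\<exists>k::int. y = 2 * pi * of_int k"
    by (auto simp: cos_one_2pi_int mult_ac)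
qed (auto simp: cis_int_pi)

lemma one_minus_cis: "1 - cis y = of_real (2 * sin (y / 2)) * cis ((y - pi) / 2)"
proof -
  have "cos y = 1 - 2 * (sin (y/2))^2" using cos_double_sin[of "y/2"] by simp
  moreover have "sin y = 2 * sin (y/2) * cos (y/2)" using sin_double[of "y/2"] by simp
  moreover have "cos ((y - pi) / 2) = sin (y/2)" "sin ((y - pi) / 2) = - cos (y/2)"
    by (simp_all add: diff_divide_distrib cos_diff sin_diff)
  ultimately show ?thesis
    by (simp add: complex_eq_iff power2_eq_square)
qed

text \<open>The floor brings \<open>y\<close> into one period, where the half-angle formula gives a
  principal argument between \<open>- pi/2\<close> and \<open>pi/2\<close>. Whenever
  \<open>y\<close> passes a multiple of \<open>2 * pi\<close> the value drops by \<open>pi\<close>;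
  these drops later become the turns of the boundary at the vertices.\<close>

lemma Im_Ln_one_minus_cis:
  assumes "cis y \<noteq> 1"
  shows "Im (Ln (1 - cis y)) = (y - 2 * pi * of_int \<lfloor>y / (2 * pi)\<rfloor> - pi) / 2"
proof -
  define k where "k = \<lfloor>y / (2 * pi)\<rfloor>"
  define y' where "y' = y - 2 * pi * of_int k"
  have "of_int k \<le> y / (2*pi)" "y / (2*pi) < of_int k + 1"
    unfolding k_def by linarith+
  then have y': "0 \<le> y'" "y' < 2 * pi"
    unfolding y'_def by (auto simp: field_simps)
  have c: "cis y' = cis y"
    unfolding y'_def by (metis cis_divide cis_int_pi div_by_1)
  with assms have "y' \<noteq> 0" by auto
  with y' have "0 < y'" by simp
  have s: "0 < 2 * sin (y'/2)" using \<open>0 < y'\<close> y' by (auto intro!: sin_gt_zero)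
  have "Im (Ln (1 - cis y')) = (y' - pi) / 2"
    unfolding one_minus_cis using s y' by (intro Im_Ln_polar) auto
  then show ?thesis unfolding c by (simp add: y'_def k_def)
qed

lemma angle_pos:
  fixes \<delta> :: real
  assumes "sin \<delta> > 0" "- pi < \<delta>" "\<delta> < 2 * pi" shows "0 < \<delta>" "\<delta> < pi"
proof -
  show "0 < \<delta>"
  proof (rule ccontr)
    assume "\<not> 0 < \<delta>"
    then have "sin (- \<delta>) \<ge> 0" using assms by (intro sin_ge_zero) auto
    then show False using assms by simp
  qed
  show "\<delta> < pi"
  proof (rule ccontr)
    assume "\<not> \<delta> < pi"
    then have "sin \<delta> \<le> 0" using assms sin_le_zero[of \<delta>] by auto
    then show False using assms by simp
  qed
qed

lemma Re_one_minus_pos: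
  assumes "norm u = 1" "norm z \<le> 1" "z \<noteq> u" shows "0 < Re (1 - cnj u * z)"
proof (rule ccontr)
  assume "\<not> ?thesis"
  moreover have n: "norm (cnj u * z) \<le> 1" using assms by (simp add: norm_mult)
  moreover have "Re (cnj u * z) \<le> norm (cnj u * z)" by (rule complex_Re_le_cmod)
  ultimately have 1: "Re (cnj u * z) = 1" by simp
  with n have "Im (cnj u * z) = 0"
    using cmod_power2[of "cnj u * z"] power_le_one[OF norm_ge_zero n, of 2] by simp
  with 1 have "cnj u * z = 1" by (simp add: complex_eq_iff)
  then have "(u * cnj u) * z = u" by (simp add: mult.assoc)
  then show False using assms by (simp add: complex_norm_square[symmetric])
qed

text \<open>The left-hand side is \<open>pi\<close> times the harmonic measure, seen from \<open>z\<close>, of the arc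
  from \<open>cis x\<close> to \<open>cis y\<close>.\<close>

lemma arc_measure_pos:
  assumes "x < y" "y < x + 2 * pi" "norm z < 1"
  shows "0 < Im (Ln (1 - cnj (cis y) * z)) - Im (Ln (1 - cnj (cis x) * z)) + (y - x) / 2"
proof -
  define P where "P = 1 - cnj (cis y) * z"
  define Q where "Q = 1 - cnj (cis x) * z"
  have P: "0 < Re P" and Q: "0 < Re Q"
    unfolding P_def Q_def by (rule Re_one_minus_pos; use assms(3) in force)+
  have nz: "P \<noteq> 0" "Q \<noteq> 0" using P Q by auto
  define \<delta> where "\<delta> = Im (Ln P) - Im (Ln Q) + (y - x) / 2"
  have b: "\<bar>Im (Ln P)\<bar> < pi/2" "\<bar>Im (Ln Q)\<bar> < pi/2"
    by (rule Re_Ln_pos_lt_imp[OF P], rule Re_Ln_pos_lt_imp[OF Q])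
  have e1: "cis (- y) * cis ((y-x)/2) = cis (- ((x+y)/2))"
    unfolding cis_mult by (rule arg_cong[of _ _ cis]) argo
  have e2: "cis x * cis ((y-x)/2) = cis ((x+y)/2)"
    unfolding cis_mult by (rule arg_cong[of _ _ cis]) argo
  have e3: "cis (- y) * cis x * cis ((y-x)/2) = cis (- ((y-x)/2))"
    unfolding cis_mult by (rule arg_cong[of _ _ cis]) argo
  have "P * cnj Q * cis ((y-x)/2)
      = cis ((y-x)/2) - (cis (-y) * cis ((y-x)/2)) * z - (cis x * cis ((y-x)/2)) * cnj z
        + (cis (- y) * cis x * cis ((y-x)/2)) * (z * cnj z)"
    unfolding P_def Q_def by (simp add: algebra_simps cis_cnj)
  also have "\<dots> = cis ((y-x)/2) - cis (- ((x+y)/2)) * z - cis ((x+y)/2) * cnj z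
        + cis (- ((y-x)/2)) * of_real ((norm z)^2)"
    unfolding e1 e2 e3 by (simp add: complex_norm_square del: of_real_power)
  finally have eq: "P * cnj Q * cis ((y-x)/2) = cis ((y-x)/2) - cis (- ((x+y)/2)) * z
        - cis ((x+y)/2) * cnj z + cis (- ((y-x)/2)) * of_real ((norm z)^2)" .
  \<comment> \<open>Rotation by the half-length of the arc makes the two terms linear in
    \<open>z\<close> conjugate to each other, so they contribute no imaginary part.\<close>
  have 1: "Im (P * cnj Q * cis ((y-x)/2)) = sin ((y-x)/2) * (1 - (norm z)^2)"
    unfolding eq by (simp add: algebra_simps)
  have pq: "P = of_real (norm P) * cis (Im (Ln P))" "cnj Q = of_real (norm Q) * cis (- Im (Ln Q))"
    using polar_Ln[OF nz(1)] arg_cong[OF polar_Ln[OF nz(2)], of cnj]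
    by (simp_all only: complex_cnj_mult complex_cnj_complex_of_real cis_cnj)
  have "P * cnj Q * cis ((y-x)/2)
      = of_real (norm P * norm Q) * (cis (Im (Ln P)) * cis (- Im (Ln Q)) * cis ((y-x)/2))"
    by (subst pq(1), subst pq(2)) (simp only: of_real_mult mult_ac)
  also have "cis (Im (Ln P)) * cis (- Im (Ln Q)) * cis ((y-x)/2) = cis \<delta>"
    unfolding cis_mult \<delta>_def by (rule arg_cong[of _ _ cis]) argo
  finally have "P * cnj Q * cis ((y-x)/2) = of_real (norm P * norm Q) * cis \<delta>" .
  then have "Im (P * cnj Q * cis ((y-x)/2)) = norm P * norm Q * sin \<delta>" by simp
  moreover have "0 < sin ((y-x)/2)" using assms by (intro sin_gt_zero) auto
  moreover have "(norm z)^2 < 1" using assms(3) by (simp add: abs_square_less_1)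
  ultimately have "0 < norm P * norm Q * sin \<delta>" using 1 by simp
  moreover have "0 < norm P * norm Q" using nz by simp
  ultimately have "0 < sin \<delta>" by (rule zero_less_mult_pos)
  \<comment> \<open>Two principal arguments below \<open>pi/2\<close> in modulus and a half-length
    in \<open>(0, pi)\<close> confine \<open>\<delta>\<close> to \<open>(- pi, 2 * pi)\<close>,
    where a positive sine leaves only \<open>(0, pi)\<close>.\<close>
  moreover have "- pi < \<delta>" using b assms(1,2) unfolding \<delta>_def by argo
  moreover have "\<delta> < 2 * pi" using b assms(1,2) unfolding \<delta>_def by argo
  ultimately have "0 < \<delta>" by (rule angle_pos)
  then show ?thesis by (simp add: \<delta>_def P_def Q_def)
qed

text \<open>\<open>exp\<close> takes the strip onto the right half-plane, and \<open>m\<close> takes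
  that onto the disk, sending \<open>0\<close> to \<open>cis x1\<close> and infinity to
  \<open>cis x2\<close>. In this coordinate the derivative is a constant times the two linear
  factors vanishing at the ends. The positive real constant is split off because only the argument
  of the rest will matter.\<close>

lemma moebius_strip:
  fixes x1 x2 :: real
  assumes "x1 < x2" "x2 < x1 + 2 * pi"
  obtains \<phi> where
    "\<And>s. \<bar>Im s\<bar> < pi/2 \<Longrightarrow> norm (\<phi> s) < 1"
    "\<And>s. \<bar>Im s\<bar> < pi/2 \<Longrightarrow> (\<phi> has_field_derivative
        of_real (1 / (2 * sin ((x2 - x1) / 2))) * (\<i> * cis ((x1 + x2) / 2)
          * (1 - cnj (cis x1) * \<phi> s) * (1 - cnj (cis x2) * \<phi> s))) (at s)"
    "\<And>z. norm z < 1 \<Longrightarrow> \<exists>s. \<bar>Im s\<bar> < pi/2 \<and> \<phi> s = z"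
    "\<And>s. ((\<lambda>x::real. \<phi> (s - of_real x)) \<longlongrightarrow> cis x1) at_top"
proof -
  define \<delta> where "\<delta> = (x2 - x1) / 2"
  define a where "a = cis x1"
  define b where "b = cis x2"
  \<comment> \<open>The rotation for which it is the right half-plane that goes to the disk;
    \<open>ident\<close> below shows this in both directions.\<close>
  define k where "k = \<i> * cis (- \<delta>)"
  define m where "m = (\<lambda>w. (a + b * k * w) / (1 + k * w))"
  define \<phi> where "\<phi> = (\<lambda>s. m (exp s))"
  have sp: "0 < sin \<delta>" unfolding \<delta>_def using assms by (intro sin_gt_zero) auto
  have ab: "b - a = of_real (2 * sin \<delta>) * (\<i> * cis ((x1 + x2) / 2))"
  proof -
    have "a = cis ((x1+x2)/2) * cis (- \<delta>)" "b = cis ((x1+x2)/2) * cis \<delta>"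
      unfolding a_def b_def \<delta>_def cis_mult by (rule arg_cong[of _ _ cis], argo)+
    then have "b - a = cis ((x1+x2)/2) * (cis \<delta> - cis (- \<delta>))" by (simp add: algebra_simps)
    also have "cis \<delta> - cis (- \<delta>) = of_real (2 * sin \<delta>) * \<i>" by (simp add: complex_eq_iff)
    finally show ?thesis by (simp add: algebra_simps)
  qed
  have abn: "a \<noteq> b" using ab sp by auto
  have na: "norm a = 1" "norm b = 1" by (simp_all add: a_def b_def)
  have k0: "k \<noteq> 0" by (simp add: k_def)
  have ident: "(norm (1 + k * w))^2 - (norm (a + b * k * w))^2 = 4 * sin \<delta> * Re w" for w
  proof -
    have e: "(norm (u + v))^2 = (norm u)^2 + (norm v)^2 + 2 * Re (cnj u * v)" for u v :: complex
      unfolding cmod_power2 by (simp add: power2_eq_square algebra_simps)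
    have n: "norm (b * k * w) = norm (k * w)" by (simp add: norm_mult na)
    have "cnj a * (b * k) = (cnj a * b) * k" by simp
    also have "cnj a * b = cis (2 * \<delta>)" unfolding a_def b_def cis_cnj cis_mult \<delta>_def
      by (rule arg_cong[of _ _ cis]) argo
    also have "\<dots> * k = \<i> * cis \<delta>" by (simp add: k_def cis_mult)
    finally have c: "cnj a * (b * k * w) = \<i> * cis \<delta> * w" by (simp add: mult_ac)
    have "k - \<i> * cis \<delta> = of_real (2 * sin \<delta>)" by (simp add: k_def complex_eq_iff)
    then have "(k - \<i> * cis \<delta>) * w = of_real (2 * sin \<delta>) * w" by simp
    then have "Re (k * w) - Re (\<i> * cis \<delta> * w) = 2 * sin \<delta> * Re w"
      unfolding left_diff_distrib minus_complex.simps(1)[symmetric] by simp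
    then show ?thesis
      unfolding e n c by (simp add: na algebra_simps)
  qed
  have nz: "1 + k * w \<noteq> 0" if "0 < Re w" for w
  proof
    assume "1 + k * w = 0"
    then have "- ((norm (a + b * k * w))^2) = 4 * sin \<delta> * Re w" using ident[of w] by simp
    moreover have "0 < 4 * sin \<delta> * Re w" using that sp by simp
    ultimately show False by (smt (verit) zero_le_power2)
  qed
  have Re_exp: "0 < Re (exp s)" if "\<bar>Im s\<bar> < pi/2" for s
    using that by (auto simp: Re_exp abs_less_iff intro!: mult_pos_pos cos_gt_zero_pi)
  show ?thesis
  proof
    fix s :: complex assume s: "\<bar>Im s\<bar> < pi/2"
    note R = Re_exp[OF s]
    note N = nz[OF R]
    have "(norm (a + b * k * exp s))^2 < (norm (1 + k * exp s))^2"
      using ident[of "exp s"] R sp by (smt (verit) mult_pos_pos)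
    then have "norm (a + b * k * exp s) < norm (1 + k * exp s)"
      by (rule power_less_imp_less_base) simp
    then show "norm (\<phi> s) < 1" using N by (simp add: \<phi>_def m_def norm_divide)
    have A: "1 - cnj a * \<phi> s = - cnj a * (k * exp s * (b - a) / (1 + k * exp s))"
    proof -
      have "\<phi> s - a = k * exp s * (b - a) / (1 + k * exp s)"
        unfolding \<phi>_def m_def using N by (simp add: field_simps)
      moreover have "1 - cnj a * \<phi> s = - cnj a * (\<phi> s - a)"
        using na by (simp add: algebra_simps complex_norm_square[symmetric] flip: complex_cnj_mult)
      ultimately show ?thesis by simp
    qed
    have B: "1 - cnj b * \<phi> s = cnj b * ((b - a) / (1 + k * exp s))"
    proof -
      have "b - \<phi> s = (b - a) / (1 + k * exp s)"
        unfolding \<phi>_def m_def using N by (simp add: field_simps)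
      moreover have "1 - cnj b * \<phi> s = cnj b * (b - \<phi> s)"
        using na by (simp add: algebra_simps complex_norm_square[symmetric] flip: complex_cnj_mult)
      ultimately show ?thesis by simp
    qed
    \<comment> \<open>The product of the two linear factors carries \<open>(b - a)^2\<close>, the
      derivative only \<open>b - a\<close>; this constant equal to \<open>1\<close> balances
      them.\<close>
    have K: "of_real (1 / (2 * sin \<delta>)) * (\<i> * cis ((x1 + x2) / 2)) * (- cnj a * cnj b) * (b - a) = 1"
    proof -
      have "cis ((x1 + x2) / 2) * (cnj a * cnj b) * cis ((x1 + x2) / 2) = 1"
        by (simp add: a_def b_def cis_cnj cis_mult field_simps)
      then show ?thesis unfolding ab using sp
        by (simp add: field_simps flip: of_real_mult)
    qed
    have "(\<phi> has_field_derivative (b - a) * (k * exp s) / (1 + k * exp s)^2) (at s)"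
      unfolding \<phi>_def m_def
      by (rule derivative_eq_intros refl N)+ (use N in \<open>simp add: field_simps power2_eq_square\<close>)
    also have "(b - a) * (k * exp s) / (1 + k * exp s)^2
        = (of_real (1 / (2 * sin \<delta>)) * (\<i> * cis ((x1 + x2) / 2)) * (- cnj a * cnj b) * (b - a))
            * ((b - a) * (k * exp s) / (1 + k * exp s)^2)"
      unfolding K by simp
    also have "\<dots> = of_real (1 / (2 * sin \<delta>)) * (\<i> * cis ((x1 + x2) / 2)
          * (1 - cnj a * \<phi> s) * (1 - cnj b * \<phi> s))"
      unfolding A B by (simp add: power2_eq_square)
    finally show "(\<phi> has_field_derivative
        of_real (1 / (2 * sin ((x2 - x1) / 2))) * (\<i> * cis ((x1 + x2) / 2)
          * (1 - cnj (cis x1) * \<phi> s) * (1 - cnj (cis x2) * \<phi> s))) (at s)"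
      unfolding a_def b_def \<delta>_def .
  next
    fix z :: complex assume z: "norm z < 1"
    define w where "w = (z - a) / (k * (b - z))"
    have bz: "b - z \<noteq> 0" using z na by auto
    have 1: "1 + k * w = (b - a) / (b - z)" unfolding w_def using bz k0 by (simp add: field_simps)
    then have nz: "1 + k * w \<noteq> 0" using bz abn by simp
    have "a + b * k * w = z * (1 + k * w)"
      unfolding w_def using bz k0 by (simp add: field_simps)
    then have mw: "m w = z" and nn: "norm (a + b * k * w) = norm z * norm (1 + k * w)"
      unfolding m_def using nz by (simp_all add: norm_mult)
    have "0 < (norm (1 + k * w))^2 * (1 - (norm z)^2)"
      using nz z by (simp add: abs_square_less_1)
    also have "\<dots> = 4 * sin \<delta> * Re w" using ident[of w] unfolding nn by (simp add: algebra_simps power_mult_distrib)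
    finally have "0 < Re w" using sp by (simp add: zero_less_mult_iff)
    then have "\<bar>Im (Ln w)\<bar> < pi/2" "w \<noteq> 0" using Re_Ln_pos_lt_imp[of w] by (simp, auto)
    then show "\<exists>s. \<bar>Im s\<bar> < pi/2 \<and> \<phi> s = z"
      using mw by (intro exI[of _ "Ln w"]) (simp add: \<phi>_def)
  next
    fix s :: complex
    have "((\<lambda>x::real. exp (s - of_real x)) \<longlongrightarrow> 0) at_top"
    proof (rule tendsto_norm_zero_cancel)
      show "((\<lambda>x::real. norm (exp (s - of_real x))) \<longlongrightarrow> 0) at_top"
        unfolding norm_exp_eq_Re minus_complex.simps Re_complex_of_real by real_asymp
    qed
    then have "((\<lambda>x::real. \<phi> (s - of_real x)) \<longlongrightarrow> (a + b * k * 0) / (1 + k * 0)) at_top"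
      unfolding \<phi>_def m_def by (intro tendsto_intros) auto
    then show "((\<lambda>x::real. \<phi> (s - of_real x)) \<longlongrightarrow> cis x1) at_top" by (simp add: a_def)
  qed
qed

section \<open>Schwarz-Christoffel integrals\<close>

text \<open>Take the least \<open>a\<close> whose cumulative weight reaches \<open>1/2\<close>: the
  cumulative weight of its predecessor is still below. This is the point at which the turning of the
  boundary is split evenly.\<close>

lemma weighted_median:
  fixes t p :: "'a \<Rightarrow> real"
  assumes "finite A" "sum t A = 1" "inj_on p A"
  obtains a where "a \<in> A" "(\<Sum>b\<in>{b\<in>A. p b < p a}. t b) \<le> 1/2"
    "1/2 \<le> (\<Sum>b\<in>{b\<in>A. p b \<le> p a}. t b)"
proof -
  define M where "M = {a\<in>A. 1/2 \<le> (\<Sum>b\<in>{b\<in>A. p b \<le> p a}. t b)}"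
  have ne: "A \<noteq> {}" using assms(2) by auto
  have fM: "finite M" unfolding M_def using assms(1) by simp
  have "M \<noteq> {}"
  proof -
    have "Max (p ` A) \<in> p ` A" using assms(1) ne by simp
    then obtain a where a: "a \<in> A" "p a = Max (p ` A)" by auto
    then have "{b\<in>A. p b \<le> p a} = A" using assms(1) by auto
    then have "a \<in> M" using a assms(2) by (simp add: M_def)
    then show ?thesis by auto
  qed
  then have "Min (p ` M) \<in> p ` M" using fM by simp
  then obtain a where a: "a \<in> M" "p a = Min (p ` M)" by auto
  have le: "p a \<le> p b" if "b \<in> M" for b using that a fM by simp
  have "(\<Sum>b\<in>{b\<in>A. p b < p a}. t b) \<le> 1/2"
  proof (cases "{b\<in>A. p b < p a} = {}")
    case True
    then have "sum t {b\<in>A. p b < p a} = 0" by (simp only: sum.empty)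
    then show ?thesis by simp
  next
    case False
    let ?B = "{b\<in>A. p b < p a}"
    have fB: "finite ?B" using assms(1) by simp
    then have "Max (p ` ?B) \<in> p ` ?B" using False by simp
    then obtain c where c: "c \<in> ?B" "p c = Max (p ` ?B)" by auto
    then have "?B = {b\<in>A. p b \<le> p c}" using fB by auto
    moreover have "c \<notin> M" using le[of c] c by auto
    ultimately show ?thesis using c by (auto simp: M_def)
  qed
  then show ?thesis using a that by (auto simp: M_def)
qed

text \<open>For unimodular \<open>\<eta>\<close> this is the plane slit along the outward rays that
  start at the points of \<open>Z\<close>. It is starlike about \<open>0\<close> and contains the
  closed disk except \<open>Z\<close>, so primitives exist on it and are analytic across the open
  arcs.\<close>

definition sc_dom :: "complex set \<Rightarrow> complex set" where
  "sc_dom Z = {z. \<forall>\<eta>\<in>Z. 1 - cnj \<eta> * z \<notin> \<real>\<^sub>\<le>\<^sub>0}"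

text \<open>\<open>exp (- 2 * sc_log Z t z)\<close> is the product of the powers of
  \<open>1 - cnj \<eta> * z\<close> with exponents \<open>- 2 * t \<eta>\<close>, in principal
  branches.\<close>

definition sc_log :: "complex set \<Rightarrow> (complex \<Rightarrow> real) \<Rightarrow> complex \<Rightarrow> complex" where
  "sc_log Z t z = (\<Sum>\<eta>\<in>Z. of_real (t \<eta>) * Ln (1 - cnj \<eta> * z))"

lemma disc_minus_subset_sc_dom:
  assumes "\<And>\<eta>. \<eta> \<in> Z \<Longrightarrow> norm \<eta> = 1" "norm z \<le> 1" "z \<notin> Z"
  shows "z \<in> sc_dom Z"
  unfolding sc_dom_def
  using Re_one_minus_pos assms by (fastforce simp: complex_nonpos_Reals_iff)

lemma open_sc_dom:
  assumes "finite Z" shows "open (sc_dom Z)"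
proof -
  have "sc_dom Z = (\<Inter>\<eta>\<in>Z. (\<lambda>z. 1 - cnj \<eta> * z) -` (- \<real>\<^sub>\<le>\<^sub>0))" by (auto simp: sc_dom_def)
  moreover have "open ((\<lambda>z. 1 - cnj \<eta> * z) -` (- \<real>\<^sub>\<le>\<^sub>0))" for \<eta>
    by (intro open_vimage continuous_intros) auto
  ultimately show ?thesis using assms by (simp add: open_INT)
qed

lemma holomorphic_sc_log: "sc_log Z t holomorphic_on sc_dom Z"
  unfolding sc_log_def by (intro holomorphic_intros) (auto simp: sc_dom_def)

text \<open>The exterior angles are \<open>2 * pi * t \<eta>\<close>, so \<open>t_sum\<close>
  expresses a total turning of \<open>2 * pi\<close>. \<open>F\<close> is given on the slit domain
  and not only in the disk, to have values and derivatives on the open arcs. Three points exclude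
  two vertices at infinity.\<close>

locale sc_map =
  fixes Z :: "complex set" and t :: "complex \<Rightarrow> real" and C :: complex
    and F :: "complex \<Rightarrow> complex"
  assumes finite_Z: "finite Z" and card_Z: "3 \<le> card Z"
    and norm_Z: "\<And>\<eta>. \<eta> \<in> Z \<Longrightarrow> norm \<eta> = 1"
    and t_pos: "\<And>\<eta>. \<eta> \<in> Z \<Longrightarrow> 0 < t \<eta>" and t_sum: "sum t Z = 1"
    and C_nz: "C \<noteq> 0"
    and F_deriv: "\<And>z. z \<in> sc_dom Z \<Longrightarrow>
      (F has_field_derivative C * exp (- 2 * sc_log Z t z)) (at z)"
begin

lemma disc_minus_subset: "norm z \<le> 1 \<Longrightarrow> z \<notin> Z \<Longrightarrow> z \<in> sc_dom Z"
  using disc_minus_subset_sc_dom norm_Z by blast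

lemma ball_subset: "norm z < 1 \<Longrightarrow> z \<in> sc_dom Z"
  using disc_minus_subset norm_Z by force

text \<open>The direction of \<open>z * F'(z)\<close> at \<open>z = cis x\<close>, which is the
  outward unit normal of the image curve there. It is written with the argument of the exponential
  made explicit, so that it can be computed from the logarithms.\<close>

definition nrm :: "real \<Rightarrow> complex" where
  "nrm x = sgn C * cis (x + Im (- 2 * sc_log Z t (cis x)))"

lemma nrm_eq: "cis x * (C * exp (- 2 * sc_log Z t (cis x)))
    = of_real (norm C * exp (Re (- 2 * sc_log Z t (cis x)))) * nrm x"
proof -
  have *: "of_real (norm C) * sgn C = C" by (simp add: sgn_eq C_nz)
  have "cis x * (C * exp u) = of_real (norm C * exp (Re u)) * (sgn C * cis (x + Im u))" for u
    by (subst *[symmetric], subst exp_eq_polar)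
       (simp only: cis_mult[symmetric] of_real_mult mult_ac)
  then show ?thesis unfolding nrm_def .
qed

lemma norm_nrm [simp]: "norm (nrm x) = 1"
  by (simp add: nrm_def norm_mult norm_sgn C_nz)

text \<open>The expression is a positive multiple of \<open>\<i> * cis \<delta>\<close>, so the
  claim amounts to \<open>\<delta>\<close> lying in \<open>(0, pi)\<close>. With
  \<open>cis x2\<close> the weighted median of \<open>Z\<close> counted from \<open>x1\<close>, both
  \<open>\<delta>\<close> and \<open>pi - \<delta>\<close> are combinations of arc measures seen
  from \<open>z\<close> with nonnegative coefficients that do not all vanish.\<close>

lemma direction:
  assumes x1: "cis x1 \<notin> Z"
  obtains x2 where "x1 < x2" "x2 < x1 + 2 * pi"
    "\<And>z. norm z < 1 \<Longrightarrow> Re (cnj (nrm x1) * (\<i> * cis ((x1 + x2) / 2)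
          * (1 - cnj (cis x1) * z) * (1 - cnj (cis x2) * z)
          * (C * exp (- 2 * sc_log Z t z)))) < 0"
proof -
  \<comment> \<open>Lifts the points of \<open>Z\<close> to arguments in the period that follows
    \<open>x1\<close>.\<close>
  define p where "p = (\<lambda>\<eta>. x1 + Arg2pi (\<eta> * cis (- x1)))"
  have p: "cis (p \<eta>) = \<eta>" "x1 < p \<eta>" "p \<eta> < x1 + 2 * pi" if "\<eta> \<in> Z" for \<eta>
  proof -
    have n: "norm (\<eta> * cis (- x1)) = 1" using norm_Z[OF that] by (simp add: norm_mult)
    have "cis (Arg2pi (\<eta> * cis (- x1))) = \<eta> * cis (- x1)"
      using Arg2pi_eq[of "\<eta> * cis (- x1)"] n by (simp add: cis_conv_exp)
    then have "cis (p \<eta>) = cis x1 * (\<eta> * cis (- x1))" by (simp add: p_def cis_mult[symmetric])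
    also have "\<dots> = \<eta>" by (simp add: cis_mult mult.left_commute)
    finally show e: "cis (p \<eta>) = \<eta>" .
    have "p \<eta> \<noteq> x1" using e that x1 by auto
    then show "x1 < p \<eta>" using Arg2pi_ge_0[of "\<eta> * cis (- x1)"] by (simp add: p_def)
    show "p \<eta> < x1 + 2 * pi" using Arg2pi_lt_2pi[of "\<eta> * cis (- x1)"] by (simp add: p_def)
  qed
  have inj: "inj_on p Z" by (rule inj_onI) (metis p(1))
  obtain \<xi> where \<xi>: "\<xi> \<in> Z" "(\<Sum>b\<in>{b\<in>Z. p b < p \<xi>}. t b) \<le> 1/2"
      "1/2 \<le> (\<Sum>b\<in>{b\<in>Z. p b \<le> p \<xi>}. t b)"
    by (rule weighted_median[OF finite_Z t_sum inj])
  define x2 where "x2 = p \<xi>"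
  define Lo where "Lo = {b\<in>Z. p b < x2}"
  define Hi where "Hi = {b\<in>Z. x2 < p b}"
  have fin: "finite Lo" "finite Hi" using finite_Z by (auto simp: Lo_def Hi_def)
  have "Z = insert \<xi> (Lo \<union> Hi)" using inj \<xi>(1)
    by (auto simp: Lo_def Hi_def x2_def inj_on_def dest: linorder_neqE)
  moreover have "\<xi> \<notin> Lo \<union> Hi" "Lo \<inter> Hi = {}" by (auto simp: Lo_def Hi_def x2_def)
  ultimately have split: "sum g Z = g \<xi> + sum g Lo + sum g Hi" for g :: "complex \<Rightarrow> real"
    using fin by (simp add: sum.union_disjoint)
  have "{b\<in>Z. p b \<le> x2} = insert \<xi> Lo" using inj \<xi>(1)
    by (auto simp: Lo_def x2_def inj_on_def order.order_iff_strict)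
  then have h: "1/2 \<le> t \<xi> + sum t Lo" "sum t Lo \<le> 1/2"
    using \<xi>(2,3) fin by (auto simp: x2_def Lo_def)
  have one: "t \<xi> + sum t Lo + sum t Hi = 1" using split[of t] t_sum by simp
  have ne: "Lo \<union> Hi \<noteq> {}"
  proof
    assume "Lo \<union> Hi = {}"
    then have "Z \<subseteq> {\<xi>}" using \<open>Z = insert \<xi> (Lo \<union> Hi)\<close> by auto
    then have "card Z \<le> card {\<xi>}" by (intro card_mono) auto
    then show False using card_Z by simp
  qed
  have x2: "x1 < x2" "x2 < x1 + 2 * pi" using p \<xi>(1) by (auto simp: x2_def)
  define m where "m = Im (- 2 * sc_log Z t (cis x1))"
  have m: "m = (\<Sum>\<eta>\<in>Z. t \<eta> * p \<eta>) - x1 - pi"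
  proof -
    have a: "Im (Ln (1 - cnj \<eta> * cis x1)) = (pi - (p \<eta> - x1)) / 2" if \<eta>: "\<eta> \<in> Z" for \<eta>
    proof -
      have e: "cnj \<eta> * cis x1 = cis (x1 - p \<eta>)"
        using p(1)[OF \<eta>] by (metis cis_cnj cis_mult add.commute uminus_add_conv_diff)
      have "cis (x1 - p \<eta>) \<noteq> 1"
      proof
        assume "cis (x1 - p \<eta>) = 1"
        then have "cis x1 = cis (p \<eta>)" by (simp add: cis_divide[symmetric])
        then show False using p(1)[OF \<eta>] \<eta> x1 by simp
      qed
      \<comment> \<open>All lifted points lie ahead of \<open>x1\<close> by less than one period, so
        every floor has the same value.\<close>
      moreover have "\<lfloor>(x1 - p \<eta>) / (2 * pi)\<rfloor> = -1"
        using p(2,3)[OF \<eta>] by (intro floor_unique) (auto simp: field_simps)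
      ultimately show ?thesis unfolding e by (subst Im_Ln_one_minus_cis) (auto simp: field_simps)
    qed
    have "m = (\<Sum>\<eta>\<in>Z. - 2 * (t \<eta> * Im (Ln (1 - cnj \<eta> * cis x1))))"
      by (simp add: m_def sc_log_def sum_distrib_left)
    also have "\<dots> = (\<Sum>\<eta>\<in>Z. - 2 * (t \<eta> * ((pi - (p \<eta> - x1)) / 2)))"
      by (intro sum.cong refl) (simp only: a)
    also have "\<dots> = (\<Sum>\<eta>\<in>Z. t \<eta> * p \<eta> - (x1 + pi) * t \<eta>)"
      by (intro sum.cong) (auto simp: field_simps)
    also have "\<dots> = (\<Sum>\<eta>\<in>Z. t \<eta> * p \<eta>) - (x1 + pi)"
      using t_sum by (simp add: sum_subtractf sum_distrib_left[symmetric])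
    finally show ?thesis by simp
  qed
  show ?thesis
  proof (rule that[OF x2])
    fix z :: complex assume z: "norm z < 1"
    define L where "L = (\<lambda>x. Im (Ln (1 - cnj (cis x) * z)))"
    define W where "W = (\<lambda>x y. L y - L x + (y - x) / 2)"
    have Wp: "0 < W x y" if "x < y" "y < x + 2 * pi" for x y
      unfolding W_def L_def using arc_measure_pos[OF that z] by simp
    have per: "L (x1 + 2 * pi) = L x1" by (simp add: L_def cis_mult[symmetric])
    define S where "S = (\<Sum>\<eta>\<in>Z. t \<eta> * L (p \<eta>))"
    have S: "Im (- 2 * sc_log Z t z) = - 2 * S"
      using p(1) by (simp add: S_def sc_log_def L_def)
    define \<delta> where "\<delta> = (x2 - x1) / 2 - m + L x1 + L x2 - 2 * S"
    have sum1: "2 * (\<Sum>\<eta>\<in>A. t \<eta> * W (p \<eta>) y)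
        = 2 * sum t A * (L y + y/2) - 2 * (\<Sum>\<eta>\<in>A. t \<eta> * L (p \<eta>)) - (\<Sum>\<eta>\<in>A. t \<eta> * p \<eta>)" for A y
    proof -
      have "2 * (\<Sum>\<eta>\<in>A. t \<eta> * W (p \<eta>) y)
        = (\<Sum>\<eta>\<in>A. t \<eta> * (2 * (L y + y/2)) - 2 * (t \<eta> * L (p \<eta>)) - t \<eta> * p \<eta>)"
        unfolding sum_distrib_left by (intro sum.cong refl) (simp add: W_def field_simps)
      also have "\<dots> = sum t A * (2 * (L y + y/2)) - 2 * (\<Sum>\<eta>\<in>A. t \<eta> * L (p \<eta>)) - (\<Sum>\<eta>\<in>A. t \<eta> * p \<eta>)"
        unfolding sum_subtractf sum_distrib_left sum_distrib_right ..
      finally show ?thesis by simp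
    qed
    have sum2: "2 * (\<Sum>\<eta>\<in>A. t \<eta> * W x (p \<eta>))
        = - 2 * sum t A * (L x + x/2) + 2 * (\<Sum>\<eta>\<in>A. t \<eta> * L (p \<eta>)) + (\<Sum>\<eta>\<in>A. t \<eta> * p \<eta>)" for A x
    proof -
      have "2 * (\<Sum>\<eta>\<in>A. t \<eta> * W x (p \<eta>)) = - (2 * (\<Sum>\<eta>\<in>A. t \<eta> * W (p \<eta>) x))"
        unfolding sum_distrib_left sum_negf[symmetric]
        by (intro sum.cong refl) (simp add: W_def field_simps)
      then show ?thesis unfolding sum1 by simp
    qed
    have SS: "S = t \<xi> * L x2 + (\<Sum>\<eta>\<in>Lo. t \<eta> * L (p \<eta>)) + (\<Sum>\<eta>\<in>Hi. t \<eta> * L (p \<eta>))"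
      "(\<Sum>\<eta>\<in>Z. t \<eta> * p \<eta>) = t \<xi> * x2 + (\<Sum>\<eta>\<in>Lo. t \<eta> * p \<eta>) + (\<Sum>\<eta>\<in>Hi. t \<eta> * p \<eta>)"
      unfolding S_def split by (simp_all add: x2_def)
    have tx: "t \<xi> = 1 - sum t Lo - sum t Hi" using one by simp
    \<comment> \<open>The median enters through the coefficients
      \<open>2 * (sum t Lo + t \<xi>) - 1\<close> here and \<open>1 - 2 * sum t Lo\<close> in
      \<open>d2\<close>, both nonnegative. Points beyond the median are measured up to
      \<open>x1 + 2 * pi\<close> here and from \<open>x2\<close> in \<open>d2\<close>, so no arc
      exceeds one period.\<close>
    have d1: "\<delta> = 2 * (\<Sum>\<eta>\<in>Lo. t \<eta> * W (p \<eta>) x2) + 2 * (\<Sum>\<eta>\<in>Hi. t \<eta> * W (p \<eta>) (x1 + 2*pi))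
        + (2 * (sum t Lo + t \<xi>) - 1) * W x2 (x1 + 2 * pi)"
      unfolding sum1 unfolding W_def per \<delta>_def m SS tx by (simp add: field_simps)
    have d2: "pi - \<delta> = 2 * (\<Sum>\<eta>\<in>Lo. t \<eta> * W x1 (p \<eta>)) + 2 * (\<Sum>\<eta>\<in>Hi. t \<eta> * W x2 (p \<eta>))
        + (1 - 2 * sum t Lo) * W x1 x2"
      unfolding sum2 unfolding W_def per \<delta>_def m SS tx by (simp add: field_simps)
    have pos: "0 < (\<Sum>\<eta>\<in>Lo. f \<eta>) + (\<Sum>\<eta>\<in>Hi. g \<eta>)"
      if "\<And>\<eta>. \<eta> \<in> Lo \<Longrightarrow> 0 < f \<eta>" "\<And>\<eta>. \<eta> \<in> Hi \<Longrightarrow> 0 < g \<eta>" for f g :: "complex \<Rightarrow> real"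
    proof (cases "Lo = {}")
      case True
      then have "0 < sum g Hi" using ne that fin by (intro sum_pos) auto
      then show ?thesis using True by simp
    next
      case False
      then have "0 < sum f Lo" using that fin by (intro sum_pos) auto
      moreover have "0 \<le> sum g Hi" using that by (intro sum_nonneg) (auto intro: less_imp_le)
      ultimately show ?thesis by simp
    qed
    have "0 < (\<Sum>\<eta>\<in>Lo. t \<eta> * W (p \<eta>) x2) + (\<Sum>\<eta>\<in>Hi. t \<eta> * W (p \<eta>) (x1 + 2*pi))"
      using p x2 t_pos by (intro pos mult_pos_pos Wp) (auto simp: Lo_def Hi_def intro: less_trans)
    moreover have "0 \<le> (2 * (sum t Lo + t \<xi>) - 1) * W x2 (x1 + 2 * pi)"
      using h x2 by (intro mult_nonneg_nonneg less_imp_le[OF Wp]) auto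
    ultimately have "0 < \<delta>" unfolding d1 by simp
    have "0 < (\<Sum>\<eta>\<in>Lo. t \<eta> * W x1 (p \<eta>)) + (\<Sum>\<eta>\<in>Hi. t \<eta> * W x2 (p \<eta>))"
    proof (intro pos mult_pos_pos Wp)
      fix \<eta> assume "\<eta> \<in> Hi"
      then show "x2 < p \<eta>" "0 < t \<eta>" "p \<eta> < x2 + 2 * pi"
        using p(3)[of \<eta>] x2 t_pos by (auto simp: Hi_def)
    qed (use p x2 t_pos in \<open>auto simp: Lo_def\<close>)
    moreover have "0 \<le> (1 - 2 * sum t Lo) * W x1 x2"
      using h x2 by (intro mult_nonneg_nonneg less_imp_le[OF Wp]) auto
    ultimately have "\<delta> < pi" using d2 by simp
    have "0 < Re (1 - cnj (cis x1) * z)" "0 < Re (1 - cnj (cis x2) * z)"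
      by (rule Re_one_minus_pos; use z in force)+
    then have nz: "1 - cnj (cis x1) * z \<noteq> 0" "1 - cnj (cis x2) * z \<noteq> 0" by force+
    define R where "R = norm (1 - cnj (cis x1) * z) * norm (1 - cnj (cis x2) * z)
      * norm C * exp (Re (- 2 * sc_log Z t z))"
    have R: "0 < R" unfolding R_def using nz C_nz by simp
    have Csgn: "cnj (sgn C) * C = of_real (norm C)"
      by (simp add: sgn_eq C_nz complex_norm_square[symmetric] power2_eq_square mult.commute field_simps)
    have "cnj (nrm x1) * (\<i> * cis ((x1 + x2) / 2)
          * (1 - cnj (cis x1) * z) * (1 - cnj (cis x2) * z) * (C * exp (- 2 * sc_log Z t z)))
       = \<i> * (cnj (sgn C) * C) * cis (- (x1 + m)) * cis ((x1 + x2) / 2)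
          * (1 - cnj (cis x1) * z) * (1 - cnj (cis x2) * z) * exp (- 2 * sc_log Z t z)"
      by (simp add: nrm_def m_def cis_cnj mult_ac)
    also have "\<dots> = \<i> * of_real R * (cis (- (x1 + m)) * cis ((x1 + x2) / 2) * cis (L x1) * cis (L x2) * cis (- 2 * S))"
    proof -
      have 1: "1 - cnj (cis x1) * z = of_real (norm (1 - cnj (cis x1) * z)) * cis (L x1)"
        unfolding L_def by (rule polar_Ln[OF nz(1)])
      have 2: "1 - cnj (cis x2) * z = of_real (norm (1 - cnj (cis x2) * z)) * cis (L x2)"
        unfolding L_def by (rule polar_Ln[OF nz(2)])
      have 3: "exp (- 2 * sc_log Z t z) = of_real (exp (Re (- 2 * sc_log Z t z))) * cis (- 2 * S)"
        unfolding exp_eq_polar S ..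
      show ?thesis
        unfolding Csgn R_def by (subst 1, subst 2, subst 3) (simp only: of_real_mult mult_ac)
    qed
    also have "cis (- (x1 + m)) * cis ((x1 + x2) / 2) * cis (L x1) * cis (L x2) * cis (- 2 * S) = cis \<delta>"
      unfolding cis_mult \<delta>_def by (rule arg_cong[of _ _ cis]) argo
    finally have E: "cnj (nrm x1) * (\<i> * cis ((x1 + x2) / 2)
          * (1 - cnj (cis x1) * z) * (1 - cnj (cis x2) * z)
          * (C * exp (- 2 * sc_log Z t z))) = \<i> * of_real R * cis \<delta>" .
    have "Re (cnj (nrm x1) * (\<i> * cis ((x1 + x2) / 2)
          * (1 - cnj (cis x1) * z) * (1 - cnj (cis x2) * z)
          * (C * exp (- 2 * sc_log Z t z)))) = - R * sin \<delta>" unfolding E by simp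
    also have "\<dots> < 0" using R sin_gt_zero[OF \<open>0 < \<delta>\<close> \<open>\<delta> < pi\<close>] by simp
    finally show "Re (cnj (nrm x1) * (\<i> * cis ((x1 + x2) / 2)
          * (1 - cnj (cis x1) * z) * (1 - cnj (cis x2) * z)
          * (C * exp (- 2 * sc_log Z t z)))) < 0" .
  qed
qed

end

section \<open>Injectivity and supporting lines from the strip coordinate\<close>

lemma inner_Re: "a \<bullet> b = Re (cnj a * b)"
  by (simp add: inner_complex_def)

lemma Re_of_real_times: "Re (of_real k * z) = k * Re z"
  by simp

context sc_map begin

text \<open>By \<open>direction\<close> the derivative of \<open>F\<close> in the strip coordinate
  stays in the open half-plane opposite to \<open>nrm x1\<close>. The strip is convex, so
  integration along the segment from \<open>s\<close> to \<open>s'\<close> keeps the difference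
  quotient in that half-plane. Multiplying by \<open>cnj (s' - s)\<close> replaces division by
  \<open>s' - s\<close> up to a positive factor.\<close>

lemma strip_decreasing:
  assumes x1: "cis x1 \<notin> Z"
  obtains \<phi> where
    "\<And>s. \<bar>Im s\<bar> < pi/2 \<Longrightarrow> norm (\<phi> s) < 1"
    "\<And>z. norm z < 1 \<Longrightarrow> \<exists>s. \<bar>Im s\<bar> < pi/2 \<and> \<phi> s = z"
    "\<And>s. ((\<lambda>x::real. \<phi> (s - of_real x)) \<longlongrightarrow> cis x1) at_top"
    "\<And>s s'. \<bar>Im s\<bar> < pi/2 \<Longrightarrow> \<bar>Im s'\<bar> < pi/2 \<Longrightarrow> s \<noteq> s' \<Longrightarrow>
       Re (cnj (nrm x1) * (cnj (s' - s) * (F (\<phi> s') - F (\<phi> s)))) < 0"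
proof -
  obtain x2 where x2: "x1 < x2" "x2 < x1 + 2 * pi"
    and dir: "\<And>z. norm z < 1 \<Longrightarrow> Re (cnj (nrm x1) * (\<i> * cis ((x1 + x2) / 2)
          * (1 - cnj (cis x1) * z) * (1 - cnj (cis x2) * z)
          * (C * exp (- 2 * sc_log Z t z)))) < 0"
    using direction[OF x1] by blast
  obtain \<phi> where \<phi>: "\<And>s. \<bar>Im s\<bar> < pi/2 \<Longrightarrow> norm (\<phi> s) < 1"
    "\<And>s. \<bar>Im s\<bar> < pi/2 \<Longrightarrow> (\<phi> has_field_derivative
        of_real (1 / (2 * sin ((x2 - x1) / 2))) * (\<i> * cis ((x1 + x2) / 2)
          * (1 - cnj (cis x1) * \<phi> s) * (1 - cnj (cis x2) * \<phi> s))) (at s)"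
    "\<And>z. norm z < 1 \<Longrightarrow> \<exists>s. \<bar>Im s\<bar> < pi/2 \<and> \<phi> s = z"
    "\<And>s. ((\<lambda>x::real. \<phi> (s - of_real x)) \<longlongrightarrow> cis x1) at_top"
    using moebius_strip[OF x2] by blast
  define \<kappa> where "\<kappa> = 1 / (2 * sin ((x2 - x1) / 2))"
  have \<kappa>: "0 < \<kappa>" unfolding \<kappa>_def using x2 by (simp, intro sin_gt_zero) auto
  define D where "D = (\<lambda>s. C * exp (- 2 * sc_log Z t (\<phi> s)) * (of_real \<kappa> * (\<i> * cis ((x1 + x2) / 2)
          * (1 - cnj (cis x1) * \<phi> s) * (1 - cnj (cis x2) * \<phi> s))))"
  have D: "((\<lambda>s. F (\<phi> s)) has_field_derivative D s) (at s)" if "\<bar>Im s\<bar> < pi/2" for s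
    unfolding D_def \<kappa>_def
    by (rule DERIV_chain2[OF F_deriv[OF ball_subset[OF \<phi>(1)[OF that]]] \<phi>(2)[OF that]])
  have Dneg: "Re (cnj (nrm x1) * D s) < 0" if "\<bar>Im s\<bar> < pi/2" for s
  proof -
    have "cnj (nrm x1) * D s = of_real \<kappa> * (cnj (nrm x1) * (\<i> * cis ((x1 + x2) / 2)
          * (1 - cnj (cis x1) * \<phi> s) * (1 - cnj (cis x2) * \<phi> s)
          * (C * exp (- 2 * sc_log Z t (\<phi> s)))))"
      by (simp add: D_def mult_ac)
    then show ?thesis
      using dir[OF \<phi>(1)[OF that]] \<kappa> by (simp only: Re_of_real_times mult_pos_neg)
  qed
  show ?thesis
  proof (rule that[OF \<phi>(1) \<phi>(3) \<phi>(4)])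
    fix s s' :: complex assume s: "\<bar>Im s\<bar> < pi/2" "\<bar>Im s'\<bar> < pi/2" "s \<noteq> s'"
    define d where "d = s' - s"
    define h where "h = (\<lambda>x::real. Re (cnj (nrm x1) * (cnj d * F (\<phi> (s + of_real x * d)))))"
    have mem: "\<bar>Im (s + of_real x * d)\<bar> < pi/2" if "0 \<le> x" "x \<le> 1" for x :: real
    proof -
      have "Im (s + of_real x * d) = (1 - x) * Im s + x * Im s'" by (simp add: d_def algebra_simps)
      moreover have "\<bar>(1 - x) * Im s + x * Im s'\<bar> \<le> (1 - x) * \<bar>Im s\<bar> + x * \<bar>Im s'\<bar>"
        using that by (intro order.trans[OF abs_triangle_ineq]) (simp add: abs_mult)
      moreover have "(1 - x) * \<bar>Im s\<bar> + x * \<bar>Im s'\<bar> < pi/2"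
        using convex_bound_lt[OF s(1,2), of "1 - x" x] that by simp
      ultimately show ?thesis by linarith
    qed
    have dh: "(h has_field_derivative (norm d)^2 * Re (cnj (nrm x1) * D (s + of_real x * d))) (at x)"
      if "0 \<le> x" "x \<le> 1" for x :: real
    proof -
      have "((\<lambda>w. F (\<phi> (s + w * d))) has_field_derivative D (s + of_real x * d) * (0 + 1 * d)) (at (of_real x))"
        by (rule DERIV_chain2[where f = "\<lambda>s. F (\<phi> s)" and g = "\<lambda>w. s + w * d", OF D[OF mem[OF that]]])
           (auto intro!: derivative_eq_intros)
      then have "((\<lambda>y. F (\<phi> (s + of_real y * d))) has_vector_derivative D (s + of_real x * d) * d) (at x)"
        by (auto dest!: has_vector_derivative_real_field)
      then have "((\<lambda>y. cnj (nrm x1) * (cnj d * F (\<phi> (s + of_real y * d)))) has_vector_derivative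
          cnj (nrm x1) * (cnj d * (D (s + of_real x * d) * d))) (at x)"
        by (intro has_vector_derivative_mult_right)
      from bounded_linear.has_vector_derivative[OF bounded_linear_Re this]
      have "(h has_vector_derivative Re (cnj (nrm x1) * (cnj d * (D (s + of_real x * d) * d)))) (at x)"
        by (simp only: h_def)
      also have "cnj (nrm x1) * (cnj d * (D (s + of_real x * d) * d))
          = of_real ((norm d)^2) * (cnj (nrm x1) * D (s + of_real x * d))"
        unfolding complex_norm_square by (simp only: mult_ac)
      finally show ?thesis by (simp add: has_real_derivative_iff_has_vector_derivative)
    qed
    have "h 1 < h 0"
    proof (rule DERIV_neg_imp_decreasing[where f = h and a = 0 and b = 1])
      fix x :: real assume x: "0 \<le> x" "x \<le> 1"
      have "(norm d)^2 * Re (cnj (nrm x1) * D (s + of_real x * d)) < 0"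
        using Dneg[OF mem[OF x]] s(3) by (intro mult_pos_neg) (simp_all add: d_def)
      with dh[OF x] show "\<exists>y. DERIV h x :> y \<and> y < 0" by blast
    qed simp
    then show "Re (cnj (nrm x1) * (cnj (s' - s) * (F (\<phi> s') - F (\<phi> s)))) < 0"
      by (simp add: h_def d_def right_diff_distrib del: complex_cnj_diff)
  qed
qed

text \<open>Along the horizontal ray from the strip point of \<open>z\<close> towards the end
  \<open>cis x1\<close>, the component of \<open>F\<close> in direction \<open>nrm x1\<close>
  increases strictly and tends to its value at \<open>cis x1\<close>.\<close>

lemma support:
  assumes x1: "cis x1 \<notin> Z" and z: "norm z < 1"
  shows "nrm x1 \<bullet> (F z - F (cis x1)) < 0"
proof -
  obtain \<phi> where \<phi>: "\<And>s. \<bar>Im s\<bar> < pi/2 \<Longrightarrow> norm (\<phi> s) < 1"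
    "\<And>z. norm z < 1 \<Longrightarrow> \<exists>s. \<bar>Im s\<bar> < pi/2 \<and> \<phi> s = z"
    "\<And>s. ((\<lambda>x::real. \<phi> (s - of_real x)) \<longlongrightarrow> cis x1) at_top"
    "\<And>s s'. \<bar>Im s\<bar> < pi/2 \<Longrightarrow> \<bar>Im s'\<bar> < pi/2 \<Longrightarrow> s \<noteq> s' \<Longrightarrow>
       Re (cnj (nrm x1) * (cnj (s' - s) * (F (\<phi> s') - F (\<phi> s)))) < 0"
    using strip_decreasing[OF x1] by blast
  obtain s where s: "\<bar>Im s\<bar> < pi/2" "\<phi> s = z" using \<phi>(2)[OF z] by blast
  define u where "u = (\<lambda>x::real. nrm x1 \<bullet> F (\<phi> (s - of_real x)))"
  have u: "u x < u y" if "x < y" for x y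
  proof -
    have "cnj (s - of_real x - (s - of_real y)) = of_real (y - x)" by simp
    then have "(y - x) * (u x - u y) < 0"
      using \<phi>(4)[of "s - of_real y" "s - of_real x"] s(1) that
      by (simp add: u_def inner_Re algebra_simps)
    then show ?thesis using that by (simp add: mult_less_0_iff)
  qed
  have "isCont F (cis x1)"
    using F_deriv[OF disc_minus_subset[OF _ x1]] by (auto intro: DERIV_isCont)
  then have "(u \<longlongrightarrow> nrm x1 \<bullet> F (cis x1)) at_top"
    unfolding u_def by (intro tendsto_intros isCont_tendsto_compose[OF _ \<phi>(3)])
  then have "u 1 \<le> nrm x1 \<bullet> F (cis x1)"
    by (rule tendsto_lowerbound) (use u in \<open>auto intro!: eventually_at_top_linorderI[of 2] less_imp_le\<close>)
  moreover have "u 0 < u 1" by (rule u) simp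
  moreover have "u 0 = nrm x1 \<bullet> F z" by (simp add: u_def s)
  ultimately show ?thesis by (simp add: inner_diff_right)
qed

lemma ex_not_in_Z: "\<exists>x. cis x \<notin> Z"
proof (rule ccontr)
  assume "\<nexists>x. cis x \<notin> Z"
  then have "cis ` {0<..<1} \<subseteq> Z" by auto
  then have "finite (cis ` {0<..<1})" using finite_Z by (rule finite_subset)
  moreover have "inj_on cis {0<..<1}"
  proof (rule inj_onI)
    fix x y :: real assume "x \<in> {0<..<1}" "y \<in> {0<..<1}" "cis x = cis y"
    then show "x = y" using Im_Ln_polar[of 1 x] Im_Ln_polar[of 1 y] pi_gt3 by simp
  qed
  ultimately show False using finite_imageD[of cis "{0<..<1}"] infinite_Ioo[of 0 "1::real"] by simp
qed

text \<open>One regular boundary point suffices: distinct strip points with equal images would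
  contradict the strict inequality of \<open>strip_decreasing\<close>.\<close>

lemma F_inj: "inj_on F (ball 0 1)"
proof (rule inj_onI)
  fix z w assume zw: "z \<in> ball 0 1" "w \<in> ball 0 1" "F z = F w"
  obtain x1 where x1: "cis x1 \<notin> Z" using ex_not_in_Z by blast
  obtain \<phi> where \<phi>: "\<And>s. \<bar>Im s\<bar> < pi/2 \<Longrightarrow> norm (\<phi> s) < 1"
    "\<And>z. norm z < 1 \<Longrightarrow> \<exists>s. \<bar>Im s\<bar> < pi/2 \<and> \<phi> s = z"
    "\<And>s. ((\<lambda>x::real. \<phi> (s - of_real x)) \<longlongrightarrow> cis x1) at_top"
    "\<And>s s'. \<bar>Im s\<bar> < pi/2 \<Longrightarrow> \<bar>Im s'\<bar> < pi/2 \<Longrightarrow> s \<noteq> s' \<Longrightarrow>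
       Re (cnj (nrm x1) * (cnj (s' - s) * (F (\<phi> s') - F (\<phi> s)))) < 0"
    using strip_decreasing[OF x1] by blast
  obtain s s' where s: "\<bar>Im s\<bar> < pi/2" "\<phi> s = z" "\<bar>Im s'\<bar> < pi/2" "\<phi> s' = w"
    using \<phi>(2)[of z] \<phi>(2)[of w] zw by auto
  show "z = w"
  proof (cases "s = s'")
    case True then show ?thesis using s by simp
  next
    case False
    from \<phi>(4)[OF s(1,3) this] show ?thesis using zw(3) s by simp
  qed
qed

end

section \<open>Turning of the boundary\<close>

lemma cis_Arg2pi: "norm \<eta> = 1 \<Longrightarrow> cis (Arg2pi \<eta>) = \<eta>"
  using Arg2pi_eq[of \<eta>] by (simp add: cis_conv_exp)

lemma cis_eq_iff_Ints:
  assumes "norm \<eta> = 1"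
  shows "cis x = \<eta> \<longleftrightarrow> (x - Arg2pi \<eta>) / (2 * pi) \<in> \<int>"
proof -
  have "cis x = \<eta> \<longleftrightarrow> cis (x - Arg2pi \<eta>) = 1"
    using cis_Arg2pi[OF assms] assms by (auto simp: cis_divide[symmetric])
  also have "\<dots> \<longleftrightarrow> (x - Arg2pi \<eta>) / (2 * pi) \<in> \<int>"
    unfolding cis_eq_1_iff by (auto simp: Ints_def field_simps)
  finally show ?thesis .
qed

lemma not_Ints_between:
  fixes y :: real assumes "of_int n < y" "y < of_int n + 1" shows "y \<notin> \<int>"
proof
  assume "y \<in> \<int>"
  then obtain k where k: "y = of_int k" by (auto elim: Ints_cases)
  then have "of_int n < (of_int k :: real)" "(of_int k :: real) < of_int (n + 1)" using assms by auto
  then show False unfolding of_int_less_iff by simp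
qed

lemma floor_at_right:
  fixes x0 \<tau> :: real
  shows "\<forall>\<^sub>F x in at_right x0. \<lfloor>(x - \<tau>) / (2 * pi)\<rfloor> = \<lfloor>(x0 - \<tau>) / (2 * pi)\<rfloor>
    \<and> (x - \<tau>) / (2 * pi) \<notin> \<int>"
proof -
  define n where "n = \<lfloor>(x0 - \<tau>) / (2 * pi)\<rfloor>"
  have n: "of_int n \<le> (x0 - \<tau>) / (2 * pi)" "(x0 - \<tau>) / (2 * pi) < of_int n + 1"
    unfolding n_def by linarith+
  show ?thesis
  proof (rule eventually_at_rightI)
    show "x0 < \<tau> + 2 * pi * (of_int n + 1)" using n(2) by (simp add: field_simps)
    fix x assume x: "x \<in> {x0<..<\<tau> + 2 * pi * (of_int n + 1)}"
    have "(x0 - \<tau>) / (2 * pi) < (x - \<tau>) / (2 * pi)" "(x - \<tau>) / (2 * pi) < of_int n + 1"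
      using x by (auto simp: field_simps)
    then have b: "of_int n < (x - \<tau>) / (2 * pi)" "(x - \<tau>) / (2 * pi) < of_int n + 1" using n by auto
    then have "\<lfloor>(x - \<tau>) / (2 * pi)\<rfloor> = n" by (intro floor_unique) auto
    then show "\<lfloor>(x - \<tau>) / (2 * pi)\<rfloor> = \<lfloor>(x0 - \<tau>) / (2 * pi)\<rfloor> \<and> (x - \<tau>) / (2 * pi) \<notin> \<int>"
      using not_Ints_between[OF b] by (simp add: n_def)
  qed
qed

text \<open>Just to the left of an integer the floor is one lower; this defect becomes the jump of
  \<open>turn\<close> at a vertex.\<close>

lemma floor_at_left:
  fixes x0 \<tau> :: real
  shows "\<forall>\<^sub>F x in at_left x0. \<lfloor>(x - \<tau>) / (2 * pi)\<rfloor>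
      = \<lfloor>(x0 - \<tau>) / (2 * pi)\<rfloor> - (if (x0 - \<tau>) / (2 * pi) \<in> \<int> then 1 else 0)
    \<and> (x - \<tau>) / (2 * pi) \<notin> \<int>"
proof -
  define n where "n = \<lfloor>(x0 - \<tau>) / (2 * pi)\<rfloor> - (if (x0 - \<tau>) / (2 * pi) \<in> \<int> then 1 else 0)"
  have n: "of_int n < (x0 - \<tau>) / (2 * pi)" "(x0 - \<tau>) / (2 * pi) \<le> of_int n + 1"
  proof -
    have "of_int \<lfloor>y\<rfloor> \<le> y" "y \<le> of_int \<lfloor>y\<rfloor> + 1" "y \<notin> \<int> \<Longrightarrow> of_int \<lfloor>y\<rfloor> \<noteq> y"
      "y \<in> \<int> \<Longrightarrow> of_int \<lfloor>y\<rfloor> = y" for y :: real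
      by (linarith, linarith, metis Ints_of_int, simp)
    note a = this[of "(x0 - \<tau>) / (2 * pi)"]
    show "of_int n < (x0 - \<tau>) / (2 * pi)" "(x0 - \<tau>) / (2 * pi) \<le> of_int n + 1"
      unfolding n_def using a by (cases "(x0 - \<tau>) / (2 * pi) \<in> \<int>"; simp; linarith)+
  qed
  show ?thesis
  proof (rule eventually_at_leftI)
    show "\<tau> + 2 * pi * of_int n < x0" using n(1) by (simp add: field_simps)
    fix x assume x: "x \<in> {\<tau> + 2 * pi * of_int n<..<x0}"
    have "(x - \<tau>) / (2 * pi) < (x0 - \<tau>) / (2 * pi)" "of_int n < (x - \<tau>) / (2 * pi)"
      using x by (auto simp: field_simps)
    then have b: "of_int n < (x - \<tau>) / (2 * pi)" "(x - \<tau>) / (2 * pi) < of_int n + 1" using n by auto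
    then have "\<lfloor>(x - \<tau>) / (2 * pi)\<rfloor> = n" by (intro floor_unique) auto
    then show "\<lfloor>(x - \<tau>) / (2 * pi)\<rfloor>
      = \<lfloor>(x0 - \<tau>) / (2 * pi)\<rfloor> - (if (x0 - \<tau>) / (2 * pi) \<in> \<int> then 1 else 0)
        \<and> (x - \<tau>) / (2 * pi) \<notin> \<int>"
      using not_Ints_between[OF b] by (simp add: n_def)
  qed
qed

context sc_map begin

text \<open>The weighted count of points of \<open>Z\<close> passed up to the argument
  \<open>x\<close>. It is right-continuous, jumps by \<open>t \<eta>\<close> at
  \<open>\<eta>\<close> and grows by \<open>1\<close> in each period; \<open>2 * pi * turn x\<close>
  is the angle by which the normal has turned away from \<open>base_dir\<close>.\<close>

definition turn :: "real \<Rightarrow> real" where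
  "turn x = (\<Sum>\<eta>\<in>Z. t \<eta> * of_int \<lfloor>(x - Arg2pi \<eta>) / (2 * pi)\<rfloor>)"

definition base_dir :: complex where
  "base_dir = sgn C * cis ((\<Sum>\<eta>\<in>Z. t \<eta> * Arg2pi \<eta>) + pi)"

lemma norm_base_dir [simp]: "norm base_dir = 1"
  by (simp add: base_dir_def norm_mult norm_sgn C_nz)

text \<open>Because the weights sum to \<open>1\<close>, the explicit \<open>x\<close> in
  \<open>nrm\<close> cancels against the half-angles of the logarithms. Only the floors still depend
  on \<open>x\<close>, so the normal is constant along each arc between points of
  \<open>Z\<close>.\<close>

lemma nrm_turn:
  assumes "cis x \<notin> Z"
  shows "nrm x = base_dir * cis (2 * pi * turn x)"
proof -
  have a: "Im (Ln (1 - cnj \<eta> * cis x))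
      = (x - Arg2pi \<eta> - 2 * pi * of_int \<lfloor>(x - Arg2pi \<eta>) / (2 * pi)\<rfloor> - pi) / 2" if "\<eta> \<in> Z" for \<eta>
  proof -
    have e: "cnj \<eta> * cis x = cis (x - Arg2pi \<eta>)"
      by (subst cis_Arg2pi[OF norm_Z[OF that], symmetric]) (simp add: cis_cnj cis_mult)
    have "cis (x - Arg2pi \<eta>) \<noteq> 1"
    proof
      assume "cis (x - Arg2pi \<eta>) = 1"
      then have "cis x = cis (Arg2pi \<eta>)" by (simp add: cis_divide[symmetric])
      then show False using cis_Arg2pi[OF norm_Z[OF that]] that assms by simp
    qed
    then show ?thesis unfolding e by (rule Im_Ln_one_minus_cis)
  qed
  have "Im (- 2 * sc_log Z t (cis x)) = (\<Sum>\<eta>\<in>Z. - 2 * (t \<eta> * Im (Ln (1 - cnj \<eta> * cis x))))"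
    by (simp add: sc_log_def sum_distrib_left)
  also have "\<dots> = (\<Sum>\<eta>\<in>Z. t \<eta> * Arg2pi \<eta> + 2 * pi * (t \<eta> * of_int \<lfloor>(x - Arg2pi \<eta>) / (2 * pi)\<rfloor>)
      + (pi - x) * t \<eta>)"
    by (intro sum.cong refl) (subst a, assumption, simp add: field_simps)
  also have "\<dots> = (\<Sum>\<eta>\<in>Z. t \<eta> * Arg2pi \<eta>) + 2 * pi * turn x + (pi - x)"
    by (simp add: sum.distrib sum_distrib_left[symmetric] t_sum turn_def)
  finally have "x + Im (- 2 * sc_log Z t (cis x)) = (\<Sum>\<eta>\<in>Z. t \<eta> * Arg2pi \<eta>) + pi + 2 * pi * turn x"
    by argo
  then have "nrm x = sgn C * cis ((\<Sum>\<eta>\<in>Z. t \<eta> * Arg2pi \<eta>) + pi + 2 * pi * turn x)"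
    unfolding nrm_def by (rule arg_cong)
  then show ?thesis by (simp add: base_dir_def cis_mult mult.assoc)
qed

lemma turn_at_right: "\<forall>\<^sub>F x in at_right x0. turn x = turn x0 \<and> cis x \<notin> Z"
proof -
  have "\<forall>\<^sub>F x in at_right x0. \<forall>\<eta>\<in>Z. \<lfloor>(x - Arg2pi \<eta>) / (2 * pi)\<rfloor> = \<lfloor>(x0 - Arg2pi \<eta>) / (2 * pi)\<rfloor>
      \<and> (x - Arg2pi \<eta>) / (2 * pi) \<notin> \<int>"
    using finite_Z by (intro eventually_ball_finite ballI floor_at_right)
  then show ?thesis
  proof eventually_elim
    case (elim x)
    then have "cis x \<notin> Z" using cis_eq_iff_Ints norm_Z by blast
    moreover have "turn x = turn x0" unfolding turn_def using elim by (intro sum.cong) auto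
    ultimately show ?case by simp
  qed
qed

lemma turn_at_left:
  "\<forall>\<^sub>F x in at_left x0. turn x = turn x0 - (if cis x0 \<in> Z then t (cis x0) else 0) \<and> cis x \<notin> Z"
proof -
  have "\<forall>\<^sub>F x in at_left x0. \<forall>\<eta>\<in>Z. \<lfloor>(x - Arg2pi \<eta>) / (2 * pi)\<rfloor> = \<lfloor>(x0 - Arg2pi \<eta>) / (2 * pi)\<rfloor>
        - (if (x0 - Arg2pi \<eta>) / (2 * pi) \<in> \<int> then 1 else 0)
      \<and> (x - Arg2pi \<eta>) / (2 * pi) \<notin> \<int>"
    using finite_Z by (intro eventually_ball_finite ballI floor_at_left)
  then show ?thesis
  proof eventually_elim
    case (elim x)
    then have "cis x \<notin> Z" using cis_eq_iff_Ints norm_Z by blast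
    moreover have "turn x = (\<Sum>\<eta>\<in>Z. t \<eta> * of_int \<lfloor>(x0 - Arg2pi \<eta>) / (2 * pi)\<rfloor>
        - (if \<eta> = cis x0 then t \<eta> else 0))"
      unfolding turn_def
    proof (intro sum.cong refl)
      fix \<eta> assume \<eta>: "\<eta> \<in> Z"
      have e: "\<lfloor>(x - Arg2pi \<eta>) / (2 * pi)\<rfloor> = \<lfloor>(x0 - Arg2pi \<eta>) / (2 * pi)\<rfloor> - (if cis x0 = \<eta> then 1 else 0)"
        using elim \<eta> cis_eq_iff_Ints[OF norm_Z[OF \<eta>], of x0] by simp
      show "t \<eta> * of_int \<lfloor>(x - Arg2pi \<eta>) / (2 * pi)\<rfloor>
          = t \<eta> * of_int \<lfloor>(x0 - Arg2pi \<eta>) / (2 * pi)\<rfloor> - (if \<eta> = cis x0 then t \<eta> else 0)"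
        unfolding e by (auto simp: algebra_simps)
    qed
    moreover have "\<dots> = turn x0 - (if cis x0 \<in> Z then t (cis x0) else 0)"
      using finite_Z by (simp add: turn_def sum_subtractf)
    ultimately show ?case by simp
  qed
qed

text \<open>The velocity of \<open>F (cis x)\<close> is a positive multiple of
  \<open>\<i> * nrm x\<close>. Where the normal is a constant \<open>n\<close>, the image point
  therefore travels strictly forward along a line in direction \<open>\<i> * n\<close>.\<close>

lemma boundary_motion:
  assumes ab: "a < b" and no: "\<And>x. a \<le> x \<Longrightarrow> x \<le> b \<Longrightarrow> cis x \<notin> Z \<and> nrm x = n"
  shows "n \<bullet> F (cis b) = n \<bullet> F (cis a)" "(\<i> * n) \<bullet> F (cis a) < (\<i> * n) \<bullet> F (cis b)"
proof -
  define R where "R = (\<lambda>x. norm C * exp (Re (- 2 * sc_log Z t (cis x))))"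
  have R: "0 < R x" for x using C_nz by (simp add: R_def)
  have n: "n \<noteq> 0" using no[of a] ab norm_nrm[of a] by auto
  have d: "((\<lambda>x. F (cis x)) has_vector_derivative of_real (R x) * (\<i> * n)) (at x)"
    if "a \<le> x" "x \<le> b" for x
  proof -
    have "cis x \<in> sc_dom Z" using no[OF that] by (intro disc_minus_subset) auto
    have "((\<lambda>x. cis x) has_vector_derivative \<i> * cis x) (at x)"
      unfolding cis_conv_exp
      by (rule has_vector_derivative_real_field) (auto intro!: derivative_eq_intros)
    from field_vector_diff_chain_at[OF this F_deriv[OF \<open>cis x \<in> sc_dom Z\<close>]]
    have "((\<lambda>x. F (cis x)) has_vector_derivative \<i> * (cis x * (C * exp (- 2 * sc_log Z t (cis x))))) (at x)"
      by (simp add: o_def mult_ac)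
    also have "\<i> * (cis x * (C * exp (- 2 * sc_log Z t (cis x)))) = of_real (R x) * (\<i> * n)"
      unfolding nrm_eq using no[OF that] by (simp add: R_def)
    finally show ?thesis .
  qed
  have d1: "((\<lambda>x. m \<bullet> F (cis x)) has_real_derivative m \<bullet> (of_real (R x) * (\<i> * n))) (at x)"
    if "a \<le> x" "x \<le> b" for x m
    using bounded_linear.has_vector_derivative[OF bounded_linear_inner_right d[OF that], of m]
    by (simp add: has_real_derivative_iff_has_vector_derivative)
  have z: "n \<bullet> (of_real r * (\<i> * n)) = 0" "(\<i> * n) \<bullet> (of_real r * (\<i> * n)) = r * (norm n)^2" for r
    unfolding cmod_power2 by (auto simp: inner_complex_def power2_eq_square algebra_simps)
  show "n \<bullet> F (cis b) = n \<bullet> F (cis a)"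
  proof (rule DERIV_isconst_end[where f = "\<lambda>x. n \<bullet> F (cis x)", OF ab])
    show "continuous_on {a..b} (\<lambda>x. n \<bullet> F (cis x))"
      using d1 by (intro continuous_at_imp_continuous_on ballI DERIV_isCont) auto
    show "DERIV (\<lambda>x. n \<bullet> F (cis x)) x :> 0" if "a < x" "x < b" for x
      using d1[of x n] that z by simp
  qed
  show "(\<i> * n) \<bullet> F (cis a) < (\<i> * n) \<bullet> F (cis b)"
  proof (rule DERIV_pos_imp_increasing[where f = "\<lambda>x. (\<i> * n) \<bullet> F (cis x)", OF ab])
    fix x assume "a \<le> x" "x \<le> b"
    from d1[OF this, of "\<i> * n"] show "\<exists>y. DERIV (\<lambda>x. (\<i> * n) \<bullet> F (cis x)) x :> y \<and> 0 < y"
      using R n unfolding z by (intro exI conjI) auto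
  qed
qed

end

section \<open>Behaviour at the vertices\<close>

lemma norm_at_0: "filterlim norm (at_right 0) (at (0::'a::real_normed_vector))"
  unfolding filterlim_at
  using tendsto_norm[OF tendsto_ident_at, of 0 UNIV] by (auto simp: eventually_at_filter)

lemma exp_Ln_tendsto_0:
  assumes "0 < \<beta>"
  shows "((\<lambda>w. exp (of_real \<beta> * Ln w)) \<longlongrightarrow> 0) (at (0::complex))"
proof (rule tendsto_norm_zero_cancel, rule Lim_transform_eventually)
  have "((\<lambda>x::real. x powr \<beta>) \<longlongrightarrow> 0) (at_right 0)" using assms by real_asymp
  then show "((\<lambda>w::complex. norm w powr \<beta>) \<longlongrightarrow> 0) (at 0)"
    using norm_at_0 by (rule filterlim_compose)
  show "\<forall>\<^sub>F w in at 0. norm w powr \<beta> = norm (exp (of_real \<beta> * Ln w))"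
    by (intro eventually_at_filter[THEN iffD2] always_eventually) (auto simp: powr_def)
qed

lemma exp_Ln_at_infinity:
  assumes "\<beta> < 0"
  shows "filterlim (\<lambda>w. exp (of_real \<beta> * Ln w)) at_infinity (at (0::complex))"
proof (rule filterlim_norm_at_top_imp_at_infinity, rule filterlim_at_top_mono)
  have "filterlim (\<lambda>x::real. x powr \<beta>) at_top (at_right 0)" using assms by real_asymp
  then show "filterlim (\<lambda>w::complex. norm w powr \<beta>) at_top (at 0)"
    using norm_at_0 by (rule filterlim_compose)
  show "\<forall>\<^sub>F w in at 0. norm w powr \<beta> \<le> norm (exp (of_real \<beta> * Ln w))"
    by (intro eventually_at_filter[THEN iffD2] always_eventually) (auto simp: powr_def)
qed

lemma Ln_at_infinity: "filterlim Ln at_infinity (at 0)"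
proof (rule filterlim_norm_at_top_imp_at_infinity, rule filterlim_at_top_mono)
  have "filterlim (\<lambda>x::real. - ln x) at_top (at_right 0)" by real_asymp
  then show "filterlim (\<lambda>w::complex. - ln (norm w)) at_top (at 0)"
    using norm_at_0 by (rule filterlim_compose)
  show "\<forall>\<^sub>F w in at 0. - ln (norm w) \<le> norm (Ln w)"
  proof (intro eventually_at_filter[THEN iffD2] always_eventually allI impI)
    fix w :: complex assume "w \<noteq> 0"
    then show "- ln (norm w) \<le> norm (Ln w)" using abs_Re_le_cmod[of "Ln w"] by simp
  qed
qed

lemma mult_Ln_tendsto_0: "((\<lambda>w. w * Ln w) \<longlongrightarrow> 0) (at 0)"
proof (rule Lim_null_comparison)
  have "((\<lambda>x::real. x * (\<bar>ln x\<bar> + pi)) \<longlongrightarrow> 0) (at_right 0)" by real_asymp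
  then show "((\<lambda>w::complex. norm w * (\<bar>ln (norm w)\<bar> + pi)) \<longlongrightarrow> 0) (at 0)"
    using norm_at_0 by (rule filterlim_compose)
  show "\<forall>\<^sub>F w in at 0. norm (w * Ln w) \<le> norm w * (\<bar>ln (norm w)\<bar> + pi)"
  proof (intro eventually_at_filter[THEN iffD2] always_eventually allI impI)
    fix w :: complex assume "w \<noteq> 0"
    then have "norm (Ln w) \<le> \<bar>ln (norm w)\<bar> + pi"
      using cmod_le[of "Ln w"] abs_Im_le_cmod Im_Ln_le_pi[of w] mpi_less_Im_Ln[of w] by simp
    then show "norm (w * Ln w) \<le> norm w * (\<bar>ln (norm w)\<bar> + pi)"
      unfolding norm_mult by (intro mult_left_mono) auto
  qed
qed

text \<open>Used to integrate by parts near a vertex until the remainder is bounded.\<close>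

lemma twofold_antiderivative:
  fixes \<alpha> :: real
  assumes \<alpha>: "0 < \<alpha>" "\<alpha> < 2"
  obtains g0 g1 :: "complex \<Rightarrow> complex" where
    "\<And>w. w \<notin> \<real>\<^sub>\<le>\<^sub>0 \<Longrightarrow> (g0 has_field_derivative exp (- of_real \<alpha> * Ln w)) (at w)"
    "\<And>w. w \<notin> \<real>\<^sub>\<le>\<^sub>0 \<Longrightarrow> (g1 has_field_derivative g0 w) (at w)"
    "(g1 \<longlongrightarrow> 0) (at 0)"
    "\<alpha> < 1 \<Longrightarrow> (g0 \<longlongrightarrow> 0) (at 0)"
    "1 \<le> \<alpha> \<Longrightarrow> filterlim g0 at_infinity (at 0)"
proof (cases "\<alpha> = 1")
  case True
  have e: "exp (- Ln w) = 1 / w" if "w \<noteq> 0" for w using that by (simp add: exp_minus field_simps)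
  show ?thesis
  proof (rule that[of Ln "\<lambda>w. w * Ln w - w"])
    show "(Ln has_field_derivative exp (- of_real \<alpha> * Ln w)) (at w)" if "w \<notin> \<real>\<^sub>\<le>\<^sub>0" for w
    proof -
      have "w \<noteq> 0" using that by auto
      then show ?thesis using has_field_derivative_Ln[OF that] True e[of w] by (simp add: divide_inverse)
    qed
    show "((\<lambda>w. w * Ln w - w) has_field_derivative Ln w) (at w)" if "w \<notin> \<real>\<^sub>\<le>\<^sub>0" for w
    proof -
      have "w \<noteq> 0" using that by auto
      then show ?thesis using that by (auto intro!: derivative_eq_intros)
    qed
    show "((\<lambda>w. w * Ln w - w) \<longlongrightarrow> 0) (at 0)"
      using tendsto_diff[OF mult_Ln_tendsto_0 tendsto_ident_at] by simp
  qed (use True Ln_at_infinity in auto)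
next
  case False
  define E where "E = (\<lambda>\<beta> w. exp (of_real \<beta> * Ln w))"
  have E: "(E \<beta> has_field_derivative of_real \<beta> * E (\<beta> - 1) w) (at w)" if "w \<notin> \<real>\<^sub>\<le>\<^sub>0" for \<beta> w
  proof -
    have w: "w \<noteq> 0" using that by auto
    have "E (\<beta> - 1) w = E \<beta> w / w"
      using w by (simp add: E_def left_diff_distrib exp_diff)
    moreover have "(E \<beta> has_field_derivative E \<beta> w * (of_real \<beta> * (1 / w))) (at w)"
      unfolding E_def using that w by (auto intro!: derivative_eq_intros simp: field_simps)
    ultimately show ?thesis by (simp add: mult_ac)
  qed
  have nz: "complex_of_real (1 - \<alpha>) \<noteq> 0" "complex_of_real (2 - \<alpha>) \<noteq> 0"
    using False \<alpha> by (auto simp del: of_real_diff)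
  show ?thesis
  proof (rule that[of "\<lambda>w. E (1 - \<alpha>) w / of_real (1 - \<alpha>)"
        "\<lambda>w. E (2 - \<alpha>) w / of_real (2 - \<alpha>) / of_real (1 - \<alpha>)"])
    fix w :: complex assume w: "w \<notin> \<real>\<^sub>\<le>\<^sub>0"
    show "((\<lambda>w. E (1 - \<alpha>) w / of_real (1 - \<alpha>)) has_field_derivative exp (- of_real \<alpha> * Ln w)) (at w)"
      using DERIV_cdivide[OF E[OF w, of "1 - \<alpha>"], of "of_real (1 - \<alpha>)"] nz
      by (simp add: E_def del: of_real_diff)
    show "((\<lambda>w. E (2 - \<alpha>) w / of_real (2 - \<alpha>) / of_real (1 - \<alpha>)) has_field_derivative
        E (1 - \<alpha>) w / of_real (1 - \<alpha>)) (at w)"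
      using DERIV_cdivide[OF DERIV_cdivide[OF E[OF w, of "2 - \<alpha>"], of "of_real (2 - \<alpha>)"], of "of_real (1 - \<alpha>)"] nz
      by (simp del: of_real_diff)
  next
    have "(E (2 - \<alpha>) \<longlongrightarrow> 0) (at 0)" unfolding E_def using \<alpha> by (intro exp_Ln_tendsto_0) auto
    from tendsto_divide_0[OF tendsto_divide_zero[OF this]]
    show "((\<lambda>w. E (2 - \<alpha>) w / of_real (2 - \<alpha>) / of_real (1 - \<alpha>)) \<longlongrightarrow> 0) (at 0)"
      using tendsto_divide_zero[OF tendsto_divide_zero[OF \<open>(E (2 - \<alpha>) \<longlongrightarrow> 0) (at 0)\<close>]] by blast
  next
    assume "\<alpha> < 1"
    then have "(E (1 - \<alpha>) \<longlongrightarrow> 0) (at 0)" unfolding E_def by (intro exp_Ln_tendsto_0) auto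
    then show "((\<lambda>w. E (1 - \<alpha>) w / of_real (1 - \<alpha>)) \<longlongrightarrow> 0) (at 0)" by (rule tendsto_divide_zero)
  next
    assume "1 \<le> \<alpha>"
    then have "filterlim (E (1 - \<alpha>)) at_infinity (at 0)"
      unfolding E_def using False by (intro exp_Ln_at_infinity) auto
    from tendsto_mult_filterlim_at_infinity[OF tendsto_const _ this, of "1 / of_real (1 - \<alpha>)"]
    show "filterlim (\<lambda>w. E (1 - \<alpha>) w / of_real (1 - \<alpha>)) at_infinity (at 0)"
      using nz by (simp add: divide_inverse mult.commute del: of_real_diff)
  qed
qed

text \<open>On a convex set a bounded derivative makes \<open>G\<close> Lipschitz, hence uniformly
  continuous and extendable to the closure.\<close>

lemma bounded_derivative_limit:
  fixes G :: "complex \<Rightarrow> complex"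
  assumes T: "convex T" "open T" "\<zeta> \<in> closure T"
    and d: "\<And>z. z \<in> T \<Longrightarrow> (G has_field_derivative G' z) (at z)"
    and M: "\<And>z. z \<in> T \<Longrightarrow> norm (G' z) \<le> M"
  obtains l where "(G \<longlongrightarrow> l) (at \<zeta> within T)"
proof -
  have lip: "norm (G x - G y) \<le> M * norm (x - y)" if "x \<in> T" "y \<in> T" for x y
    using field_differentiable_bound[OF T(1) _ M that] d
    by (meson has_field_derivative_at_within)
  have "uniformly_continuous_on T G"
    unfolding uniformly_continuous_on_def
  proof (intro allI impI)
    fix e :: real assume "0 < e"
    have K: "0 < \<bar>M\<bar> + 1" by simp
    show "\<exists>d>0. \<forall>x\<in>T. \<forall>x'\<in>T. dist x' x < d \<longrightarrow> dist (G x') (G x) < e"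
    proof (intro exI[of _ "e / (\<bar>M\<bar> + 1)"] conjI ballI impI)
      show "0 < e / (\<bar>M\<bar> + 1)" using \<open>0 < e\<close> K by simp
      fix x x' assume *: "x \<in> T" "x' \<in> T" "dist x' x < e / (\<bar>M\<bar> + 1)"
      have "dist (G x') (G x) \<le> M * norm (x' - x)" using lip[OF *(2,1)] by (simp add: dist_norm)
      also have "\<dots> \<le> (\<bar>M\<bar> + 1) * norm (x' - x)" by (intro mult_right_mono) auto
      also have "\<dots> < e" using *(3) K by (simp add: dist_norm field_simps)
      finally show "dist (G x') (G x) < e" .
    qed
  qed
  then obtain l where "(G \<longlongrightarrow> l) (at \<zeta> within T)"
    using uniformly_continuous_on_extension_at_closure[OF _ T(3)] by blast
  then show ?thesis by (rule that)
qed

context sc_map begin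

lemma t_less_1:
  assumes "\<zeta> \<in> Z" shows "t \<zeta> < 1"
proof -
  have "Z - {\<zeta>} \<noteq> {}"
  proof
    assume "Z - {\<zeta>} = {}"
    then have "Z \<subseteq> {\<zeta>}" by auto
    then have "card Z \<le> card {\<zeta>}" by (intro card_mono) auto
    then show False using card_Z by simp
  qed
  then have "0 < sum t (Z - {\<zeta>})" using finite_Z t_pos by (intro sum_pos) auto
  then show ?thesis using sum.remove[OF finite_Z assms, of t] t_sum by simp
qed

text \<open>Near \<open>\<zeta>\<close> the derivative is
  \<open>h z * exp (- of_real \<alpha> * Ln (q z))\<close> with \<open>h\<close> analytic and
  nonzero at \<open>\<zeta>\<close> and \<open>\<alpha> = 2 * t \<zeta> < 2\<close>, so
  \<open>F\<close> behaves like a primitive of that power. The limit is taken in the half-plane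
  bounded by the tangent at \<open>\<zeta>\<close>, which contains the adjacent parts of the circle
  as well as the disk.\<close>

lemma vertex_behaviour:
  assumes \<zeta>: "\<zeta> \<in> Z"
  shows "(t \<zeta> < 1/2 \<longrightarrow> (\<exists>v. (F \<longlongrightarrow> v) (at \<zeta> within {z. Re (cnj \<zeta> * z) < 1})))
    \<and> (1/2 \<le> t \<zeta> \<longrightarrow> filterlim F at_infinity (at \<zeta> within {z. Re (cnj \<zeta> * z) < 1}))"
proof -
  define H where "H = {z. Re (cnj \<zeta> * z) < 1}"
  define W where "W = sc_dom (Z - {\<zeta>})"
  define q where "q = (\<lambda>z. 1 - cnj \<zeta> * z)"
  define h where "h = (\<lambda>z. C * exp (- 2 * sc_log (Z - {\<zeta>}) t z))"
  define \<alpha> where "\<alpha> = 2 * t \<zeta>"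
  have n\<zeta>: "norm \<zeta> = 1" using norm_Z \<zeta> by simp
  have cc: "\<zeta> * cnj \<zeta> = 1" using n\<zeta> by (simp add: complex_norm_square[symmetric])
  have cc': "\<zeta> * (cnj \<zeta> * w) = w" "cnj \<zeta> * (\<zeta> * w) = w" for w
    using cc by (simp_all add: mult.assoc[symmetric] mult.commute[of "cnj \<zeta>"])
  have \<alpha>: "0 < \<alpha>" "\<alpha> < 2" using t_pos[OF \<zeta>] t_less_1[OF \<zeta>] by (auto simp: \<alpha>_def)
  have qH: "q z \<notin> \<real>\<^sub>\<le>\<^sub>0" if "z \<in> H" for z
    using that by (auto simp: H_def q_def complex_nonpos_Reals_iff)
  have opW: "open W" unfolding W_def using finite_Z by (intro open_sc_dom) auto
  have "\<zeta> \<in> W" unfolding W_def using n\<zeta> norm_Z by (intro disc_minus_subset_sc_dom) auto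
  have hol: "h holomorphic_on W"
    unfolding h_def W_def by (intro holomorphic_intros holomorphic_sc_log)
  have hol1: "deriv h holomorphic_on W" using hol opW by (rule holomorphic_deriv)
  have hol2: "deriv (deriv h) holomorphic_on W" using hol1 opW by (rule holomorphic_deriv)
  have F': "(F has_field_derivative h z * exp (- of_real \<alpha> * Ln (q z))) (at z)" if "z \<in> H" "z \<in> W" for z
  proof -
    have "z \<in> sc_dom Z" using that qH[of z] by (auto simp: sc_dom_def W_def q_def)
    moreover have "sc_log Z t z = of_real (t \<zeta>) * Ln (q z) + sc_log (Z - {\<zeta>}) t z"
      unfolding sc_log_def q_def by (rule sum.remove[OF finite_Z \<zeta>])
    then have "C * exp (- 2 * sc_log Z t z) = h z * exp (- of_real \<alpha> * Ln (q z))"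
      unfolding h_def \<alpha>_def by (simp add: algebra_simps flip: exp_add)
    ultimately show ?thesis using F_deriv[of z] by simp
  qed
  obtain g0 g1 where
    g0: "\<And>w. w \<notin> \<real>\<^sub>\<le>\<^sub>0 \<Longrightarrow> (g0 has_field_derivative exp (- of_real \<alpha> * Ln w)) (at w)" and
    g1: "\<And>w. w \<notin> \<real>\<^sub>\<le>\<^sub>0 \<Longrightarrow> (g1 has_field_derivative g0 w) (at w)" and
    g1_lim: "(g1 \<longlongrightarrow> 0) (at 0)" and
    g0_lim: "\<alpha> < 1 \<Longrightarrow> (g0 \<longlongrightarrow> 0) (at 0)" "1 \<le> \<alpha> \<Longrightarrow> filterlim g0 at_infinity (at 0)"
    by (rule twofold_antiderivative[OF \<alpha>]) blast
  define G0 where "G0 = (\<lambda>z. - \<zeta> * g0 (q z))"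
  define G1 where "G1 = (\<lambda>z. \<zeta>^2 * g1 (q z))"
  have q': "(q has_field_derivative - cnj \<zeta>) (at z)" for z
    unfolding q_def by (auto intro!: derivative_eq_intros)
  have G0: "(G0 has_field_derivative exp (- of_real \<alpha> * Ln (q z))) (at z)" if "z \<in> H" for z
    unfolding G0_def using DERIV_cmult[OF DERIV_chain2[OF g0[OF qH[OF that]] q'], of "- \<zeta>"]
    by (simp add: mult_ac cc')
  have G1: "(G1 has_field_derivative G0 z) (at z)" if "z \<in> H" for z
    unfolding G0_def G1_def using DERIV_cmult[OF DERIV_chain2[OF g1[OF qH[OF that]] q'], of "\<zeta>^2"]
    by (simp add: mult_ac power2_eq_square cc')
  have q0: "q \<zeta> = 0" unfolding q_def using cc by (simp add: mult.commute)
  have qz: "q z \<noteq> 0" if "z \<noteq> \<zeta>" for z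
  proof
    assume "q z = 0"
    then have "\<zeta> * (cnj \<zeta> * z) = \<zeta>" by (simp add: q_def)
    then show False using that cc by (simp add: mult.assoc[symmetric])
  qed
  have q_lim: "filterlim q (at 0) (at \<zeta>)"
  proof (rule filterlim_atI)
    show "(q \<longlongrightarrow> 0) (at \<zeta>)" using DERIV_isCont[OF q', of \<zeta>] q0 unfolding isCont_def by metis
    show "\<forall>\<^sub>F z in at \<zeta>. q z \<noteq> 0" using qz by (auto simp: eventually_at_filter)
  qed
  have G1_lim: "(G1 \<longlongrightarrow> 0) (at \<zeta>)"
    unfolding G1_def using tendsto_mult_right_zero[OF filterlim_compose[OF g1_lim q_lim]] by blast
  obtain e where e: "0 < e" "cball \<zeta> e \<subseteq> W"
    using opW \<open>\<zeta> \<in> W\<close> by (meson open_contains_cball_eq)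
  have "\<forall>\<^sub>F z in at \<zeta>. norm (G1 z) < 1"
    using order_tendstoD(2)[OF tendsto_norm_zero[OF G1_lim], of 1] by simp
  then obtain e' where e': "0 < e'" "\<And>z. z \<noteq> \<zeta> \<Longrightarrow> dist z \<zeta> < e' \<Longrightarrow> norm (G1 z) < 1"
    by (auto simp: eventually_at)
  define d where "d = min e e'"
  have d: "0 < d" using e e' by (simp add: d_def)
  define T where "T = ball \<zeta> d \<inter> H"
  have TW: "z \<in> W" if "z \<in> T" for z using that e by (auto simp: T_def d_def)
  have \<zeta>H: "\<zeta> \<notin> H" using cc'(2)[of 1] by (simp add: H_def del: times_complex.simps)
  have G1b: "norm (G1 z) \<le> 1" if "z \<in> T" for z
    using that e'(2)[of z] \<zeta>H by (fastforce simp: T_def d_def dist_commute)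
  have "compact (deriv (deriv h) ` cball \<zeta> e)"
    using holomorphic_on_imp_continuous_on[OF holomorphic_on_subset[OF hol2 e(2)]]
    by (intro compact_continuous_image) auto
  then obtain M where M: "\<And>z. z \<in> cball \<zeta> e \<Longrightarrow> norm (deriv (deriv h) z) \<le> M"
    by (meson compact_imp_bounded bounded_iff imageI)
  \<comment> \<open>The outcome of two integrations by parts: the derivative of \<open>G\<close> is
    \<open>deriv (deriv h) z * G1 z\<close>, which is bounded on \<open>T\<close>. As
    \<open>G1\<close> tends to \<open>0\<close>, the behaviour of \<open>F\<close> is that of
    \<open>h z * G0 z\<close> up to a term with a finite limit.\<close>
  define G where "G = (\<lambda>z. F z - h z * G0 z + deriv h z * G1 z)"
  have "convex H" "open H"
  proof -
    have "H = {z. \<zeta> \<bullet> z < 1}" by (auto simp: H_def inner_Re)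
    then show "convex H" "open H" by (simp_all add: convex_halfspace_lt open_halfspace_lt)
  qed
  have T: "convex T" "open T" using \<open>convex H\<close> \<open>open H\<close> by (auto simp: T_def convex_Int)
  have \<zeta>T: "\<zeta> \<in> closure T"
  proof (unfold closure_approachable, intro allI impI)
    fix \<epsilon> :: real assume \<epsilon>: "0 < \<epsilon>"
    define s where "s = min d \<epsilon> / 2"
    have s: "0 < s" "s < d" "s < \<epsilon>" using d \<epsilon> by (auto simp: s_def)
    have n: "dist (of_real (1 - s) * \<zeta>) \<zeta> = s"
      using s n\<zeta> by (simp add: dist_norm left_diff_distrib norm_mult)
    have "cnj \<zeta> * (of_real (1 - s) * \<zeta>) = of_real (1 - s)"
      using cc'(2)[of "of_real (1 - s)"] by (simp only: mult_ac)
    then have "Re (cnj \<zeta> * (of_real (1 - s) * \<zeta>)) < 1" using s by (simp only: Re_complex_of_real)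
    then have "of_real (1 - s) * \<zeta> \<in> T"
      using s n unfolding T_def H_def Int_iff mem_Collect_eq mem_ball by (simp only: dist_commute)
    then show "\<exists>y\<in>T. dist y \<zeta> < \<epsilon>" using n s by metis
  qed
  have dG: "(G has_field_derivative deriv (deriv h) z * G1 z) (at z)" if "z \<in> T" for z
  proof -
    have z: "z \<in> H" "z \<in> W" using that TW by (auto simp: T_def)
    have "(h has_field_derivative deriv h z) (at z)" "(deriv h has_field_derivative deriv (deriv h) z) (at z)"
      using hol hol1 opW z(2) by (auto intro: holomorphic_derivI)
    then show ?thesis
      unfolding G_def using F'[OF z] G0[OF z(1)] G1[OF z(1)]
      by (auto intro!: derivative_eq_intros simp: algebra_simps)
  qed
  have bG: "norm (deriv (deriv h) z * G1 z) \<le> M" if "z \<in> T" for z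
  proof -
    have *: "norm (deriv (deriv h) z) \<le> M" using M that by (auto simp: T_def d_def)
    have "norm (deriv (deriv h) z) * norm (G1 z) \<le> M * 1"
      by (rule mult_mono[OF * G1b[OF that] order.trans[OF norm_ge_zero *] norm_ge_zero])
    then show ?thesis by (simp add: norm_mult)
  qed
  obtain l where l: "(G \<longlongrightarrow> l) (at \<zeta> within T)"
    by (rule bounded_derivative_limit[OF T \<zeta>T dG bG])
  have HT: "at \<zeta> within H = at \<zeta> within T"
    by (rule at_within_nhd[of _ "ball \<zeta> d"]) (use d in \<open>auto simp: T_def\<close>)
  have within: "at \<zeta> within T \<le> at \<zeta>" by (simp add: at_le)
  have G1T: "(G1 \<longlongrightarrow> 0) (at \<zeta> within T)" using G1_lim within by (rule tendsto_mono[rotated])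
  have qT: "filterlim q (at 0) (at \<zeta> within T)" using q_lim within by (rule filterlim_mono[OF _ order_refl])
  have ct: "(f \<longlongrightarrow> f \<zeta>) (at \<zeta> within T)" if "f holomorphic_on W" for f
    using that opW \<open>\<zeta> \<in> W\<close> within
    by (metis at_within_open continuous_on_def holomorphic_on_imp_continuous_on tendsto_mono)
  have rest: "((\<lambda>z. G z - deriv h z * G1 z) \<longlongrightarrow> l - deriv h \<zeta> * 0) (at \<zeta> within T)"
    by (intro tendsto_intros l G1T ct hol1)
  have Feq: "F = (\<lambda>z. (G z - deriv h z * G1 z) + h z * G0 z)" by (simp add: G_def)
  have hz: "h \<zeta> \<noteq> 0" using C_nz by (simp add: h_def)
  have \<zeta>0: "- \<zeta> \<noteq> 0" using n\<zeta> by auto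
  show ?thesis
    unfolding H_def[symmetric] HT
  proof (intro conjI impI)
    assume "t \<zeta> < 1/2"
    then have "((\<lambda>z. g0 (q z)) \<longlongrightarrow> 0) (at \<zeta> within T)"
      using g0_lim(1) qT by (intro filterlim_compose[OF _ qT]) (simp add: \<alpha>_def)
    then have "((\<lambda>z. (G z - deriv h z * G1 z) + h z * G0 z) \<longlongrightarrow> (l - deriv h \<zeta> * 0) + h \<zeta> * (- \<zeta> * 0)) (at \<zeta> within T)"
      unfolding G0_def by (intro tendsto_add rest tendsto_mult ct hol tendsto_const)
    then show "\<exists>v. (F \<longlongrightarrow> v) (at \<zeta> within T)" unfolding Feq[symmetric] by blast
  next
    assume "1/2 \<le> t \<zeta>"
    then have "filterlim (\<lambda>z. g0 (q z)) at_infinity (at \<zeta> within T)"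
      using g0_lim(2) by (intro filterlim_compose[OF _ qT]) (simp add: \<alpha>_def)
    then have "filterlim (\<lambda>z. h z * G0 z) at_infinity (at \<zeta> within T)"
      unfolding G0_def
      by (intro tendsto_mult_filterlim_at_infinity[OF ct[OF hol] hz]
          tendsto_mult_filterlim_at_infinity[OF tendsto_const \<zeta>0])
    then show "filterlim F at_infinity (at \<zeta> within T)"
      by (subst Feq) (rule tendsto_add_filterlim_at_infinity[OF rest])
  qed
qed

end

section \<open>Boundary limits and the closure of the image\<close>

lemma at_ball_nontrivial:
  fixes \<zeta> :: complex
  assumes "norm \<zeta> = 1" shows "at \<zeta> within ball 0 1 \<noteq> bot"
  using assms by (simp add: at_within_eq_bot_iff Diff_insert0)

lemma not_max_in_interior:
  fixes n :: "'a::real_inner"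
  assumes "w \<in> interior Q" "n \<noteq> 0" "\<And>v. v \<in> Q \<Longrightarrow> n \<bullet> v \<le> n \<bullet> w"
  shows False
proof -
  obtain e where e: "0 < e" "ball w e \<subseteq> Q" using assms(1) by (auto simp: mem_interior)
  define v where "v = w + (e / (2 * norm n)) *\<^sub>R n"
  have "v \<in> ball w e" using e assms(2) by (simp add: v_def dist_norm)
  then have "n \<bullet> v \<le> n \<bullet> w" using e assms(3) by blast
  moreover have "n \<bullet> v = n \<bullet> w + (e / (2 * norm n)) * (n \<bullet> n)" by (simp add: v_def inner_add_right)
  moreover have "0 < (e / (2 * norm n)) * (n \<bullet> n)" using e assms(2) by simp
  ultimately show False by linarith
qed

lemma orthogonal_two_zero:
  fixes c :: complex
  assumes "n \<bullet> c = 0" "m \<bullet> c = 0" "Im (cnj n * m) \<noteq> 0" shows "c = 0"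
proof -
  have a: "Re n * Re c + Im n * Im c = 0" "Re m * Re c + Im m * Im c = 0"
    and d: "Re n * Im m - Im n * Re m \<noteq> 0"
    using assms by (simp_all add: inner_complex_def)
  have "(Re n * Im m - Im n * Re m) * Re c
      = Im m * (Re n * Re c + Im n * Im c) - Im n * (Re m * Re c + Im m * Im c)"
    "(Re n * Im m - Im n * Re m) * Im c
      = Re n * (Re m * Re c + Im m * Im c) - Re m * (Re n * Re c + Im n * Im c)"
    by (simp_all add: algebra_simps)
  then have "Re c = 0" "Im c = 0" unfolding a using d by simp_all
  then show ?thesis by (simp add: complex_eq_iff)
qed

lemma i_orthogonal_zero:
  fixes c :: complex
  assumes "n \<bullet> c = 0" "(\<i> * n) \<bullet> c = 0" "n \<noteq> 0" shows "c = 0"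
proof (rule orthogonal_two_zero[OF assms(1,2)])
  have eq: "cnj n * (\<i> * n) = \<i> * of_real ((norm n)^2)"
    unfolding complex_norm_square by (simp add: mult_ac)
  show "Im (cnj n * (\<i> * n)) \<noteq> 0" unfolding eq using assms(3) by simp
qed

context sc_map begin

abbreviation S :: "complex set" where "S \<equiv> F ` ball 0 1"

text \<open>A turn \<open>2 * pi * t \<zeta>\<close> below \<open>pi\<close> gives a corner in the
  plane; the remaining points of \<open>Z\<close> are sent to infinity.\<close>

definition fin_verts :: "complex set" where "fin_verts = {\<zeta>\<in>Z. t \<zeta> < 1/2}"

definition vtx :: "complex \<Rightarrow> complex" where
  "vtx \<zeta> = (SOME v. (F \<longlongrightarrow> v) (at \<zeta> within {z. Re (cnj \<zeta> * z) < 1}))"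

lemma vtx_lim_halfplane:
  assumes "\<zeta> \<in> fin_verts"
  shows "(F \<longlongrightarrow> vtx \<zeta>) (at \<zeta> within {z. Re (cnj \<zeta> * z) < 1})"
proof -
  have "\<exists>v. (F \<longlongrightarrow> v) (at \<zeta> within {z. Re (cnj \<zeta> * z) < 1})"
    using vertex_behaviour[of \<zeta>] assms unfolding fin_verts_def by blast
  then show ?thesis unfolding vtx_def by (rule someI_ex)
qed

lemma ball_le_halfplane: 
  assumes "norm \<zeta> = 1" shows "at \<zeta> within ball 0 1 \<le> at \<zeta> within {z. Re (cnj \<zeta> * z) < 1}"
proof (rule at_le)
  show "ball 0 1 \<subseteq> {z. Re (cnj \<zeta> * z) < 1}"
  proof
    fix z :: complex assume "z \<in> ball 0 1"
    then have "0 < Re (1 - cnj \<zeta> * z)" using assms by (intro Re_one_minus_pos) auto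
    then show "z \<in> {z. Re (cnj \<zeta> * z) < 1}" by (simp del: times_complex.simps)
  qed
qed

lemma vtx_lim: "\<zeta> \<in> fin_verts \<Longrightarrow> (F \<longlongrightarrow> vtx \<zeta>) (at \<zeta> within ball 0 1)"
  by (rule tendsto_mono[OF ball_le_halfplane vtx_lim_halfplane]) (auto simp: fin_verts_def norm_Z)

lemma inf_lim:
  assumes "\<zeta> \<in> Z" "\<zeta> \<notin> fin_verts" shows "filterlim F at_infinity (at \<zeta> within ball 0 1)"
proof -
  have "filterlim F at_infinity (at \<zeta> within {z. Re (cnj \<zeta> * z) < 1})"
    using vertex_behaviour[OF assms(1)] assms by (simp add: fin_verts_def not_less)
  then show ?thesis using ball_le_halfplane[OF norm_Z[OF assms(1)]] by (rule filterlim_mono[OF _ order_refl])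
qed

lemma isCont_F: "norm z \<le> 1 \<Longrightarrow> z \<notin> Z \<Longrightarrow> isCont F z"
  using F_deriv[OF disc_minus_subset] by (auto intro: DERIV_isCont)

lemma reg_lim: "norm \<zeta> = 1 \<Longrightarrow> \<zeta> \<notin> Z \<Longrightarrow> (F \<longlongrightarrow> F \<zeta>) (at \<zeta> within ball 0 1)"
  using isCont_F[of \<zeta>] unfolding isCont_def by (auto intro: tendsto_within_subset)

text \<open>Other points of the circle lie strictly inside the tangent half-plane at
  \<open>cis x0\<close>, so the half-plane limit also governs the approach along the two adjacent
  arcs.\<close>

lemma vtx_lim_circle:
  assumes "cis x0 \<in> fin_verts"
  shows "((\<lambda>x. F (cis x)) \<longlongrightarrow> vtx (cis x0)) (at x0)"
proof (rule filterlim_compose[OF vtx_lim_halfplane[OF assms]])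
  have Z: "cis x0 \<in> Z" using assms by (simp add: fin_verts_def)
  have "\<forall>\<^sub>F x in at x0. cis x \<notin> Z"
    unfolding eventually_at_split
    by (intro conjI eventually_mono[OF turn_at_left] eventually_mono[OF turn_at_right]) simp_all
  then have "\<forall>\<^sub>F x in at x0. cis x \<in> {z. Re (cnj (cis x0) * z) < 1} \<and> cis x \<noteq> cis x0"
  proof eventually_elim
    case (elim x)
    then have "cis x \<noteq> cis x0" using Z by auto
    then have "0 < Re (1 - cnj (cis x0) * cis x)" by (intro Re_one_minus_pos) auto
    then show ?case using \<open>cis x \<noteq> cis x0\<close> by (simp del: times_complex.simps)
  qed
  moreover have "((\<lambda>x. cis x) \<longlongrightarrow> cis x0) (at x0)"
    unfolding cis_conv_exp by (intro tendsto_intros)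
  ultimately show "filterlim cis (at (cis x0) within {z. Re (cnj (cis x0) * z) < 1}) (at x0)"
    by (simp add: filterlim_at)
qed

lemma support_closure:
  assumes "cis x \<notin> Z" "w \<in> closure S"
  shows "nrm x \<bullet> w \<le> nrm x \<bullet> F (cis x)"
proof -
  have "S \<subseteq> {w. nrm x \<bullet> w \<le> nrm x \<bullet> F (cis x)}"
  proof (rule image_subsetI)
    fix z :: complex assume "z \<in> ball 0 1"
    then have "nrm x \<bullet> (F z - F (cis x)) < 0" by (intro support[OF assms(1)]) simp
    then show "F z \<in> {w. nrm x \<bullet> w \<le> nrm x \<bullet> F (cis x)}" by (simp add: inner_diff_right)
  qed
  then have "closure S \<subseteq> {w. nrm x \<bullet> w \<le> nrm x \<bullet> F (cis x)}"
    by (intro closure_minimal closed_halfspace_le)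
  then show ?thesis using assms(2) by blast
qed

lemma lim_in_closure:
  assumes "norm \<zeta> = 1" "(F \<longlongrightarrow> v) (at \<zeta> within ball 0 1)" shows "v \<in> closure S"
proof (rule Lim_in_closed_set[OF closed_closure _ at_ball_nontrivial[OF assms(1)] assms(2)])
  show "\<forall>\<^sub>F z in at \<zeta> within ball 0 1. F z \<in> closure S"
    using closure_subset[of S] by (auto simp: eventually_at_filter intro!: always_eventually)
qed

lemma boundary_sequence:
  assumes "\<And>n::nat. z n \<in> ball (0::complex) 1"
  obtains r \<zeta> where "strict_mono r" "norm \<zeta> < 1 \<and> (z \<circ> r) \<longlonglongrightarrow> \<zeta>
     \<or> norm \<zeta> = 1 \<and> filterlim (z \<circ> r) (at \<zeta> within ball 0 1) sequentially"
proof -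
  have "compact (cball (0::complex) 1)" by simp
  moreover have "\<forall>n. z n \<in> cball 0 1" using assms by (simp add: less_imp_le)
  ultimately obtain \<zeta> r where r: "\<zeta> \<in> cball 0 1" "strict_mono (r::nat\<Rightarrow>nat)" "(z \<circ> r) \<longlonglongrightarrow> \<zeta>"
    unfolding compact_def by blast
  have "filterlim (z \<circ> r) (at \<zeta> within ball 0 1) sequentially" if "norm \<zeta> = 1"
  proof (rule filterlim_at[THEN iffD2], intro conjI always_eventually allI)
    fix n show "(z \<circ> r) n \<in> ball 0 1" using assms by simp
    show "(z \<circ> r) n \<noteq> \<zeta>" using assms[of "r n"] that by auto
  qed (rule r(3))
  then show ?thesis using that[OF r(2)] r by (cases "norm \<zeta> = 1") (auto simp: less_le)
qed

text \<open>By compactness of the closed disk a subsequence settles inside, at a regular boundary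
  point, at a finite vertex or at a vertex at infinity, and \<open>F\<close> has the corresponding
  limit. The form with sequences serves both for the closure of the image and for its
  boundedness.\<close>

lemma seq_limit_cases:
  assumes "\<And>n::nat. z n \<in> ball 0 1"
  obtains r w where "strict_mono (r :: nat \<Rightarrow> nat)" "(\<lambda>n. F (z (r n))) \<longlonglongrightarrow> w"
      "w \<in> S \<or> (\<exists>\<zeta>. norm \<zeta> = 1 \<and> \<zeta> \<notin> Z \<and> w = F \<zeta>) \<or> (\<exists>\<zeta>\<in>fin_verts. w = vtx \<zeta>)"
  | r where "strict_mono (r :: nat \<Rightarrow> nat)" "filterlim (\<lambda>n. F (z (r n))) at_infinity sequentially"
      "fin_verts \<noteq> Z"
proof -
  obtain r \<zeta> where r: "strict_mono r" and c: "norm \<zeta> < 1 \<and> (z \<circ> r) \<longlonglongrightarrow> \<zeta>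
     \<or> norm \<zeta> = 1 \<and> filterlim (z \<circ> r) (at \<zeta> within ball 0 1) sequentially"
    by (rule boundary_sequence[OF assms])
  consider "norm \<zeta> < 1" "(z \<circ> r) \<longlonglongrightarrow> \<zeta>"
    | "norm \<zeta> = 1" "\<zeta> \<notin> Z" "filterlim (z \<circ> r) (at \<zeta> within ball 0 1) sequentially"
    | "norm \<zeta> = 1" "\<zeta> \<in> fin_verts" "filterlim (z \<circ> r) (at \<zeta> within ball 0 1) sequentially"
    | "norm \<zeta> = 1" "\<zeta> \<in> Z" "\<zeta> \<notin> fin_verts" "filterlim (z \<circ> r) (at \<zeta> within ball 0 1) sequentially"
    using c by blast
  then show thesis
  proof cases
    case 1
    have "isCont F \<zeta>" using F_deriv[OF ball_subset[OF 1(1)]] by (rule DERIV_isCont)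
    then have "(\<lambda>n. F (z (r n))) \<longlonglongrightarrow> F \<zeta>"
      using isCont_tendsto_compose[OF _ 1(2)] by (simp add: o_def)
    then show ?thesis by (rule that(1)[OF r]) (use 1(1) in simp)
  next
    case 2
    have "(\<lambda>n. F (z (r n))) \<longlonglongrightarrow> F \<zeta>"
      using filterlim_compose[OF reg_lim[OF 2(1,2)] 2(3)] by (simp add: o_def)
    then show ?thesis by (rule that(1)[OF r]) (use 2(1,2) in blast)
  next
    case 3
    have "(\<lambda>n. F (z (r n))) \<longlonglongrightarrow> vtx \<zeta>"
      using filterlim_compose[OF vtx_lim[OF 3(2)] 3(3)] by (simp add: o_def)
    then show ?thesis by (rule that(1)[OF r]) (use 3(2) in blast)
  next
    case 4
    have "filterlim (\<lambda>n. F (z (r n))) at_infinity sequentially"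
      using filterlim_compose[OF inf_lim[OF 4(2,3)] 4(4)] by (simp add: o_def)
    then show ?thesis by (rule that(2)[OF r]) (use 4(2,3) in blast)
  qed
qed

lemma closure_cases:
  assumes "w \<in> closure S"
  shows "w \<in> S \<or> (\<exists>\<zeta>. norm \<zeta> = 1 \<and> \<zeta> \<notin> Z \<and> w = F \<zeta>) \<or> (\<exists>\<zeta>\<in>fin_verts. w = vtx \<zeta>)"
proof -
  have "\<exists>y. (\<forall>n. y n \<in> S) \<and> y \<longlonglongrightarrow> w" using assms by (simp only: closure_sequential)
  then obtain y where y: "\<forall>n. y n \<in> S" "y \<longlonglongrightarrow> w" by (elim exE conjE)
  have "\<forall>n. \<exists>z. z \<in> ball 0 1 \<and> y n = F z"
  proof
    fix n from y(1) have "y n \<in> S" ..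
    then show "\<exists>z. z \<in> ball 0 1 \<and> y n = F z" by (elim imageE) (intro exI conjI)
  qed
  then obtain z where z: "\<And>n. z n \<in> ball 0 1" "\<And>n. y n = F (z n)" by metis
  have sub: "(\<lambda>n. F (z (r n))) \<longlonglongrightarrow> w" if "strict_mono r" for r
    using LIMSEQ_subseq_LIMSEQ[OF y(2) that] z(2) by (simp add: o_def)
  show ?thesis
  proof (rule seq_limit_cases[OF z(1)])
    fix r w'
    assume 1: "strict_mono (r :: nat \<Rightarrow> nat)" "(\<lambda>n. F (z (r n))) \<longlonglongrightarrow> w'"
      "w' \<in> S \<or> (\<exists>\<zeta>. norm \<zeta> = 1 \<and> \<zeta> \<notin> Z \<and> w' = F \<zeta>) \<or> (\<exists>\<zeta>\<in>fin_verts. w' = vtx \<zeta>)"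
    have "w' = w" using LIMSEQ_unique[OF 1(2) sub[OF 1(1)]] .
    with 1(3) show ?thesis by simp
  next
    fix r assume 2: "strict_mono (r :: nat \<Rightarrow> nat)" "filterlim (\<lambda>n. F (z (r n))) at_infinity sequentially"
    show ?thesis
      using not_tendsto_and_filterlim_at_infinity[OF trivial_limit_sequentially sub[OF 2(1)] 2(2)] by simp
  qed
qed

lemma bounded_S:
  assumes "fin_verts = Z" shows "bounded S"
proof (rule ccontr)
  assume "\<not> bounded S"
  then have nb: "\<not> (\<forall>w\<in>S. norm w \<le> a)" for a by (simp only: bounded_iff) (erule contrapos_nn, rule exI)
  have "\<forall>n::nat. \<exists>z. z \<in> ball 0 1 \<and> real n < norm (F z)"
  proof
    fix n :: nat
    from nb[of "real n"] show "\<exists>z. z \<in> ball 0 1 \<and> real n < norm (F z)"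
      by (simp only: bex_simps ball_simps not_le) (elim bexE, intro exI conjI)
  qed
  then obtain z where z: "\<And>n. z n \<in> ball 0 1" "\<And>n. real n < norm (F (z n))" by metis
  have top: "filterlim (\<lambda>n. norm (F (z n))) at_top sequentially"
    by (rule filterlim_at_top_mono[OF filterlim_real_sequentially])
       (use z(2) in \<open>auto intro!: always_eventually less_imp_le\<close>)
  then have inf: "filterlim (\<lambda>n. F (z n)) at_infinity sequentially"
    by (rule filterlim_norm_at_top_imp_at_infinity)
  show False
  proof (rule seq_limit_cases[OF z(1)])
    fix r w assume 1: "strict_mono (r :: nat \<Rightarrow> nat)" "(\<lambda>n. F (z (r n))) \<longlonglongrightarrow> w"
    have "filterlim (\<lambda>n. F (z (r n))) at_infinity sequentially"
      using filterlim_compose[OF inf filterlim_subseq[OF 1(1)]] .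
    then show False using not_tendsto_and_filterlim_at_infinity[OF trivial_limit_sequentially 1(2)] by simp
  qed (use assms in simp)
qed

lemma unbounded_S:
  assumes "fin_verts \<noteq> Z" shows "\<not> bounded S"
proof
  assume "bounded S"
  then have "\<exists>B. \<forall>w\<in>S. norm w \<le> B" by (simp only: bounded_iff)
  then obtain B where B': "\<forall>w\<in>S. norm w \<le> B" by (elim exE)
  have B: "norm (F z) \<le> B" if "norm z < 1" for z using B' that by simp
  have "fin_verts \<subseteq> Z" by (auto simp: fin_verts_def)
  then obtain \<zeta> where \<zeta>: "\<zeta> \<in> Z" "\<zeta> \<notin> fin_verts" using assms by blast
  have "filterlim (\<lambda>z. norm (F z)) at_top (at \<zeta> within ball 0 1)"
    using inf_lim[OF \<zeta>] by (rule filterlim_at_infinity_imp_norm_at_top)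
  then have "\<forall>\<^sub>F z in at \<zeta> within ball 0 1. B < norm (F z)"
    by (simp add: filterlim_at_top_dense)
  moreover have "\<forall>\<^sub>F z in at \<zeta> within ball 0 1. norm (F z) \<le> B"
    using B by (auto simp: eventually_at_filter intro!: always_eventually)
  ultimately have "\<forall>\<^sub>F z in at \<zeta> within ball 0 1. False"
    by eventually_elim simp
  then show False using at_ball_nontrivial[OF norm_Z[OF \<zeta>(1)]] by (simp add: trivial_limit_def[symmetric])
qed

end

section \<open>The image polygon\<close>

context sc_map begin

text \<open>The one-sided limits of the normal at \<open>x0\<close>. As \<open>turn\<close> is
  right-continuous, only \<open>dir_left\<close> has to subtract the jump; it is meant for
  \<open>cis x0 \<in> Z\<close>.\<close>

definition dir_right :: "real \<Rightarrow> complex" where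
  "dir_right x0 = base_dir * cis (2 * pi * turn x0)"

definition dir_left :: "real \<Rightarrow> complex" where
  "dir_left x0 = base_dir * cis (2 * pi * (turn x0 - t (cis x0)))"

lemma norm_dir [simp]: "norm (dir_right x) = 1" "norm (dir_left x) = 1"
  by (simp_all add: dir_right_def dir_left_def norm_mult)

lemma nrm_at_right: "\<forall>\<^sub>F x in at_right x0. cis x \<notin> Z \<and> nrm x = dir_right x0"
  using turn_at_right[of x0] by eventually_elim (simp add: nrm_turn dir_right_def)

lemma nrm_at_left: "cis x0 \<in> Z \<Longrightarrow> \<forall>\<^sub>F x in at_left x0. cis x \<notin> Z \<and> nrm x = dir_left x0"
  using turn_at_left[of x0] by eventually_elim (simp add: nrm_turn dir_left_def)

lemma nrm_at_left_regular:
  "cis x0 \<notin> Z \<Longrightarrow> \<forall>\<^sub>F x in at_left x0. cis x \<notin> Z \<and> nrm x = nrm x0"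
  using turn_at_left[of x0] by eventually_elim (simp add: nrm_turn)

lemma F_cis_in_closure: "cis x \<notin> Z \<Longrightarrow> F (cis x) \<in> closure S"
  using lim_in_closure[OF _ reg_lim] by simp

text \<open>Both lines support the same closed set, have the same normal and touch the set, so each
  offset bounds the other.\<close>

lemma same_nrm_offset:
  assumes "cis x \<notin> Z" "cis y \<notin> Z" "nrm x = nrm y"
  shows "nrm x \<bullet> F (cis x) = nrm x \<bullet> F (cis y)"
  using support_closure[OF assms(1) F_cis_in_closure[OF assms(2)]]
    support_closure[OF assms(2) F_cis_in_closure[OF assms(1)]] assms(3) by simp

definition halfplane :: "real \<Rightarrow> complex set" where
  "halfplane x = {w. nrm x \<bullet> w \<le> nrm x \<bullet> F (cis x)}"

text \<open>The candidate for the closed polygon. It is indexed by all regular boundary arguments;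
  that finitely many half-planes suffice is shown in \<open>polyhedron_Q\<close>.\<close>

definition Q :: "complex set" where
  "Q = (\<Inter>x\<in>{x. cis x \<notin> Z}. halfplane x)"

text \<open>The offset of the supporting line is constant along an edge, and the vertex is the limit
  of points of the edge, so the supporting lines of both adjacent edges pass through it.\<close>

lemma vertex_offset:
  assumes "cis x0 \<in> fin_verts"
  shows "\<forall>\<^sub>F x in at_right x0. cis x \<notin> Z \<and> nrm x = dir_right x0
      \<and> dir_right x0 \<bullet> F (cis x) = dir_right x0 \<bullet> vtx (cis x0)"
    and "\<forall>\<^sub>F x in at_left x0. cis x \<notin> Z \<and> nrm x = dir_left x0
      \<and> dir_left x0 \<bullet> F (cis x) = dir_left x0 \<bullet> vtx (cis x0)"
proof -
  have *: "\<forall>\<^sub>F x in A. cis x \<notin> Z \<and> nrm x = n \<and> n \<bullet> F (cis x) = n \<bullet> vtx (cis x0)"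
    if ev: "\<forall>\<^sub>F x in A. cis x \<notin> Z \<and> nrm x = n" and A: "A \<noteq> bot" "A \<le> at x0" for A n
    using ev
  proof eventually_elim
    case (elim x)
    have "((\<lambda>y. n \<bullet> F (cis y)) \<longlongrightarrow> n \<bullet> vtx (cis x0)) A"
      by (intro tendsto_intros tendsto_mono[OF A(2) vtx_lim_circle[OF assms]])
    moreover have "\<forall>\<^sub>F y in A. n \<bullet> F (cis y) = n \<bullet> F (cis x)"
      using ev
    proof eventually_elim
      case (elim y)
      then show ?case using same_nrm_offset[of x y] \<open>cis x \<notin> Z \<and> nrm x = n\<close> by auto
    qed
    ultimately have "((\<lambda>y. n \<bullet> F (cis x)) \<longlongrightarrow> n \<bullet> vtx (cis x0)) A"
      by (rule Lim_transform_eventually)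
    then have "n \<bullet> F (cis x) = n \<bullet> vtx (cis x0)"
      using A(1) by (simp add: tendsto_const_iff)
    then show ?case using elim by simp
  qed
  have "cis x0 \<in> Z" using assms by (simp add: fin_verts_def)
  show "\<forall>\<^sub>F x in at_right x0. cis x \<notin> Z \<and> nrm x = dir_right x0
      \<and> dir_right x0 \<bullet> F (cis x) = dir_right x0 \<bullet> vtx (cis x0)"
    by (intro * nrm_at_right at_le) auto
  show "\<forall>\<^sub>F x in at_left x0. cis x \<notin> Z \<and> nrm x = dir_left x0
      \<and> dir_left x0 \<bullet> F (cis x) = dir_left x0 \<bullet> vtx (cis x0)"
    by (intro * nrm_at_left at_le \<open>cis x0 \<in> Z\<close>) auto
qed

lemma vertex_support:
  assumes "cis x0 \<in> fin_verts" "w \<in> Q"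
  shows "dir_right x0 \<bullet> w \<le> dir_right x0 \<bullet> vtx (cis x0)"
    and "dir_left x0 \<bullet> w \<le> dir_left x0 \<bullet> vtx (cis x0)"
proof -
  obtain x where "cis x \<notin> Z \<and> nrm x = dir_right x0
      \<and> dir_right x0 \<bullet> F (cis x) = dir_right x0 \<bullet> vtx (cis x0)"
    using eventually_happens[OF vertex_offset(1)[OF assms(1)]] by auto
  then show "dir_right x0 \<bullet> w \<le> dir_right x0 \<bullet> vtx (cis x0)"
    using assms(2) by (auto simp: Q_def halfplane_def)
  obtain x where "cis x \<notin> Z \<and> nrm x = dir_left x0
      \<and> dir_left x0 \<bullet> F (cis x) = dir_left x0 \<bullet> vtx (cis x0)"
    using eventually_happens[OF vertex_offset(2)[OF assms(1)]] by auto
  then show "dir_left x0 \<bullet> w \<le> dir_left x0 \<bullet> vtx (cis x0)"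
    using assms(2) by (auto simp: Q_def halfplane_def)
qed

text \<open>Up to an integer, \<open>turn x\<close> is minus the total weight of a subset of
  \<open>Z\<close>, and there are only finitely many subsets.\<close>

lemma finite_normals: "finite (nrm ` {x. cis x \<notin> Z})"
proof (rule finite_subset)
  show "nrm ` {x. cis x \<notin> Z} \<subseteq> (\<lambda>A. base_dir * cis (- 2 * pi * sum t A)) ` Pow Z"
  proof (rule image_subsetI)
    fix x assume "x \<in> {x. cis x \<notin> Z}"
    then have x: "cis x \<notin> Z" by simp
    define k where "k = \<lfloor>x / (2 * pi)\<rfloor>"
    \<comment> \<open>The points not yet passed in the current period; their floors are one behind
      \<open>k\<close>.\<close>
    define A where "A = {\<eta>\<in>Z. \<lfloor>(x - Arg2pi \<eta>) / (2 * pi)\<rfloor> = k - 1}"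
    have k: "of_int k \<le> x / (2 * pi)" "x / (2 * pi) < of_int k + 1" unfolding k_def by linarith+
    have fl: "\<lfloor>(x - Arg2pi \<eta>) / (2 * pi)\<rfloor> = k - 1 \<or> \<lfloor>(x - Arg2pi \<eta>) / (2 * pi)\<rfloor> = k" for \<eta>
    proof -
      have "0 \<le> Arg2pi \<eta> / (2 * pi)" "Arg2pi \<eta> / (2 * pi) < 1"
        using Arg2pi_ge_0 Arg2pi_lt_2pi by (auto simp: field_simps)
      then have "of_int (k - 1) \<le> (x - Arg2pi \<eta>) / (2 * pi)" "(x - Arg2pi \<eta>) / (2 * pi) < of_int (k + 1)"
        using k unfolding diff_divide_distrib by (simp_all, linarith+)
      then show ?thesis by linarith
    qed
    have "turn x = (\<Sum>\<eta>\<in>Z. of_int k * t \<eta> - (if \<eta> \<in> A then t \<eta> else 0))"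
      unfolding turn_def
    proof (intro sum.cong refl)
      fix \<eta> assume "\<eta> \<in> Z"
      then show "t \<eta> * of_int \<lfloor>(x - Arg2pi \<eta>) / (2 * pi)\<rfloor> = of_int k * t \<eta> - (if \<eta> \<in> A then t \<eta> else 0)"
        using fl[of \<eta>] by (auto simp: A_def algebra_simps)
    qed
    also have "\<dots> = of_int k * sum t Z - (\<Sum>\<eta>\<in>Z. if \<eta> \<in> A then t \<eta> else 0)"
      by (simp only: sum_subtractf sum_distrib_left)
    also have "\<dots> = of_int k - sum t A"
      proof -
      have "Z \<inter> A = A" by (auto simp: A_def)
      then show ?thesis using sum.inter_restrict[OF finite_Z, of t A] t_sum by simp
    qed
    finally have tx: "turn x = of_int k - sum t A" .
    have "cis (2 * pi * turn x) = cis (2 * pi * of_int k) * cis (- 2 * pi * sum t A)"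
      unfolding cis_mult tx by (rule arg_cong[of _ _ cis]) (simp add: algebra_simps)
    then have "nrm x = base_dir * cis (- 2 * pi * sum t A)"
      by (simp only: nrm_turn[OF x] cis_int_pi mult_1_left)
    moreover have "A \<in> Pow Z" by (auto simp: A_def)
    ultimately show "nrm x \<in> (\<lambda>A. base_dir * cis (- 2 * pi * sum t A)) ` Pow Z" by blast
  qed
  show "finite ((\<lambda>A. base_dir * cis (- 2 * pi * sum t A)) ` Pow Z)" using finite_Z by simp
qed

text \<open>By \<open>same_nrm_offset\<close> a half-plane is determined by its normal, so finitely
  many normals give finitely many half-planes.\<close>

lemma polyhedron_Q: "polyhedron Q"
proof -
  define g where "g = (\<lambda>n. halfplane (SOME y. cis y \<notin> Z \<and> nrm y = n))"
  have "halfplane x = g (nrm x)" if x: "cis x \<notin> Z" for x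
  proof -
    define y where "y = (SOME y. cis y \<notin> Z \<and> nrm y = nrm x)"
    have "cis y \<notin> Z \<and> nrm y = nrm x" unfolding y_def by (rule someI[of _ x]) (use x in simp)
    then show ?thesis
      using same_nrm_offset[of x y] x by (simp add: g_def y_def[symmetric] halfplane_def)
  qed
  then have "halfplane ` {x. cis x \<notin> Z} = g ` nrm ` {x. cis x \<notin> Z}"
    by (auto simp: image_image intro!: image_cong)
  then have "finite (halfplane ` {x. cis x \<notin> Z})" using finite_normals by simp
  moreover have "polyhedron h" if "h \<in> halfplane ` {x. cis x \<notin> Z}" for h
    using that by (auto simp: halfplane_def intro: polyhedron_halfspace_le)
  ultimately show ?thesis unfolding Q_def by (intro polyhedron_Inter) auto
qed

lemma F_holomorphic: "F holomorphic_on ball 0 1"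
  unfolding holomorphic_on_open[OF open_ball]
proof
  fix z :: complex assume "z \<in> ball 0 1"
  then have "z \<in> sc_dom Z" by (intro ball_subset) simp
  from F_deriv[OF this] show "\<exists>f'. (F has_field_derivative f') (at z)" ..
qed

lemma open_S: "open S"
  by (rule open_mapping_thm3[OF F_holomorphic open_ball F_inj])

lemma S_subset_Q: "S \<subseteq> Q"
  using support_closure closure_subset[of S] unfolding Q_def halfplane_def by blast

lemma nrm_nonzero: "nrm x \<noteq> 0"
  by (metis norm_nrm norm_zero zero_neq_one)

text \<open>\<open>interior Q\<close> is convex, hence connected, and \<open>S\<close> is open in
  it. \<open>S\<close> is also relatively closed: a point of \<open>closure S\<close> outside
  \<open>S\<close> is a regular boundary value or a vertex, where some supporting functional attains
  its maximum over \<open>Q\<close>, and that cannot happen at an interior point.\<close>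

lemma S_eq: "S = interior Q"
proof -
  have sub: "S \<subseteq> interior Q" by (rule interior_maximal[OF S_subset_Q open_S])
  have "interior Q \<inter> closure S \<subseteq> S"
  proof
    fix w assume w: "w \<in> interior Q \<inter> closure S"
    then consider "w \<in> S" | \<zeta> where "norm \<zeta> = 1" "\<zeta> \<notin> Z" "w = F \<zeta>" | \<zeta> where "\<zeta> \<in> fin_verts" "w = vtx \<zeta>"
      using closure_cases[of w] by blast
    then show "w \<in> S"
    proof cases
      case (2 \<zeta>)
      have c: "cis (Arg2pi \<zeta>) = \<zeta>" by (rule cis_Arg2pi[OF 2(1)])
      have "nrm (Arg2pi \<zeta>) \<bullet> v \<le> nrm (Arg2pi \<zeta>) \<bullet> w" if "v \<in> Q" for v
      proof -
        have "v \<in> halfplane (Arg2pi \<zeta>)" using that c 2(2) by (auto simp: Q_def)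
        then show ?thesis by (simp add: halfplane_def c 2(3))
      qed
      then show ?thesis using not_max_in_interior[of w Q "nrm (Arg2pi \<zeta>)"] w nrm_nonzero by blast
    next
      case (3 \<zeta>)
      have "norm \<zeta> = 1" using 3(1) norm_Z by (simp add: fin_verts_def)
      then have c: "cis (Arg2pi \<zeta>) = \<zeta>" by (rule cis_Arg2pi)
      have "dir_right (Arg2pi \<zeta>) \<bullet> v \<le> dir_right (Arg2pi \<zeta>) \<bullet> w" if "v \<in> Q" for v
        using vertex_support(1)[of "Arg2pi \<zeta>" v] that c 3 by simp
      moreover have "dir_right (Arg2pi \<zeta>) \<noteq> 0" by (metis norm_dir(1) norm_zero zero_neq_one)
      ultimately show ?thesis using not_max_in_interior[of w Q "dir_right (Arg2pi \<zeta>)"] w by blast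
    qed
  qed
  then have eq: "S = interior Q \<inter> closure S" using sub closure_subset[of S] by blast
  have "connected (interior Q)"
    using polyhedron_imp_convex[OF polyhedron_Q] by (intro convex_connected convex_interior)
  moreover have "openin (top_of_set (interior Q)) S" using open_S sub by (simp add: open_subset)
  moreover have "closedin (top_of_set (interior Q)) S"
    by (subst eq) (intro closedin_closed_Int closed_closure)
  moreover have "S \<noteq> {}" by auto
  ultimately show ?thesis unfolding connected_clopen by blast
qed

lemma closure_S: "closure S = Q"
proof -
  have "interior Q \<noteq> {}" using S_eq by auto
  then show ?thesis
    using convex_closure_interior[OF polyhedron_imp_convex[OF polyhedron_Q]]
      closure_closed[OF polyhedron_imp_closed[OF polyhedron_Q]] S_eq by simp
qed

text \<open>Two supporting lines pass through the vertex, and their normals differ by the angle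
  \<open>2 * pi * t \<zeta>\<close> in \<open>(0, pi)\<close>, so they are linearly independent. A
  segment of \<open>Q\<close> with the vertex in its relative interior would lie in both lines and
  thus be a point.\<close>

lemma vtx_extreme:
  assumes "\<zeta> \<in> fin_verts" shows "vtx \<zeta> extreme_point_of Q"
proof -
  have \<zeta>: "\<zeta> \<in> Z" "t \<zeta> < 1/2" "norm \<zeta> = 1" using assms norm_Z by (auto simp: fin_verts_def)
  define x0 where "x0 = Arg2pi \<zeta>"
  have c: "cis x0 = \<zeta>" unfolding x0_def by (rule cis_Arg2pi[OF \<zeta>(3)])
  have fv: "cis x0 \<in> fin_verts" using assms c by simp
  let ?n = "dir_right x0" and ?m = "dir_left x0"
  note sup = vertex_support[OF fv]
  have "cnj ?n * ?m = (cnj base_dir * base_dir) * (cis (- (2 * pi * turn x0)) * cis (2 * pi * (turn x0 - t \<zeta>)))"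
    by (simp add: dir_right_def dir_left_def c cis_cnj mult_ac)
  also have "cnj base_dir * base_dir = 1"
    using complex_norm_square[of base_dir] by (simp add: mult.commute)
  finally have "cnj ?n * ?m = cis (- (2 * pi * t \<zeta>))" by (simp add: cis_mult algebra_simps)
  then have "Im (cnj ?n * ?m) = - sin (2 * pi * t \<zeta>)" by simp
  moreover have "0 < sin (2 * pi * t \<zeta>)" using \<zeta>(2) t_pos[OF \<zeta>(1)] by (intro sin_gt_zero) auto
  ultimately have im: "Im (cnj ?n * ?m) \<noteq> 0" by simp
  have mem: "vtx \<zeta> \<in> Q" using lim_in_closure[OF \<zeta>(3) vtx_lim[OF assms]] closure_S by simp
  show ?thesis
    unfolding extreme_point_of_def
  proof (intro conjI ballI notI mem)
    fix a b assume ab: "a \<in> Q" "b \<in> Q" "vtx \<zeta> \<in> open_segment a b"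
    then obtain u where u: "a \<noteq> b" "0 < u" "u < 1" "vtx \<zeta> = (1 - u) *\<^sub>R a + u *\<^sub>R b"
      by (auto simp: in_segment)
    \<comment> \<open>A linear functional with its maximum at an inner point of a segment is
      constant along the segment.\<close>
    have eq: "n \<bullet> a = n \<bullet> vtx \<zeta>" if le: "\<And>w. w \<in> Q \<Longrightarrow> n \<bullet> w \<le> n \<bullet> vtx \<zeta>" for n
    proof (rule ccontr)
      assume "n \<bullet> a \<noteq> n \<bullet> vtx \<zeta>"
      then have "n \<bullet> a < n \<bullet> vtx \<zeta>" using le[OF ab(1)] by simp
      then have "(1 - u) * (n \<bullet> a) < (1 - u) * (n \<bullet> vtx \<zeta>)" using u by simp
      moreover have "u * (n \<bullet> b) \<le> u * (n \<bullet> vtx \<zeta>)" using u le[OF ab(2)] by simp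
      moreover have "n \<bullet> vtx \<zeta> = (1 - u) * (n \<bullet> a) + u * (n \<bullet> b)"
        by (subst u(4)) (simp add: inner_add_right)
      ultimately show False by (simp add: algebra_simps)
    qed
    have av: "a - vtx \<zeta> = 0"
      using eq[of ?n] eq[of ?m] sup c by (intro orthogonal_two_zero[OF _ _ im]) (simp_all add: inner_diff_right)
    have "u *\<^sub>R (b - a) = ((1 - u) *\<^sub>R a + u *\<^sub>R b) - a" by (simp add: algebra_simps)
    also have "\<dots> = 0" using u(4) av by simp
    finally have "u *\<^sub>R (b - a) = 0" .
    then show False using u by simp
  qed
qed

text \<open>The normal is constant on both sides of a regular point, so by
  \<open>boundary_motion\<close> its image lies strictly between two other boundary points on one
  line.\<close>

lemma regular_not_extreme:
  assumes "norm \<zeta> = 1" "\<zeta> \<notin> Z" shows "\<not> F \<zeta> extreme_point_of Q"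
proof
  assume ex: "F \<zeta> extreme_point_of Q"
  define x0 where "x0 = Arg2pi \<zeta>"
  have c: "cis x0 = \<zeta>" unfolding x0_def by (rule cis_Arg2pi[OF assms(1)])
  have x0: "cis x0 \<notin> Z" using c assms by simp
  have n0: "nrm x0 = dir_right x0" by (simp add: nrm_turn[OF x0] dir_right_def)
  obtain b where b: "x0 < b" "\<And>y. x0 < y \<Longrightarrow> y < b \<Longrightarrow> cis y \<notin> Z \<and> nrm y = nrm x0"
    using nrm_at_right[of x0] unfolding eventually_at_right_field n0 by blast
  obtain a where a: "a < x0" "\<And>y. a < y \<Longrightarrow> y < x0 \<Longrightarrow> cis y \<notin> Z \<and> nrm y = nrm x0"
    using nrm_at_left_regular[OF x0] unfolding eventually_at_left_field by blast
  define b' where "b' = (x0 + b) / 2"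
  define a' where "a' = (a + x0) / 2"
  have ab': "a < a'" "a' < x0" "x0 < b'" "b' < b" using a b by (auto simp: a'_def b'_def)
  have all: "cis y \<notin> Z \<and> nrm y = nrm x0" if "a' \<le> y" "y \<le> b'" for y
    using that ab' a(2)[of y] b(2)[of y] x0 by (cases y x0 rule: linorder_cases) auto
  let ?n = "nrm x0"
  have l: "cis y \<notin> Z \<and> nrm y = ?n" if "a' \<le> y" "y \<le> x0" for y using all[of y] that ab' by linarith
  have r: "cis y \<notin> Z \<and> nrm y = ?n" if "x0 \<le> y" "y \<le> b'" for y using all[of y] that ab' by linarith
  have m1: "?n \<bullet> F (cis x0) = ?n \<bullet> F (cis a')" "(\<i> * ?n) \<bullet> F (cis a') < (\<i> * ?n) \<bullet> F (cis x0)"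
    by (rule boundary_motion[OF ab'(2)], rule l, assumption+)+
  have m2: "?n \<bullet> F (cis b') = ?n \<bullet> F (cis x0)" "(\<i> * ?n) \<bullet> F (cis x0) < (\<i> * ?n) \<bullet> F (cis b')"
    by (rule boundary_motion[OF ab'(3)], rule r, assumption+)+
  define p where "p = (\<i> * ?n) \<bullet> F (cis a')"
  define q where "q = (\<i> * ?n) \<bullet> F (cis b')"
  define m where "m = (\<i> * ?n) \<bullet> F (cis x0)"
  have pmq: "p < m" "m < q" unfolding p_def q_def m_def by (rule m1(2), rule m2(2))
  \<comment> \<open>The ratio in which the middle point divides the segment, read off from the
    tangential coordinates.\<close>
  define u where "u = (m - p) / (q - p)"
  have u: "0 < u" "u < 1" using pmq by (auto simp: u_def)
  have uq: "u * (q - p) = m - p" using pmq by (simp add: u_def)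
  have "F (cis x0) - ((1 - u) *\<^sub>R F (cis a') + u *\<^sub>R F (cis b')) = 0"
  proof (rule i_orthogonal_zero[OF _ _ nrm_nonzero[of x0]])
    show "?n \<bullet> (F (cis x0) - ((1 - u) *\<^sub>R F (cis a') + u *\<^sub>R F (cis b'))) = 0"
      using m1(1) m2(1) by (simp add: inner_diff_right inner_add_right algebra_simps)
    have "(\<i> * ?n) \<bullet> (F (cis x0) - ((1 - u) *\<^sub>R F (cis a') + u *\<^sub>R F (cis b')))
        = m - ((1 - u) * p + u * q)"
      by (simp only: inner_diff_right inner_add_right inner_scaleR_right p_def q_def m_def)
    also have "\<dots> = 0" using uq by (simp add: algebra_simps)
    finally show "(\<i> * ?n) \<bullet> (F (cis x0) - ((1 - u) *\<^sub>R F (cis a') + u *\<^sub>R F (cis b'))) = 0" .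
  qed
  moreover have "F (cis a') \<noteq> F (cis b')"
  proof
    assume "F (cis a') = F (cis b')"
    then have "p = q" by (simp only: p_def q_def)
    then show False using pmq by simp
  qed
  ultimately have "F \<zeta> \<in> open_segment (F (cis a')) (F (cis b'))"
    using u c by (auto simp: in_segment intro!: exI[of _ u])
  moreover have "F (cis a') \<in> Q" "F (cis b') \<in> Q"
    using all[of a'] all[of b'] ab' F_cis_in_closure closure_S by auto
  ultimately show False using ex unfolding extreme_point_of_def by blast
qed

lemma extreme_points: "{v. v extreme_point_of Q} = vtx ` fin_verts"
proof
  show "{v. v extreme_point_of Q} \<subseteq> vtx ` fin_verts"
  proof
    fix v assume "v \<in> {v. v extreme_point_of Q}"
    then have v: "v extreme_point_of Q" by simp
    then have "v \<in> closure S" by (simp add: extreme_point_of_def closure_S)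
    moreover have "v \<notin> S" using extreme_point_not_in_interior[OF v] S_eq by simp
    moreover have "v \<noteq> F \<zeta>" if "norm \<zeta> = 1" "\<zeta> \<notin> Z" for \<zeta>
      using regular_not_extreme[OF that] v by blast
    ultimately show "v \<in> vtx ` fin_verts" using closure_cases[of v] by blast
  qed
qed (use vtx_extreme in auto)


section \<open>Distinct vertices and their number\<close>

lemma right_motion:
  assumes fv: "cis x0 \<in> fin_verts"
  obtains x where "cis x \<notin> Z" "nrm x = dir_right x0"
    "dir_right x0 \<bullet> F (cis x) = dir_right x0 \<bullet> vtx (cis x0)"
    "(\<i> * dir_right x0) \<bullet> vtx (cis x0) < (\<i> * dir_right x0) \<bullet> F (cis x)"
proof -
  let ?n = "dir_right x0"
  obtain b where b: "x0 < b" "\<And>y. x0 < y \<Longrightarrow> y < b \<Longrightarrow> cis y \<notin> Z \<and> nrm y = ?n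
      \<and> ?n \<bullet> F (cis y) = ?n \<bullet> vtx (cis x0)"
    using vertex_offset(1)[OF fv] unfolding eventually_at_right_field by blast
  define x where "x = x0 + 2 * (b - x0) / 3"
  \<comment> \<open>The intermediate point keeps the inequality strict: the limit at the vertex is
    only known to be at most the value at \<open>y\<close>, and that is below the value at
    \<open>x\<close>.\<close>
  define y where "y = x0 + (b - x0) / 3"
  have xy: "x0 < y" "y < x" "x < b" using b(1) by (auto simp: x_def y_def field_simps)
  have mot: "(\<i> * ?n) \<bullet> F (cis z) < (\<i> * ?n) \<bullet> F (cis z')" if z: "x0 < z" "z < z'" "z' < b" for z z'
  proof (rule boundary_motion(2)[OF z(2)])
    fix u assume "z \<le> u" "u \<le> z'"
    then have "x0 < u" "u < b" using z by linarith+
    then show "cis u \<notin> Z \<and> nrm u = ?n" using b(2) by blast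
  qed
  have lim: "((\<lambda>z. (\<i> * ?n) \<bullet> F (cis z)) \<longlongrightarrow> (\<i> * ?n) \<bullet> vtx (cis x0)) (at_right x0)"
    by (intro tendsto_intros tendsto_mono[OF _ vtx_lim_circle[OF fv]] at_le) simp
  have ev: "\<forall>\<^sub>F z in at_right x0. (\<i> * ?n) \<bullet> F (cis z) \<le> (\<i> * ?n) \<bullet> F (cis y)"
  proof (rule eventually_at_rightI[OF _ xy(1)])
    fix z assume "z \<in> {x0<..<y}"
    then show "(\<i> * ?n) \<bullet> F (cis z) \<le> (\<i> * ?n) \<bullet> F (cis y)" using mot[of z y] xy by simp
  qed
  have "(\<i> * ?n) \<bullet> vtx (cis x0) \<le> (\<i> * ?n) \<bullet> F (cis y)"
    by (rule tendsto_upperbound[OF lim ev]) simp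
  also have "\<dots> < (\<i> * ?n) \<bullet> F (cis x)" by (rule mot[OF xy])
  finally show ?thesis using that[of x] b(2)[of x] xy by simp
qed

text \<open>The difference is the weight of the points with argument in a half-open interval that
  contains \<open>Arg2pi \<eta>\<close> but not \<open>Arg2pi \<zeta>\<close>, so it is neither
  empty nor all of \<open>Z\<close>.\<close>

lemma turn_diff:
  assumes "\<zeta> \<in> Z" "\<eta> \<in> Z" "Arg2pi \<zeta> < Arg2pi \<eta>"
  shows "0 < turn (Arg2pi \<eta>) - turn (Arg2pi \<zeta>)" "turn (Arg2pi \<eta>) - turn (Arg2pi \<zeta>) < 1"
proof -
  define f where "f = (\<lambda>\<xi>. t \<xi> * (if Arg2pi \<zeta> < Arg2pi \<xi> \<and> Arg2pi \<xi> \<le> Arg2pi \<eta> then 1 else 0))"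
  have fl: "\<lfloor>(Arg2pi a - Arg2pi b) / (2 * pi)\<rfloor> = (if Arg2pi b \<le> Arg2pi a then 0 else -1)" for a b
  proof -
    have "Arg2pi a < 2 * pi" "Arg2pi b < 2 * pi" "0 \<le> Arg2pi a" "0 \<le> Arg2pi b"
      using Arg2pi_ge_0 Arg2pi_lt_2pi by auto
    then show ?thesis by (cases "Arg2pi b \<le> Arg2pi a") (auto intro!: floor_unique simp: field_simps)
  qed
  have d: "turn (Arg2pi \<eta>) - turn (Arg2pi \<zeta>) = sum f Z"
    unfolding turn_def sum_subtractf[symmetric]
  proof (intro sum.cong refl)
    fix \<xi>
    show "t \<xi> * of_int \<lfloor>(Arg2pi \<eta> - Arg2pi \<xi>) / (2 * pi)\<rfloor> - t \<xi> * of_int \<lfloor>(Arg2pi \<zeta> - Arg2pi \<xi>) / (2 * pi)\<rfloor> = f \<xi>"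
      unfolding f_def fl using assms(3) by auto
  qed
  have f0: "0 \<le> f \<xi>" "f \<xi> \<le> t \<xi>" if "\<xi> \<in> Z" for \<xi> using t_pos[OF that] by (auto simp: f_def)
  have "0 < f \<eta>" using t_pos[OF assms(2)] assms(3) by (simp add: f_def)
  then show "0 < turn (Arg2pi \<eta>) - turn (Arg2pi \<zeta>)"
    unfolding d by (intro sum_pos2[OF finite_Z assms(2)] f0)
  have "sum f Z < sum t Z"
  proof (rule sum_strict_mono_ex1[OF finite_Z])
    show "\<exists>a\<in>Z. f a < t a" using assms(1) t_pos by (intro bexI[of _ \<zeta>]) (auto simp: f_def)
  qed (use f0 in auto)
  then show "turn (Arg2pi \<eta>) - turn (Arg2pi \<zeta>) < 1" unfolding d using t_sum by simp
qed

lemma dir_right_distinct: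
  assumes "\<zeta> \<in> Z" "\<eta> \<in> Z" "\<zeta> \<noteq> \<eta>"
  shows "dir_right (Arg2pi \<zeta>) \<noteq> dir_right (Arg2pi \<eta>)"
proof -
  have *: "dir_right (Arg2pi \<zeta>) \<noteq> dir_right (Arg2pi \<eta>)"
    if "\<zeta> \<in> Z" "\<eta> \<in> Z" "Arg2pi \<zeta> < Arg2pi \<eta>" for \<zeta> \<eta>
  proof
    assume eq: "dir_right (Arg2pi \<zeta>) = dir_right (Arg2pi \<eta>)"
    have "base_dir \<noteq> 0" by (metis norm_base_dir norm_zero zero_neq_one)
    then have "cis (2 * pi * turn (Arg2pi \<zeta>)) = cis (2 * pi * turn (Arg2pi \<eta>))"
      using eq by (simp add: dir_right_def)
    then have "cis (2 * pi * turn (Arg2pi \<eta>) - 2 * pi * turn (Arg2pi \<zeta>)) = 1"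
      by (simp add: cis_divide[symmetric])
    then obtain k :: int where "2 * pi * turn (Arg2pi \<eta>) - 2 * pi * turn (Arg2pi \<zeta>) = 2 * pi * of_int k"
      unfolding cis_eq_1_iff by blast
    then have "2 * pi * (turn (Arg2pi \<eta>) - turn (Arg2pi \<zeta>)) = 2 * pi * of_int k"
      by (simp only: right_diff_distrib)
    then have "turn (Arg2pi \<eta>) - turn (Arg2pi \<zeta>) = of_int k" by simp
    then have "0 < (of_int k :: real)" "(of_int k :: real) < 1" using turn_diff[OF that] by simp_all
    then show False by simp
  qed
  have "Arg2pi \<zeta> \<noteq> Arg2pi \<eta>" using cis_Arg2pi norm_Z assms by metis
  then show ?thesis using *[OF assms(1,2)] *[OF assms(2,1)] by (metis linorder_neqE)
qed

text \<open>Suppose two vertices coincide in \<open>v\<close>, and let \<open>n\<close> and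
  \<open>m\<close> be the normals of the edges that leave it. These edges start in directions
  \<open>\<i> * n\<close> and \<open>\<i> * m\<close>, and each must respect the supporting line of
  the other, so \<open>m \<bullet> (\<i> * n)\<close> and \<open>n \<bullet> (\<i> * m)\<close> are
  both at most \<open>0\<close>. They are negatives of each other, hence zero, and \<open>m\<close>
  is \<open>n\<close> or \<open>- n\<close>. The first is excluded by
  \<open>dir_right_distinct\<close>; the second would squeeze \<open>Q\<close> into a line.\<close>

lemma vtx_inj: "inj_on vtx fin_verts"
proof (rule inj_onI, rule ccontr)
  fix \<zeta> \<eta> assume fv: "\<zeta> \<in> fin_verts" "\<eta> \<in> fin_verts" and eq: "vtx \<zeta> = vtx \<eta>" and ne: "\<zeta> \<noteq> \<eta>"
  have Z: "\<zeta> \<in> Z" "\<eta> \<in> Z" using fv by (auto simp: fin_verts_def)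
  have c: "cis (Arg2pi \<zeta>) = \<zeta>" "cis (Arg2pi \<eta>) = \<eta>" using Z norm_Z cis_Arg2pi by auto
  define n where "n = dir_right (Arg2pi \<zeta>)"
  define m where "m = dir_right (Arg2pi \<eta>)"
  define v where "v = vtx \<zeta>"
  have nn: "norm n = 1" "norm m = 1" by (simp_all add: n_def m_def)
  have nm: "n \<noteq> m" unfolding n_def m_def by (rule dir_right_distinct[OF Z ne])
  have sn: "n \<bullet> w \<le> n \<bullet> v" if "w \<in> Q" for w
    using vertex_support(1)[of "Arg2pi \<zeta>" w] that fv c by (simp add: n_def v_def)
  have sm: "m \<bullet> w \<le> m \<bullet> v" if "w \<in> Q" for w
    using vertex_support(1)[of "Arg2pi \<eta>" w] that fv c eq by (simp add: m_def v_def)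
  have key: "m \<bullet> (\<i> * n) \<le> 0"
    if n: "norm n = 1" and p: "p \<in> Q" "n \<bullet> p = n \<bullet> v" "(\<i> * n) \<bullet> v < (\<i> * n) \<bullet> p"
      and sm: "\<And>w. w \<in> Q \<Longrightarrow> m \<bullet> w \<le> m \<bullet> v" for n m p
  proof -
    define \<mu> where "\<mu> = (\<i> * n) \<bullet> p - (\<i> * n) \<bullet> v"
    have \<mu>: "0 < \<mu>" using p by (simp add: \<mu>_def)
    have nin: "n \<bullet> (\<i> * n) = 0" "(\<i> * n) \<bullet> (\<i> * n) = 1"
      using n by (simp_all add: inner_complex_def norm_complex_def power2_eq_square)
    have "p - v - \<mu> *\<^sub>R (\<i> * n) = 0"
    proof (rule i_orthogonal_zero)
      show "n \<bullet> (p - v - \<mu> *\<^sub>R (\<i> * n)) = 0"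
        using p(2) nin by (simp only: inner_diff_right inner_scaleR_right)
      show "(\<i> * n) \<bullet> (p - v - \<mu> *\<^sub>R (\<i> * n)) = 0"
        using nin by (simp only: inner_diff_right inner_scaleR_right \<mu>_def) simp
      show "n \<noteq> 0" using n by auto
    qed
    then have "p = v + \<mu> *\<^sub>R (\<i> * n)" by (simp add: algebra_simps)
    then have "m \<bullet> p = m \<bullet> v + \<mu> * (m \<bullet> (\<i> * n))"
      by (simp only: inner_add_right inner_scaleR_right)
    with sm[OF p(1)] have "\<mu> * (m \<bullet> (\<i> * n)) \<le> 0" by linarith
    with \<mu> show ?thesis by (simp only: mult_le_0_iff) linarith
  qed
  have a: "m \<bullet> (\<i> * n) \<le> 0"
  proof (rule right_motion[of "Arg2pi \<zeta>"])
    show "cis (Arg2pi \<zeta>) \<in> fin_verts" using c fv by simp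
    fix x assume x: "cis x \<notin> Z" "dir_right (Arg2pi \<zeta>) \<bullet> F (cis x) = dir_right (Arg2pi \<zeta>) \<bullet> vtx (cis (Arg2pi \<zeta>))"
      "(\<i> * dir_right (Arg2pi \<zeta>)) \<bullet> vtx (cis (Arg2pi \<zeta>)) < (\<i> * dir_right (Arg2pi \<zeta>)) \<bullet> F (cis x)"
    show ?thesis
      using x F_cis_in_closure[OF x(1)] unfolding c n_def[symmetric] v_def[symmetric] closure_S
      by (intro key[OF nn(1) _ _ _ sm])
  qed
  have b: "n \<bullet> (\<i> * m) \<le> 0"
  proof (rule right_motion[of "Arg2pi \<eta>"])
    show "cis (Arg2pi \<eta>) \<in> fin_verts" using c fv by simp
    fix x assume x: "cis x \<notin> Z" "dir_right (Arg2pi \<eta>) \<bullet> F (cis x) = dir_right (Arg2pi \<eta>) \<bullet> vtx (cis (Arg2pi \<eta>))"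
      "(\<i> * dir_right (Arg2pi \<eta>)) \<bullet> vtx (cis (Arg2pi \<eta>)) < (\<i> * dir_right (Arg2pi \<eta>)) \<bullet> F (cis x)"
    show ?thesis
      using x F_cis_in_closure[OF x(1)] unfolding c m_def[symmetric] eq[symmetric] v_def[symmetric] closure_S
      by (intro key[OF nn(2) _ _ _ sn])
  qed
  have "m \<bullet> (\<i> * n) = - (n \<bullet> (\<i> * m))" by (simp add: inner_complex_def)
  then have mi: "m \<bullet> (\<i> * n) = 0" using a b by linarith
  have "m - (m \<bullet> n) *\<^sub>R n = 0"
  proof (rule i_orthogonal_zero)
    show "n \<bullet> (m - (m \<bullet> n) *\<^sub>R n) = 0"
      using nn by (simp add: inner_diff_right dot_square_norm inner_commute)
    have "(\<i> * n) \<bullet> n = 0" by (simp add: inner_complex_def)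
    then show "(\<i> * n) \<bullet> (m - (m \<bullet> n) *\<^sub>R n) = 0"
      using mi by (simp only: inner_diff_right inner_scaleR_right inner_commute[of _ m])
    show "n \<noteq> 0" using nn by auto
  qed
  then have mn: "m = (m \<bullet> n) *\<^sub>R n" by simp
  then have "\<bar>m \<bullet> n\<bar> = 1" using nn by (metis mult.right_neutral norm_scaleR)
  moreover have "m \<bullet> n \<noteq> 1" using mn nm by auto
  ultimately have "m \<bullet> n = -1" by linarith
  then have mn': "m = - n" using mn by simp
  have const: "n \<bullet> w = n \<bullet> v" if "w \<in> Q" for w
    using sn[OF that] sm[OF that] unfolding mn' by simp
  have "F 0 \<in> interior Q" using S_eq by auto
  then show False
  proof (rule not_max_in_interior)
    show "n \<noteq> 0" using nn by auto
    have "F 0 \<in> Q" using \<open>F 0 \<in> interior Q\<close> interior_subset by blast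
    then show "n \<bullet> w \<le> n \<bullet> F 0" if "w \<in> Q" for w using const that by simp
  qed
qed

text \<open>Two points of weight at least \<open>1/2\<close> and a third of positive weight would
  exceed the total \<open>1\<close>, so at most one vertex is at infinity. It is present exactly
  when the image is unbounded.\<close>

lemma card_inf_verts: "card Z = card fin_verts + (if bounded S then 0 else 1)"
proof -
  have sub: "fin_verts \<subseteq> Z" by (auto simp: fin_verts_def)
  have ff: "finite fin_verts" using sub finite_Z by (rule finite_subset)
  show ?thesis
  proof (cases "fin_verts = Z")
    case True
    then show ?thesis using bounded_S by simp
  next
    case False
    then obtain \<zeta> where \<zeta>: "\<zeta> \<in> Z" "\<zeta> \<notin> fin_verts" using sub by blast
    have "Z - fin_verts = {\<zeta>}"
    proof (rule ccontr)
      assume "Z - fin_verts \<noteq> {\<zeta>}"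
      then obtain \<eta> where \<eta>: "\<eta> \<in> Z" "\<eta> \<notin> fin_verts" "\<eta> \<noteq> \<zeta>" using \<zeta> by blast
      have "\<not> Z \<subseteq> {\<zeta>, \<eta>}"
      proof
        assume "Z \<subseteq> {\<zeta>, \<eta>}"
        then have "card Z \<le> card {\<zeta>, \<eta>}" by (intro card_mono) auto
        also have "\<dots> \<le> 2" by (simp add: card_insert_if)
        finally show False using card_Z by simp
      qed
      then obtain \<xi> where \<xi>: "\<xi> \<in> Z" "\<xi> \<noteq> \<zeta>" "\<xi> \<noteq> \<eta>" by blast
      have "sum t {\<zeta>, \<eta>, \<xi>} \<le> sum t Z"
        using \<zeta> \<eta> \<xi> t_pos finite_Z by (intro sum_mono2) (auto intro: less_imp_le)
      moreover have "sum t {\<zeta>, \<eta>, \<xi>} = t \<zeta> + t \<eta> + t \<xi>" using \<eta>(3) \<xi> by simp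
      moreover have "1/2 \<le> t \<zeta>" "1/2 \<le> t \<eta>" using \<zeta> \<eta> by (auto simp: fin_verts_def)
      ultimately show False using t_pos[OF \<xi>(1)] t_sum by simp
    qed
    moreover have "card (Z - fin_verts) = card Z - card fin_verts" using ff sub by (rule card_Diff_subset)
    moreover have "card fin_verts \<le> card Z" using finite_Z sub by (rule card_mono)
    ultimately show ?thesis using unbounded_S[OF False] by simp
  qed
qed

theorem is_schwarz_christoffel: "schwarz_christoffel (card Z) F"
  unfolding schwarz_christoffel_def convex_polygon_def closure_S
proof (intro conjI F_holomorphic F_inj polyhedron_Q S_eq)
  have "card {v. v extreme_point_of Q} = card fin_verts"
    unfolding extreme_points by (rule card_image[OF vtx_inj])
  then show "card {v. v extreme_point_of Q} + (if bounded S then 0 else 1) = card Z"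
    using card_inf_verts by simp
qed simp

theorem prevertices_eq: "prevertices F = Z"
proof (intro set_eqI iffI)
  fix \<zeta> assume \<zeta>: "\<zeta> \<in> Z"
  have n: "norm \<zeta> = 1" using \<zeta> norm_Z by simp
  show "\<zeta> \<in> prevertices F"
  proof (cases "\<zeta> \<in> fin_verts")
    case True
    then show ?thesis
      using vtx_extreme[OF True] vtx_lim[OF True] n unfolding prevertices_def closure_S by blast
  next
    case False
    then show ?thesis using inf_lim[OF \<zeta> False] n unfolding prevertices_def by blast
  qed
next
  fix \<zeta> assume p: "\<zeta> \<in> prevertices F"
  then have n: "norm \<zeta> = 1" by (simp add: prevertices_def)
  show "\<zeta> \<in> Z"
  proof (rule ccontr)
    assume Z: "\<zeta> \<notin> Z"
    note lim = reg_lim[OF n Z] and nt = at_ball_nontrivial[OF n]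
    have "\<not> filterlim F at_infinity (at \<zeta> within ball 0 1)"
      using not_tendsto_and_filterlim_at_infinity[OF nt lim] by blast
    then obtain v where "v extreme_point_of Q" "(F \<longlongrightarrow> v) (at \<zeta> within ball 0 1)"
      using p unfolding prevertices_def closure_S by blast
    then show False using tendsto_unique[OF nt lim] regular_not_extreme[OF n Z] by blast
  qed
qed

end

section \<open>Partial fractions of the pre-Schwarzian\<close>

lemma poly_eqI_card:
  fixes p q :: "'a::idom poly"
  assumes "finite A" "\<And>x. x \<in> A \<Longrightarrow> poly p x = poly q x" "degree (p - q) < card A"
  shows "p = q"
proof (rule ccontr)
  assume "p \<noteq> q"
  then have nz: "p - q \<noteq> 0" by simp
  have "A \<subseteq> {x. poly (p - q) x = 0}" using assms(2) by auto
  then have "card A \<le> card {x. poly (p - q) x = 0}" by (rule card_mono[OF poly_roots_finite[OF nz]])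
  also have "\<dots> \<le> degree (p - q)" by (rule card_poly_roots_bound[OF nz])
  finally show False using assms(3) by simp
qed

lemma prod_linear_factors:
  fixes A :: "'b set" and b :: "'b \<Rightarrow> 'a::idom"
  assumes "finite A"
  shows "degree (\<Prod>k\<in>A. [:b k, 1:]) = card A" "coeff (\<Prod>k\<in>A. [:b k, 1:]) (card A) = 1"
proof -
  have "lead_coeff (\<Prod>k\<in>A. [:b k, 1:]) = 1"
    using assms by (induction A rule: finite_induct) (simp_all add: lead_coeff_mult del: mult_pCons_left)
  moreover show d: "degree (\<Prod>k\<in>A. [:b k, 1:]) = card A"
    using assms by (subst degree_prod_eq_sum_degree) auto
  ultimately show "coeff (\<Prod>k\<in>A. [:b k, 1:]) (card A) = 1" by simp
qed

lemma pderiv_prod_linear: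
  fixes b d :: "'b \<Rightarrow> 'a::field"
  assumes "finite A" "\<And>k. k \<in> A \<Longrightarrow> b k + d k * x \<noteq> 0"
  shows "poly (pderiv (\<Prod>k\<in>A. [:b k, d k:])) x
      = poly (\<Prod>k\<in>A. [:b k, d k:]) x * (\<Sum>k\<in>A. d k / (b k + d k * x))"
  using assms
proof (induction A rule: finite_induct)
  case (insert k A)
  define P where "P = (\<Prod>k\<in>A. [:b k, d k:])"
  have nz: "b k + d k * x \<noteq> 0" using insert.prems by simp
  have IH: "poly (pderiv P) x = poly P x * (\<Sum>k\<in>A. d k / (b k + d k * x))"
    unfolding P_def using insert by simp
  have pr: "(\<Prod>k\<in>insert k A. [:b k, d k:]) = [:b k, d k:] * P" using insert by (simp add: P_def)
  have "poly (pderiv ([:b k, d k:] * P)) x = (b k + d k * x) * poly (pderiv P) x + poly P x * d k"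
    unfolding pderiv_mult by (simp add: pderiv_pCons algebra_simps del: mult_pCons_left)
  also have "\<dots> = (b k + d k * x) * poly P x * (d k / (b k + d k * x) + (\<Sum>k\<in>A. d k / (b k + d k * x)))"
    unfolding IH using nz by (simp add: distrib_left)
  also have "(b k + d k * x) * poly P x = poly ([:b k, d k:] * P) x"
    by (simp add: algebra_simps del: mult_pCons_left)
  also have "d k / (b k + d k * x) + (\<Sum>k\<in>A. d k / (b k + d k * x)) = (\<Sum>k\<in>insert k A. d k / (b k + d k * x))"
    using insert by simp
  finally show ?case unfolding pr .
qed simp

text \<open>The left-hand side is \<open>\<eta>\<close> times the logarithmic derivative of the
  Blaschke factor with zero \<open>a\<close>. It equals the Poisson kernel of \<open>a\<close> at
  \<open>\<eta>\<close>, here in the form \<open>(1 - (norm c)^2) / (norm (1 - c))^2\<close> with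
  \<open>c = cnj a * \<eta>\<close>.\<close>

lemma circle_weight_pos:
  assumes "norm \<eta> = 1" "norm a < 1"
  shows "\<exists>s>0. \<eta> / (\<eta> - a) + cnj a * \<eta> / (1 - cnj a * \<eta>) = of_real s"
proof -
  define c where "c = cnj a * \<eta>"
  have n: "norm c < 1" using assms by (simp add: c_def norm_mult)
  have e: "\<eta> * cnj \<eta> = 1" using assms by (simp add: complex_norm_square[symmetric])
  have nz: "1 - c \<noteq> 0" using n by auto
  then have nz': "1 - cnj c \<noteq> 0" by (metis complex_cnj_cancel_iff complex_cnj_diff complex_cnj_one complex_cnj_zero)
  have "\<eta> - a = \<eta> * (1 - cnj c)"
  proof -
    have "\<eta> * (1 - cnj c) = \<eta> - a * (\<eta> * cnj \<eta>)" by (simp add: c_def algebra_simps)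
    then show ?thesis by (simp only: e mult_1_right)
  qed
  moreover have "\<eta> \<noteq> 0" using assms by auto
  ultimately have "\<eta> / (\<eta> - a) + cnj a * \<eta> / (1 - cnj a * \<eta>) = 1 / (1 - cnj c) + c / (1 - c)"
    by (simp add: c_def)
  also have "\<dots> = (1 - c * cnj c) / ((1 - c) * cnj (1 - c))"
    using nz nz' by (simp add: field_simps)
  also have "\<dots> = of_real ((1 - (norm c)^2) / (norm (1 - c))^2)"
    by (simp add: complex_norm_square[symmetric] del: complex_cnj_diff)
  finally have "\<eta> / (\<eta> - a) + cnj a * \<eta> / (1 - cnj a * \<eta>)
      = of_real ((1 - (norm c)^2) / (norm (1 - c))^2)" .
  moreover have "0 < (1 - (norm c)^2) / (norm (1 - c))^2"
    using n nz by (simp add: abs_square_less_1)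
  ultimately show ?thesis by blast
qed

text \<open>Write the Blaschke product as \<open>q / p\<close>. The denominator
  \<open>z * q - p\<close> is the monic polynomial with simple roots \<open>Z\<close>, so Lagrange
  interpolation of \<open>q\<close> at these roots is the partial fraction decomposition. The
  assumption on \<open>card Z\<close> says that all roots lie on the circle and are simple.\<close>

lemma blaschke_partial_fractions:
  assumes a: "\<And>k. k \<in> {1..n} \<Longrightarrow> norm (a k) < 1"
    and Z_def: "Z = {z. norm z = 1 \<and> z * blaschke n a z = 1}" and card_Z: "card Z = n + 1"
  obtains t where "\<And>\<eta>. \<eta> \<in> Z \<Longrightarrow> 0 < (t \<eta> :: real)" "sum t Z = 1"
    "\<And>z. norm z < 1 \<Longrightarrow> 2 * blaschke n a z / (1 - z * blaschke n a z)
        = 2 * (\<Sum>\<eta>\<in>Z. of_real (t \<eta>) * (cnj \<eta> / (1 - cnj \<eta> * z)))"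
proof -
  have fin: "finite Z" using card_Z by (intro card_ge_0_finite) simp
  define q where "q = (\<Prod>k=1..n. [:- a k, 1:])"
  define p where "p = (\<Prod>k=1..n. [:1, - cnj (a k):])"
  define W where "W = pCons 0 q - p"
  define V where "V = (\<lambda>A. \<Prod>\<xi>\<in>A. [:- \<xi>, 1::complex:])"
  have q: "degree q = n" "coeff q n = 1" using prod_linear_factors[of "{1..n}" "\<lambda>k. - a k"] by (simp_all add: q_def)
  have dp: "degree p \<le> n"
  proof -
    have "degree p \<le> (\<Sum>k=1..n. degree [:1, - cnj (a k):])" unfolding p_def
      using degree_prod_sum_le[of "{1..n}" "\<lambda>k. [:1, - cnj (a k):]"] by (simp add: o_def)
    also have "\<dots> \<le> (\<Sum>k=1..n. 1)" by (intro sum_mono) simp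
    finally show ?thesis by simp
  qed
  have fac: "1 - cnj (a k) * z \<noteq> 0" if "k \<in> {1..n}" "norm z \<le> 1" for k z
  proof -
    have "norm (cnj (a k) * z) < 1"
      using mult_left_le[OF that(2), of "norm (a k)"] a[OF that(1)] by (simp add: norm_mult)
    then show ?thesis by auto
  qed
  have pz: "poly p z \<noteq> 0" if "norm z \<le> 1" for z
    using fac[OF _ that] by (simp add: p_def poly_prod mult.commute)
  have B: "blaschke n a z = poly q z / poly p z" for z
    by (simp add: blaschke_def q_def p_def poly_prod prod_dividef mult.commute)
  have root: "\<eta> * poly q \<eta> = poly p \<eta>" if "\<eta> \<in> Z" for \<eta>
    using that pz[of \<eta>] by (simp add: Z_def B field_simps)
  have V: "degree (V A) = card A" "coeff (V A) (card A) = 1" if "finite A" for A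
    using prod_linear_factors[OF that, of uminus] by (simp_all add: V_def)
  have V0: "poly (V A) z = (\<Prod>\<xi>\<in>A. z - \<xi>)" for A z by (simp add: V_def poly_prod)
  \<comment> \<open>Both are monic of degree \<open>n + 1\<close>, so the difference has degree at
    most \<open>n\<close> while vanishing at \<open>n + 1\<close> points.\<close>
  have WV: "W = V Z"
  proof (rule poly_eqI_card[OF fin])
    fix \<eta> assume \<eta>: "\<eta> \<in> Z"
    have "poly (V Z) \<eta> = 0" unfolding V0 using \<eta> fin by (intro prod_zero) auto
    then show "poly W \<eta> = poly (V Z) \<eta>" using root[OF \<eta>] by (simp add: W_def)
  next
    have d: "coeff (W - V Z) i = 0" if "i > n" for i
    proof (cases "i = n + 1")
      case True
      have "coeff p (n + 1) = 0" using dp by (intro coeff_eq_0) simp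
      then show ?thesis using V[OF fin] q card_Z True by (simp add: W_def)
    next
      case False
      then have i: "n + 1 < i" using that by simp
      then obtain j where j: "i = Suc j" "n < j" by (cases i) auto
      have "coeff p i = 0" using dp i by (intro coeff_eq_0) simp
      moreover have "coeff q j = 0" using q j by (intro coeff_eq_0) simp
      moreover have "coeff (V Z) i = 0" using V[OF fin] card_Z i by (intro coeff_eq_0) simp
      ultimately show ?thesis using j by (simp add: W_def)
    qed
    have "degree (W - V Z) \<le> n" by (rule degree_le) (use d in blast)
    then show "degree (W - V Z) < card Z" using card_Z by simp
  qed
  \<comment> \<open>The residues of \<open>q / W\<close>: at a root the derivative of
    \<open>V Z\<close> is the product over the other roots.\<close>
  define c where "c = (\<lambda>\<eta>. poly q \<eta> / poly (V (Z - {\<eta>})) \<eta>)"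
  have Vnz: "poly (V (Z - {\<eta>})) \<eta> \<noteq> 0" for \<eta> unfolding V0 using fin by simp
  have cd: "card (Z - {\<eta>}) = n" if "\<eta> \<in> Z" for \<eta> using card_Z fin that by simp
  have qL: "q = (\<Sum>\<eta>\<in>Z. smult (c \<eta>) (V (Z - {\<eta>})))"
  proof (rule poly_eqI_card[OF fin])
    fix \<xi> assume \<xi>: "\<xi> \<in> Z"
    have "(\<Sum>\<eta>\<in>Z. c \<eta> * poly (V (Z - {\<eta>})) \<xi>) = (\<Sum>\<eta>\<in>Z. if \<eta> = \<xi> then poly q \<xi> else 0)"
    proof (intro sum.cong refl)
      fix \<eta> assume "\<eta> \<in> Z"
      show "c \<eta> * poly (V (Z - {\<eta>})) \<xi> = (if \<eta> = \<xi> then poly q \<xi> else 0)"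
      proof (cases "\<eta> = \<xi>")
        case True then show ?thesis using Vnz[of \<xi>] by (simp add: c_def)
      next
        case False
        then have "poly (V (Z - {\<eta>})) \<xi> = 0" unfolding V0 using \<xi> fin by (intro prod_zero) auto
        then show ?thesis using False by simp
      qed
    qed
    then show "poly q \<xi> = poly (\<Sum>\<eta>\<in>Z. smult (c \<eta>) (V (Z - {\<eta>}))) \<xi>"
      using fin \<xi> by (simp add: poly_sum)
  next
    have "degree (\<Sum>\<eta>\<in>Z. smult (c \<eta>) (V (Z - {\<eta>}))) \<le> n"
    proof (rule degree_sum_le[OF fin])
      fix \<eta> assume "\<eta> \<in> Z"
      then show "degree (smult (c \<eta>) (V (Z - {\<eta>}))) \<le> n"
        using degree_smult_le[of "c \<eta>" "V (Z - {\<eta>})"] V(1)[of "Z - {\<eta>}"] cd fin by simp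
    qed
    then show "degree (q - (\<Sum>\<eta>\<in>Z. smult (c \<eta>) (V (Z - {\<eta>})))) < card Z"
      using q degree_diff_le[of q n] card_Z by (simp add: less_Suc_eq_le)
  qed
  \<comment> \<open>Comparison of the coefficients of degree \<open>n\<close> in \<open>qL\<close>,
    where every polynomial is monic.\<close>
  have csum: "sum c Z = 1"
  proof -
    have "1 = coeff q n" using q by simp
    also have "\<dots> = (\<Sum>\<eta>\<in>Z. c \<eta> * coeff (V (Z - {\<eta>})) n)" by (subst qL) (simp add: coeff_sum)
    also have "\<dots> = sum c Z"
    proof (intro sum.cong refl)
      fix \<eta> assume "\<eta> \<in> Z"
      then show "c \<eta> * coeff (V (Z - {\<eta>})) n = c \<eta>" using V(2)[of "Z - {\<eta>}"] cd fin by simp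
    qed
    finally show ?thesis by simp
  qed
  \<comment> \<open>At a root \<open>p = \<eta> * q\<close>, so differentiating \<open>W\<close>
    factor by factor gives \<open>q\<close> times \<open>1\<close> plus a sum of Poisson kernels.
    Hence the residue is the reciprocal of a number that is at least \<open>1\<close>.\<close>
  have cpos: "\<exists>s>0. c \<eta> = of_real s" if \<eta>: "\<eta> \<in> Z" for \<eta>
  proof -
    have n\<eta>: "norm \<eta> = 1" using \<eta> by (simp add: Z_def)
    have na: "\<eta> - a k \<noteq> 0" if "k \<in> {1..n}" for k using a[OF that] n\<eta> by auto
    have qnz: "poly q \<eta> \<noteq> 0" using na by (simp add: q_def poly_prod)
    have "\<forall>k\<in>{1..n}. \<exists>s>0. \<eta> / (\<eta> - a k) + cnj (a k) * \<eta> / (1 - cnj (a k) * \<eta>) = of_real s"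
      using circle_weight_pos[OF n\<eta>] a by blast
    then obtain s where s: "\<And>k. k \<in> {1..n} \<Longrightarrow> 0 < (s k :: real)"
      "\<And>k. k \<in> {1..n} \<Longrightarrow> \<eta> / (\<eta> - a k) + cnj (a k) * \<eta> / (1 - cnj (a k) * \<eta>) = of_real (s k)"
      by metis
    have "V Z = [:- \<eta>, 1:] * V (Z - {\<eta>})" unfolding V_def using fin \<eta> by (subst prod.remove[of _ \<eta>]) auto
    then have "poly (pderiv W) \<eta> = poly (V (Z - {\<eta>})) \<eta>"
      unfolding WV by (simp add: pderiv_mult pderiv_pCons del: mult_pCons_left)
    moreover have "poly (pderiv W) \<eta> = poly q \<eta> + \<eta> * poly (pderiv q) \<eta> - poly (pderiv p) \<eta>"
      by (simp add: W_def pderiv_diff pderiv_pCons)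
    moreover have "poly (pderiv q) \<eta> = poly q \<eta> * (\<Sum>k=1..n. 1 / (- a k + 1 * \<eta>))"
      unfolding q_def using na by (intro pderiv_prod_linear) auto
    moreover have "poly (pderiv p) \<eta> = poly p \<eta> * (\<Sum>k=1..n. - cnj (a k) / (1 + - cnj (a k) * \<eta>))"
      unfolding p_def using fac n\<eta> by (intro pderiv_prod_linear) auto
    ultimately have "poly (V (Z - {\<eta>})) \<eta>
        = poly q \<eta> * (1 + (\<Sum>k=1..n. \<eta> * (1 / (- a k + 1 * \<eta>)) - \<eta> * (- cnj (a k) / (1 + - cnj (a k) * \<eta>))))"
      unfolding sum_subtractf sum_distrib_left[symmetric] root[OF \<eta>, symmetric] by (simp add: algebra_simps)
    also have "(\<Sum>k=1..n. \<eta> * (1 / (- a k + 1 * \<eta>)) - \<eta> * (- cnj (a k) / (1 + - cnj (a k) * \<eta>))) = (\<Sum>k=1..n. of_real (s k))"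
      by (intro sum.cong refl) (simp add: s(2)[symmetric] mult.commute)
    finally have "poly (V (Z - {\<eta>})) \<eta> = poly q \<eta> * of_real (1 + (\<Sum>k=1..n. s k))" by simp
    then have "c \<eta> = of_real (1 / (1 + (\<Sum>k=1..n. s k)))" using qnz by (simp add: c_def)
    moreover have "0 \<le> (\<Sum>k=1..n. s k)" using s(1) by (intro sum_nonneg) (auto intro: less_imp_le)
    ultimately show ?thesis by (intro exI[of _ "1 / (1 + (\<Sum>k=1..n. s k))"]) simp
  qed
  define t where "t = (\<lambda>\<eta>. Re (c \<eta>))"
  have ct: "c \<eta> = of_real (t \<eta>)" "0 < t \<eta>" if "\<eta> \<in> Z" for \<eta> using cpos[OF that] by (auto simp: t_def)
  show ?thesis
  proof (rule that[of t])
    show "0 < t \<eta>" if "\<eta> \<in> Z" for \<eta> by (rule ct(2)[OF that])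
    have "complex_of_real (sum t Z) = sum c Z" using ct(1) by simp
    then show "sum t Z = 1" using csum by (metis of_real_eq_1_iff)
    fix z :: complex assume z: "norm z < 1"
    have zn: "z - \<xi> \<noteq> 0" if "\<xi> \<in> Z" for \<xi> using that z by (auto simp: Z_def)
    then have Vz: "poly (V Z) z \<noteq> 0" unfolding V0 using fin by simp
    have Wz: "poly (V Z) z = z * poly q z - poly p z" unfolding WV[symmetric] by (simp add: W_def)
    have pz': "poly p z \<noteq> 0" using pz z by simp
    have "blaschke n a z / (1 - z * blaschke n a z) = - (poly q z / poly (V Z) z)"
      unfolding B Wz using pz' Vz unfolding Wz by (simp add: divide_simps) (simp add: algebra_simps)
    also have "poly q z / poly (V Z) z = (\<Sum>\<eta>\<in>Z. c \<eta> * poly (V (Z - {\<eta>})) z / poly (V Z) z)"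
      by (subst qL) (simp add: poly_sum sum_divide_distrib)
    also have "- \<dots> = (\<Sum>\<eta>\<in>Z. of_real (t \<eta>) * (cnj \<eta> / (1 - cnj \<eta> * z)))"
      unfolding sum_negf[symmetric]
    proof (intro sum.cong refl)
      fix \<eta> assume \<eta>: "\<eta> \<in> Z"
      have e: "\<eta> * cnj \<eta> = 1" using \<eta> by (simp add: Z_def complex_norm_square[symmetric])
      have e0: "cnj \<eta> \<noteq> 0" using e by auto
      have ve: "poly (V Z) z = (z - \<eta>) * poly (V (Z - {\<eta>})) z"
        unfolding V0 using fin \<eta> by (subst prod.remove[of _ \<eta>]) auto
      have "c \<eta> * poly (V (Z - {\<eta>})) z / poly (V Z) z = c \<eta> / (z - \<eta>)"
        using Vz unfolding ve by simp
      moreover have "cnj \<eta> / (1 - cnj \<eta> * z) = - (1 / (z - \<eta>))"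
      proof -
        have h: "1 - cnj \<eta> * z = cnj \<eta> * (\<eta> - z)" using e by (simp add: algebra_simps)
        have "1 / (\<eta> - z) = - (1 / (z - \<eta>))" by (metis minus_diff_eq minus_divide_right)
        then show ?thesis unfolding h using e0 by simp
      qed
      ultimately show "- (c \<eta> * poly (V (Z - {\<eta>})) z / poly (V Z) z)
          = of_real (t \<eta>) * (cnj \<eta> / (1 - cnj \<eta> * z))" using ct(1)[OF \<eta>] by simp
    qed
    finally have "2 * (blaschke n a z / (1 - z * blaschke n a z))
        = 2 * (\<Sum>\<eta>\<in>Z. of_real (t \<eta>) * (cnj \<eta> / (1 - cnj \<eta> * z)))" by (rule arg_cong)
    then show "2 * blaschke n a z / (1 - z * blaschke n a z)
        = 2 * (\<Sum>\<eta>\<in>Z. of_real (t \<eta>) * (cnj \<eta> / (1 - cnj \<eta> * z)))"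
      by (simp only: times_divide_eq_right)
  qed
qed

section \<open>From the pre-Schwarzian to the mapping and back\<close>

lemma has_field_derivative_sc_log:
  assumes "finite Z" "z \<in> sc_dom Z"
  shows "(sc_log Z t has_field_derivative - (\<Sum>\<eta>\<in>Z. of_real (t \<eta>) * (cnj \<eta> / (1 - cnj \<eta> * z)))) (at z)"
proof -
  have "(sc_log Z t has_field_derivative
      (\<Sum>\<eta>\<in>Z. of_real (t \<eta>) * ((0 - cnj \<eta> * 1) / (1 - cnj \<eta> * z)))) (at z)"
    unfolding sc_log_def [abs_def]
    using assms by (intro DERIV_sum DERIV_cmult) (auto intro!: derivative_eq_intros simp: sc_dom_def divide_inverse mult.commute)
  then show ?thesis by (simp add: sum_negf)
qed

lemma starlike_sc_dom: "starlike (sc_dom Z)"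
  unfolding starlike_def
proof (intro bexI ballI subsetI)
  show "0 \<in> sc_dom Z" by (auto simp: sc_dom_def)
  fix z w assume z: "z \<in> sc_dom Z" and "w \<in> closed_segment 0 z"
  then obtain u where u: "0 \<le> u" "u \<le> 1" "w = of_real u * z"
    by (auto simp: in_segment scaleR_conv_of_real)
  show "w \<in> sc_dom Z"
    unfolding sc_dom_def
  proof (intro CollectI ballI notI)
    fix \<eta> assume \<eta>: "\<eta> \<in> Z" and np: "1 - cnj \<eta> * w \<in> \<real>\<^sub>\<le>\<^sub>0"
    define v where "v = 1 - cnj \<eta> * z"
    have eq: "1 - cnj \<eta> * w = of_real (1 - u) + of_real u * v"
      by (simp add: u(3) v_def algebra_simps)
    have v: "(1 - u) + u * Re v \<le> 0" "u * Im v = 0"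
      using np unfolding eq complex_nonpos_Reals_iff by simp_all
    have u0: "0 < u" using v(1) u(1) by (cases "u = 0") auto
    have "u * Re v \<le> 0" using v(1) u(2) by linarith
    then have "v \<in> \<real>\<^sub>\<le>\<^sub>0"
      using u0 v(2) unfolding complex_nonpos_Reals_iff by (auto simp: mult_le_0_iff)
    then show False using z \<eta> by (auto simp: sc_dom_def v_def)
  qed
qed

lemma sc_primitive:
  assumes "finite Z"
  obtains F where "F 0 = w0"
    "\<And>z. z \<in> sc_dom Z \<Longrightarrow> (F has_field_derivative C * exp (- 2 * sc_log Z t z)) (at z)"
proof -
  have op: "open (sc_dom Z)" by (rule open_sc_dom[OF assms])
  have hol: "(\<lambda>z. C * exp (- 2 * sc_log Z t z)) holomorphic_on sc_dom Z"
    by (intro holomorphic_intros holomorphic_sc_log)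
  have "\<exists>g. \<forall>z\<in>sc_dom Z. (g has_field_derivative C * exp (- 2 * sc_log Z t z)) (at z)"
    by (rule holomorphic_starlike_primitive[where k = "{}"])
       (use hol op in \<open>auto intro: holomorphic_on_imp_continuous_on starlike_sc_dom
          holomorphic_on_imp_differentiable_at\<close>)
  then obtain g where g: "\<And>z. z \<in> sc_dom Z \<Longrightarrow> (g has_field_derivative C * exp (- 2 * sc_log Z t z)) (at z)"
    by blast
  show ?thesis
  proof (rule that[of "\<lambda>z. g z + (w0 - g 0)"])
    show "((\<lambda>z. g z + (w0 - g 0)) has_field_derivative C * exp (- 2 * sc_log Z t z)) (at z)"
      if "z \<in> sc_dom Z" for z using g[OF that] by (auto intro!: derivative_eq_intros)
  qed simp
qed

text \<open>\<open>exp (2 * sc_log Z t z)\<close> is an integrating factor: its product with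
  \<open>deriv f\<close> has derivative zero. This gives the formula for the derivative in the disk,
  and a primitive of the same formula on the slit domain continues \<open>f\<close> across the open
  arcs.\<close>

lemma pre_schwarzian_determines:
  assumes fin: "finite Z" and nZ: "\<And>\<eta>. \<eta> \<in> Z \<Longrightarrow> norm \<eta> = 1"
    and hol: "f holomorphic_on ball 0 1" and inj: "inj_on f (ball 0 1)"
    and ode: "\<And>z. norm z < 1 \<Longrightarrow> deriv (deriv f) z / deriv f z
        = 2 * (\<Sum>\<eta>\<in>Z. of_real (t \<eta>) * (cnj \<eta> / (1 - cnj \<eta> * z)))"
  obtains C F where "C \<noteq> 0"
    "\<And>z. z \<in> sc_dom Z \<Longrightarrow> (F has_field_derivative C * exp (- 2 * sc_log Z t z)) (at z)"
    "\<And>z. norm z < 1 \<Longrightarrow> F z = f z"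
proof -
  have dom: "z \<in> sc_dom Z" if "norm z < 1" for z
    using disc_minus_subset_sc_dom[OF nZ, of Z z] nZ that by force
  have nz: "deriv f z \<noteq> 0" if "norm z < 1" for z
    by (rule holomorphic_injective_imp_regular[OF hol open_ball inj]) (use that in simp)
  have d1: "(f has_field_derivative deriv f z) (at z)" if "norm z < 1" for z
    using hol by (rule holomorphic_derivI) (use that in auto)
  have d2: "(deriv f has_field_derivative deriv (deriv f) z) (at z)" if "norm z < 1" for z
    by (rule holomorphic_derivI[OF holomorphic_deriv[OF hol open_ball] open_ball]) (use that in auto)
  define h where "h = (\<lambda>z. deriv f z * exp (2 * sc_log Z t z))"
  have h: "(h has_field_derivative 0) (at z)" if z: "norm z < 1" for z
  proof -
    let ?s = "\<Sum>\<eta>\<in>Z. of_real (t \<eta>) * (cnj \<eta> / (1 - cnj \<eta> * z))"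
    have "deriv (deriv f) z = deriv f z * (2 * ?s)" using ode[OF z] nz[OF z] by (simp add: field_simps)
    moreover have "(h has_field_derivative (deriv (deriv f) z - deriv f z * (2 * ?s)) * exp (2 * sc_log Z t z)) (at z)"
      unfolding h_def using d2[OF z] has_field_derivative_sc_log[OF fin dom[OF z], of t]
      by (auto intro!: derivative_eq_intros simp: algebra_simps)
    ultimately show ?thesis by simp
  qed
  have "\<exists>c. \<forall>z\<in>ball 0 1. h z = c"
    by (rule has_field_derivative_zero_constant[OF convex_ball]) (use h in \<open>auto intro: has_field_derivative_at_within\<close>)
  then obtain C where C: "\<And>z. norm z < 1 \<Longrightarrow> h z = C" by auto
  have f': "deriv f z = C * exp (- 2 * sc_log Z t z)" if "norm z < 1" for z
  proof -
    have "C * exp (- 2 * sc_log Z t z) = deriv f z * (exp (2 * sc_log Z t z) * exp (- 2 * sc_log Z t z))"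
      using C[OF that] by (simp add: h_def)
    also have "exp (2 * sc_log Z t z) * exp (- 2 * sc_log Z t z) = 1" by (simp flip: exp_add)
    finally show ?thesis by simp
  qed
  have C0: "C \<noteq> 0" using f'[of 0] nz[of 0] by auto
  obtain F where F: "F 0 = f 0"
    "\<And>z. z \<in> sc_dom Z \<Longrightarrow> (F has_field_derivative C * exp (- 2 * sc_log Z t z)) (at z)"
    using sc_primitive[OF fin] by blast
  have "\<exists>c. \<forall>z\<in>ball 0 1. F z - f z = c"
  proof (rule has_field_derivative_zero_constant[OF convex_ball])
    fix z :: complex assume "z \<in> ball 0 1"
    then have z: "norm z < 1" by simp
    have "((\<lambda>z. F z - f z) has_field_derivative C * exp (- 2 * sc_log Z t z) - deriv f z) (at z)"
      by (intro DERIV_diff F(2) dom z d1)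
    then show "((\<lambda>z. F z - f z) has_field_derivative 0) (at z within ball 0 1)"
      using f'[OF z] by (simp add: has_field_derivative_at_within)
  qed
  then have "F z = f z" if "norm z < 1" for z using F(1) that by (metis eq_iff_diff_eq_0 mem_ball_0 norm_zero zero_less_one)
  then show ?thesis using that C0 F(2) by blast
qed

lemma prevertices_cong:
  assumes "\<And>z. norm z < 1 \<Longrightarrow> F z = f z" shows "prevertices F = prevertices f"
proof -
  have "F ` ball 0 1 = f ` ball 0 1" using assms by (intro image_cong) auto
  moreover have "filterlim F A (at \<zeta> within ball 0 1) \<longleftrightarrow> filterlim f A (at \<zeta> within ball 0 1)" for \<zeta> A
    by (intro filterlim_cong refl) (use assms in \<open>auto simp: eventually_at_filter intro!: always_eventually\<close>)
  ultimately show ?thesis unfolding prevertices_def by simp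
qed

lemma prevertices_of_sc:
  assumes n: "2 \<le> n" and a: "\<And>k. k \<in> {1..n} \<Longrightarrow> norm (a k) < 1"
    and Z_def: "Z = {z. norm z = 1 \<and> z * blaschke n a z = 1}" and cZ: "card Z = n + 1"
    and sc: "sc_with_blaschke n a f"
  shows "prevertices f = Z"
proof -
  obtain t where t: "\<And>\<eta>. \<eta> \<in> Z \<Longrightarrow> 0 < (t \<eta> :: real)" "sum t Z = 1"
    "\<And>z. norm z < 1 \<Longrightarrow> 2 * blaschke n a z / (1 - z * blaschke n a z)
        = 2 * (\<Sum>\<eta>\<in>Z. of_real (t \<eta>) * (cnj \<eta> / (1 - cnj \<eta> * z)))"
    by (rule blaschke_partial_fractions[OF a Z_def cZ]) auto
  have fin: "finite Z" using cZ by (intro card_ge_0_finite) simp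
  have nZ: "\<And>\<eta>. \<eta> \<in> Z \<Longrightarrow> norm \<eta> = 1" by (simp add: Z_def)
  obtain C F where F: "C \<noteq> 0"
    "\<And>z. z \<in> sc_dom Z \<Longrightarrow> (F has_field_derivative C * exp (- 2 * sc_log Z t z)) (at z)"
    "\<And>z. norm z < 1 \<Longrightarrow> F z = f z"
  proof (rule pre_schwarzian_determines[OF fin nZ])
    show "f holomorphic_on ball 0 1" "inj_on f (ball 0 1)"
      using sc by (auto simp: sc_with_blaschke_def schwarz_christoffel_def)
    show "deriv (deriv f) z / deriv f z = 2 * (\<Sum>\<eta>\<in>Z. of_real (t \<eta>) * (cnj \<eta> / (1 - cnj \<eta> * z)))"
      if "norm z < 1" for z
      using sc t(3)[OF that] that by (simp add: sc_with_blaschke_def)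
  qed auto
  interpret sc_map Z t C F
    by unfold_locales (use fin nZ t F n cZ in auto)
  show ?thesis using prevertices_eq prevertices_cong[OF F(3)] by simp
qed

lemma sc_exists:
  assumes n: "2 \<le> n" and a: "\<And>k. k \<in> {1..n} \<Longrightarrow> norm (a k) < 1"
    and Z_def: "Z = {z. norm z = 1 \<and> z * blaschke n a z = 1}" and cZ: "card Z = n + 1"
  shows "\<exists>f. sc_with_blaschke n a f"
proof -
  obtain t where t: "\<And>\<eta>. \<eta> \<in> Z \<Longrightarrow> 0 < (t \<eta> :: real)" "sum t Z = 1"
    "\<And>z. norm z < 1 \<Longrightarrow> 2 * blaschke n a z / (1 - z * blaschke n a z)
        = 2 * (\<Sum>\<eta>\<in>Z. of_real (t \<eta>) * (cnj \<eta> / (1 - cnj \<eta> * z)))"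
    by (rule blaschke_partial_fractions[OF a Z_def cZ]) auto
  have fin: "finite Z" using cZ by (intro card_ge_0_finite) simp
  have nZ: "\<And>\<eta>. \<eta> \<in> Z \<Longrightarrow> norm \<eta> = 1" by (simp add: Z_def)
  obtain F where F: "\<And>z. z \<in> sc_dom Z \<Longrightarrow> (F has_field_derivative 1 * exp (- 2 * sc_log Z t z)) (at z)"
    using sc_primitive[OF fin, of _ 1 t] by blast
  interpret sc_map Z t 1 F
    by unfold_locales (use fin nZ t F n cZ in auto)
  have "deriv (deriv F) z / deriv F z = 2 * blaschke n a z / (1 - z * blaschke n a z)"
    if z: "norm z < 1" for z
  proof -
    let ?s = "\<Sum>\<eta>\<in>Z. of_real (t \<eta>) * (cnj \<eta> / (1 - cnj \<eta> * z))"
    have d: "deriv F w = exp (- 2 * sc_log Z t w)" if "norm w < 1" for w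
      using DERIV_imp_deriv[OF F[OF ball_subset[OF that]]] by simp
    have "((\<lambda>w. exp (- 2 * sc_log Z t w)) has_field_derivative exp (- 2 * sc_log Z t z) * (2 * ?s)) (at z)"
      using has_field_derivative_sc_log[OF fin ball_subset[OF z], of t]
      by (auto intro!: derivative_eq_intros)
    then have "(deriv F has_field_derivative exp (- 2 * sc_log Z t z) * (2 * ?s)) (at z)"
      by (rule has_field_derivative_transform_within_open[OF _ open_ball[of 0 1]]) (use d z in auto)
    then have "deriv (deriv F) z = exp (- 2 * sc_log Z t z) * (2 * ?s)" by (rule DERIV_imp_deriv)
    then show ?thesis using d[OF z] t(3)[OF z] by simp
  qed
  then have "sc_with_blaschke n a F"
    using is_schwarz_christoffel cZ by (simp add: sc_with_blaschke_def)
  then show ?thesis by (intro exI[of _ F])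
qed

section \<open>Harmonic measure estimates\<close>

text \<open>A continuous argument on the circle of the Blaschke factor with zero \<open>a\<close>:
  at \<open>cis x\<close> the factor is \<open>cis x * w / cnj w\<close> with
  \<open>w = 1 - a * cis (- x)\<close>. For \<open>norm a < 1\<close> the real part of
  \<open>w\<close> is positive, so the principal logarithm causes no jump.\<close>

definition blaschke_angle :: "complex \<Rightarrow> real \<Rightarrow> real" where
  "blaschke_angle a x = x + 2 * Im (Ln (1 - a * cis (- x)))"

definition root_angle :: "nat \<Rightarrow> (nat \<Rightarrow> complex) \<Rightarrow> real \<Rightarrow> real" where
  "root_angle n a x = x + (\<Sum>k=1..n. blaschke_angle (a k) x)"

lemma Re_one_minus_mult_cis: "norm a < 1 \<Longrightarrow> 0 < Re (1 - a * cis x)"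
  using complex_Re_le_cmod[of "a * cis x"] by (simp add: norm_mult del: times_complex.simps)

lemma Im_Ln_cnj: "0 < Re w \<Longrightarrow> Im (Ln (cnj w)) = - Im (Ln w)"
  by (subst cnj_Ln[symmetric]) (auto simp: complex_nonpos_Reals_iff)

lemma blaschke_factor_cis:
  assumes "norm a < 1"
  shows "(cis x - a) / (1 - cnj a * cis x) = cis (blaschke_angle a x)"
proof -
  define w where "w = 1 - a * cis (- x)"
  have "0 < Re w" unfolding w_def by (rule Re_one_minus_mult_cis[OF assms])
  then have w: "w \<noteq> 0" by auto
  have e: "w = of_real (norm w) * cis (Im (Ln w))" by (rule polar_Ln[OF w])
  have c: "cnj w = of_real (norm w) * cis (- Im (Ln w))"
    using arg_cong[OF e, of cnj] by (simp only: complex_cnj_mult complex_cnj_complex_of_real cis_cnj)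
  have "cis x - a = cis x * w" by (simp add: w_def right_diff_distrib cis_mult mult.left_commute)
  moreover have "1 - cnj a * cis x = cnj w" by (simp add: w_def cis_cnj)
  moreover have "w / cnj w = cis (2 * Im (Ln w))"
  proof -
    have "cis (2 * Im (Ln w)) * cnj w = of_real (norm w) * (cis (2 * Im (Ln w)) * cis (- Im (Ln w)))"
      by (subst c) (simp only: mult_ac)
    also have "cis (2 * Im (Ln w)) * cis (- Im (Ln w)) = cis (Im (Ln w))" by (simp add: cis_mult)
    finally have "cis (2 * Im (Ln w)) * cnj w = w" using e by simp
    then show ?thesis using w by (simp add: field_simps)
  qed
  ultimately have "(cis x - a) / (1 - cnj a * cis x) = cis x * cis (2 * Im (Ln w))"
    by (simp only: times_divide_eq_right[symmetric])
  then show ?thesis by (simp add: blaschke_angle_def cis_mult w_def)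
qed

lemma cis_sum: "cis (sum f A) = (\<Prod>k\<in>A. cis (f k))"
  by (induction A rule: infinite_finite_induct) (simp_all add: cis_mult[symmetric])

lemma cis_root_angle:
  assumes "\<forall>k\<in>{1..n}. norm (a k) < 1"
  shows "cis x * blaschke n a (cis x) = cis (root_angle n a x)"
  unfolding root_angle_def blaschke_def cis_mult[symmetric] cis_sum
  using assms by (simp add: blaschke_factor_cis)

lemma blaschke_angle_cont: "norm a < 1 \<Longrightarrow> continuous_on UNIV (blaschke_angle a)"
  unfolding blaschke_angle_def cis_conv_exp
proof (intro continuous_intros)
  fix x assume "norm a < 1"
  then have "0 < Re (1 - a * cis (- x))" by (rule Re_one_minus_mult_cis)
  then show "1 - a * exp (\<i> * complex_of_real (- x)) \<notin> \<real>\<^sub>\<le>\<^sub>0"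
    unfolding cis_conv_exp[symmetric] by (auto simp: complex_nonpos_Reals_iff)
qed

lemma root_angle_cont:
  assumes "\<forall>k\<in>{1..n}. norm (a k) < 1" shows "continuous_on A (root_angle n a)"
proof -
  have "continuous_on UNIV (\<lambda>x. x + (\<Sum>k=1..n. blaschke_angle (a k) x))"
    using assms by (intro continuous_intros blaschke_angle_cont) auto
  then show ?thesis unfolding root_angle_def [abs_def] by (rule continuous_on_subset) simp
qed

lemma root_angle_period: "root_angle n a (x + 2 * pi) = root_angle n a x + 2 * pi * real (n + 1)"
proof -
  have "cis (- x - 2 * pi) = cis (- x)" by (simp add: cis_divide[symmetric])
  then have "blaschke_angle b (x + 2 * pi) = blaschke_angle b x + 2 * pi" for b
    by (simp add: blaschke_angle_def)
  then show ?thesis by (simp add: root_angle_def sum.distrib algebra_simps)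
qed

text \<open>\<open>x\<close> and \<open>\<rho>\<close> stand for the real part and the modulus of
  the zero, \<open>c\<close> for \<open>cos \<sigma>\<close>. The identity \<open>id\<close> splits
  the expression into three nonpositive terms, and the first two vanish together only if the zero is
  the real number \<open>r\<close>.\<close>

lemma extremal_bracket:
  fixes x \<rho> r c :: real
  assumes "x \<le> \<rho>" "0 \<le> \<rho>" "\<rho> \<le> r" "r < 1" "c \<le> 1"
  shows "- (r - x) - r * (x * r - \<rho>^2) + c * (r^2 - \<rho>^2) \<le> 0"
    and "- (r - x) - r * (x * r - \<rho>^2) + c * (r^2 - \<rho>^2) = 0 \<Longrightarrow> \<rho> = r \<and> x = \<rho>"
proof -
  have id: "- (r - x) - r * (x * r - \<rho>^2) + c * (r^2 - \<rho>^2)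
      = - ((\<rho> - x) * (1 - r^2)) - (r - \<rho>) * ((1 - r) * (1 - \<rho>)) - (1 - c) * ((r - \<rho>) * (r + \<rho>))"
    by (simp add: power2_eq_square algebra_simps)
  have "r^2 < 1" using assms by (simp add: abs_square_less_1)
  then have 1: "0 \<le> (\<rho> - x) * (1 - r^2)" using assms by simp
  have 2: "0 \<le> (r - \<rho>) * ((1 - r) * (1 - \<rho>))" using assms by simp
  have 3: "0 \<le> (1 - c) * ((r - \<rho>) * (r + \<rho>))" using assms by simp
  show "- (r - x) - r * (x * r - \<rho>^2) + c * (r^2 - \<rho>^2) \<le> 0" unfolding id using 1 2 3 by linarith
  assume "- (r - x) - r * (x * r - \<rho>^2) + c * (r^2 - \<rho>^2) = 0"
  then have "(\<rho> - x) * (1 - r^2) = 0" "(r - \<rho>) * ((1 - r) * (1 - \<rho>)) = 0"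
    unfolding id using 1 2 3 by linarith+
  then show "\<rho> = r \<and> x = \<rho>" using assms \<open>r^2 < 1\<close> by auto
qed

text \<open>The two arguments differ by \<open>pi\<close> times a harmonic measure, up to normalization. Over the disk
  \<open>norm b \<le> r\<close> it is largest at \<open>b = r\<close>: multiplying by the square of \<open>1 - r * cis \<sigma>\<close>
  reduces this to the sign of an imaginary part.\<close>

lemma arg_diff_upper:
  assumes r: "norm b \<le> r" "r < 1" and s: "0 < \<sigma>" "\<sigma> < pi"
  shows "Im (Ln (1 - b * cis (- \<sigma>))) - Im (Ln (1 - b * cis \<sigma>)) \<le> 2 * Im (Ln (1 - of_real r * cis (- \<sigma>)))"
    and "Im (Ln (1 - b * cis (- \<sigma>))) - Im (Ln (1 - b * cis \<sigma>)) = 2 * Im (Ln (1 - of_real r * cis (- \<sigma>)))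
      \<Longrightarrow> b = of_real r"
proof -
  define P where "P = 1 - b * cis (- \<sigma>)"
  define Q where "Q = 1 - b * cis \<sigma>"
  define R where "R = 1 - of_real r * cis (- \<sigma>)"
  have r0: "0 \<le> r" using r(1) norm_ge_zero[of b] by linarith
  have nb: "norm b < 1" using r by simp
  have nr: "norm (complex_of_real r) < 1" using r0 r by simp
  have pos: "0 < Re P" "0 < Re Q" "0 < Re R"
    unfolding P_def Q_def R_def using Re_one_minus_mult_cis nb nr by blast+
  have nz: "P \<noteq> 0" "Q \<noteq> 0" "R \<noteq> 0" using pos by auto
  define p where "p = Im (Ln P)"
  define q where "q = Im (Ln Q)"
  define l where "l = Im (Ln R)"
  have cn: "cnj w = of_real (norm w) * cis (- Im (Ln w))" if "w \<noteq> 0" for w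
    using arg_cong[OF polar_Ln[OF that], of cnj]
    by (simp only: complex_cnj_mult complex_cnj_complex_of_real cis_cnj)
  have "P * cnj Q * (cnj R * cnj R)
      = of_real (norm P * norm Q * (norm R * norm R)) * (cis p * cis (- q) * (cis (- l) * cis (- l)))"
    by (subst polar_Ln[OF nz(1)], subst cn[OF nz(2)], subst (1 2) cn[OF nz(3)])
       (simp only: p_def q_def l_def of_real_mult mult_ac)
  also have "cis p * cis (- q) * (cis (- l) * cis (- l)) = cis (p - q - 2 * l)"
    unfolding cis_mult by (rule arg_cong[of _ _ cis]) argo
  finally have im1: "Im (P * cnj Q * (cnj R * cnj R))
      = norm P * norm Q * (norm R * norm R) * sin (p - q - 2 * l)" by simp
  define x where "x = Re b"
  define y where "y = Im b"
  define \<rho> where "\<rho> = norm b"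
  have \<rho>2: "\<rho>^2 = x^2 + y^2" by (simp add: \<rho>_def x_def y_def cmod_power2)
  have b: "b = Complex x y" by (simp add: x_def y_def)
  have sc: "sin \<sigma> ^ 2 = 1 - cos \<sigma> ^ 2" by (simp add: sin_squared_eq)
  \<comment> \<open>For \<open>b = r\<close> one has \<open>P * cnj Q = R * R\<close>, so the factor
    \<open>cnj R * cnj R\<close> subtracts exactly the extremal angle. In general the sign is that
    of the bracket, as \<open>sin \<sigma>\<close> is positive.\<close>
  have im2: "Im (P * cnj Q * (cnj R * cnj R))
      = 2 * sin \<sigma> * (- (r - x) - r * (x * r - \<rho>^2) + cos \<sigma> * (r^2 - \<rho>^2))"
  proof -
    define S where "S = sin \<sigma>"
    define T where "T = cos \<sigma>"
    have e1: "P = Complex (1 - (x * T + y * S)) (x * S - y * T)"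
      by (simp add: P_def b complex_eq_iff S_def T_def)
    have e2: "cnj Q = Complex (1 - (x * T - y * S)) (x * S + y * T)"
      by (simp add: Q_def b complex_eq_iff S_def T_def)
    have e3: "cnj R = Complex (1 - r * T) (- (r * S))"
      by (simp add: R_def complex_eq_iff S_def T_def)
    have ST: "S * S = 1 - T * T" using sc by (simp add: S_def T_def power2_eq_square)
    define A where "A = Re (P * cnj Q)"
    define B where "B = Im (P * cnj Q)"
    have A: "A = 1 - 2 * x * T + (x^2 + y^2) * (T * T - S * S)"
      unfolding A_def e1 e2 e3 by (simp add: power2_eq_square algebra_simps)
    have B: "B = 2 * x * S - (x^2 + y^2) * (2 * S * T)"
      unfolding B_def e1 e2 e3 by (simp add: power2_eq_square algebra_simps)
    define A' where "A' = Re (cnj R * cnj R)"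
    define B' where "B' = Im (cnj R * cnj R)"
    have A': "A' = 1 - 2 * r * T + r^2 * (T * T - S * S)"
      unfolding A'_def e1 e2 e3 by (simp add: power2_eq_square algebra_simps)
    have B': "B' = - 2 * r * S + r^2 * (2 * S * T)"
      unfolding B'_def e1 e2 e3 by (simp add: power2_eq_square algebra_simps)
    have "Im (P * cnj Q * (cnj R * cnj R)) = A * B' + B * A'"
      by (simp only: A_def B_def A'_def B'_def times_complex.simps(2)[of "P * cnj Q"])
    also have "\<dots> = 2 * S * (- (r - x) - r * (x * r - (x^2 + y^2)) + T * (r^2 - (x^2 + y^2)))"
    proof -
      define m where "m = x^2 + y^2"
      have TT: "T * T = 1 - S * S" using ST by simp
      have "A * B' + B * A' - 2 * S * (- (r - x) - r * (x * r - m) + T * (r^2 - m))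
          = - ((S * S + T * T - 1) * (2 * S * (r^2 * x - m * r)))"
        unfolding A B A' B' m_def[symmetric]
        by (simp add: power2_eq_square algebra_simps)
      also have "\<dots> = 0" using TT by simp
      finally show ?thesis unfolding m_def by simp
    qed
    finally show ?thesis unfolding \<rho>2 S_def T_def .
  qed
  have xr: "x \<le> \<rho>" "0 \<le> \<rho>" "\<rho> \<le> r" using r complex_Re_le_cmod[of b] by (auto simp: x_def \<rho>_def)
  note br = extremal_bracket[OF xr r(2) cos_le_one[of \<sigma>]]
  have sp: "0 < sin \<sigma>" using s by (intro sin_gt_zero)
  have N: "0 < norm P * norm Q * (norm R * norm R)" using nz by simp
  have "norm P * norm Q * (norm R * norm R) * sin (p - q - 2 * l) \<le> 0"
    unfolding im1[symmetric] im2 using sp br(1) by (intro mult_nonneg_nonpos) auto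
  then have le: "sin (p - q - 2 * l) \<le> 0" using mult_pos_pos[OF N, of "sin (p - q - 2 * l)"] by (meson not_le)
  have bd: "\<bar>p\<bar> < pi/2" "\<bar>q\<bar> < pi/2" "\<bar>l\<bar> < pi/2"
    unfolding p_def q_def l_def by (rule Re_Ln_pos_lt_imp, rule pos)+
  have l0: "0 \<le> l"
  proof -
    have "Im R = r * sin \<sigma>" by (simp add: R_def)
    then have "0 \<le> Im R" using r0 sp by simp
    then show ?thesis unfolding l_def using Im_Ln_pos_le[OF nz(3)] by blast
  qed
  have "p - q - 2 * l \<le> 0"
  proof (rule ccontr)
    assume "\<not> p - q - 2 * l \<le> 0"
    \<comment> \<open>Only this side needs a bound: from \<open>p - q < pi\<close> and
      \<open>0 \<le> l\<close> a positive difference would have a positive sine.\<close>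
    moreover have "p - q - 2 * l < pi" using bd l0 by argo
    ultimately have "0 < sin (p - q - 2 * l)" by (intro sin_gt_zero) auto
    then show False using le by simp
  qed
  then show "Im (Ln (1 - b * cis (- \<sigma>))) - Im (Ln (1 - b * cis \<sigma>)) \<le> 2 * Im (Ln (1 - of_real r * cis (- \<sigma>)))"
    by (simp add: p_def q_def l_def P_def Q_def R_def)
  assume "Im (Ln (1 - b * cis (- \<sigma>))) - Im (Ln (1 - b * cis \<sigma>)) = 2 * Im (Ln (1 - of_real r * cis (- \<sigma>)))"
  then have "p - q - 2 * l = 0" by (simp add: p_def q_def l_def P_def Q_def R_def)
  then have "2 * sin \<sigma> * (- (r - x) - r * (x * r - \<rho>^2) + cos \<sigma> * (r^2 - \<rho>^2)) = 0"
    using im1 im2 by simp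
  then have "\<rho> = r \<and> x = \<rho>" using sp br(2) by simp
  then have "x = r" "y = 0" using \<rho>2 by auto
  then show "b = of_real r" using b by (simp add: complex_eq_iff)
qed

text \<open>The upper bound for \<open>- b\<close> and \<open>pi - \<sigma>\<close>, that is for the
  complementary arc: the two negations cancel inside the logarithms and exchange the end
  points.\<close>

lemma arg_diff_lower:
  assumes r: "norm b \<le> r" "r < 1" and s: "0 < \<sigma>" "\<sigma> < pi"
  shows "2 * Im (Ln (1 - of_real (- r) * cis (- \<sigma>))) \<le> Im (Ln (1 - b * cis (- \<sigma>))) - Im (Ln (1 - b * cis \<sigma>))"
    and "Im (Ln (1 - b * cis (- \<sigma>))) - Im (Ln (1 - b * cis \<sigma>)) = 2 * Im (Ln (1 - of_real (- r) * cis (- \<sigma>)))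
      \<Longrightarrow> b = of_real (- r)"
proof -
  have c: "cis (pi - \<sigma>) = - cis (- \<sigma>)" "cis (- (pi - \<sigma>)) = - cis \<sigma>"
    by (simp_all add: complex_eq_iff)
  have "0 \<le> r" using r(1) norm_ge_zero[of b] by linarith
  then have nr: "norm (complex_of_real (- r)) < 1" using r by simp
  have e: "Im (Ln (1 - of_real r * cis (- (pi - \<sigma>)))) = - Im (Ln (1 - of_real (- r) * cis (- \<sigma>)))"
  proof -
    have eq: "1 - of_real r * cis (- (pi - \<sigma>)) = cnj (1 - of_real (- r) * cis (- \<sigma>))"
      unfolding c by (simp add: cis_cnj)
    show ?thesis unfolding eq by (rule Im_Ln_cnj[OF Re_one_minus_mult_cis[OF nr]])
  qed
  have s': "0 < pi - \<sigma>" "pi - \<sigma> < pi" using s by auto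
  have nb: "norm (- b) \<le> r" using r by simp
  note u = arg_diff_upper[OF nb r(2) s', unfolded e c(1), unfolded c(2)]
  have c2: "1 - - b * - cis \<sigma> = 1 - b * cis \<sigma>" "1 - - b * - cis (- \<sigma>) = 1 - b * cis (- \<sigma>)" by simp_all
  show "2 * Im (Ln (1 - of_real (- r) * cis (- \<sigma>))) \<le> Im (Ln (1 - b * cis (- \<sigma>))) - Im (Ln (1 - b * cis \<sigma>))"
    using u(1) unfolding c2 by linarith
  assume "Im (Ln (1 - b * cis (- \<sigma>))) - Im (Ln (1 - b * cis \<sigma>)) = 2 * Im (Ln (1 - of_real (- r) * cis (- \<sigma>)))"
  then have "- b = of_real r" using u(2) unfolding c2 by linarith
  then show "b = of_real (- r)" by (metis minus_minus of_real_minus)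
qed

section \<open>Blaschke angles with a real zero, and increments over an arc\<close>

lemma blaschke_angle_real_odd:
  assumes "\<bar>\<rho>\<bar> < 1"
  shows "blaschke_angle (of_real \<rho>) (- x) = - blaschke_angle (of_real \<rho>) x"
proof -
  have "norm (complex_of_real \<rho>) < 1" using assms by simp
  note p = Re_one_minus_mult_cis[OF this, of "- x"]
  have eq: "1 - of_real \<rho> * cis (- (- x)) = cnj (1 - of_real \<rho> * cis (- x))" by (simp add: cis_cnj)
  have e: "Im (Ln (1 - of_real \<rho> * cis (- (- x)))) = - Im (Ln (1 - of_real \<rho> * cis (- x)))"
    unfolding eq by (rule Im_Ln_cnj[OF p])
  show ?thesis unfolding blaschke_angle_def e by simp
qed

lemma cayley_cis: "(1 + \<i> * of_real T) / (1 - \<i> * of_real T) = cis (2 * arctan T)"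
proof -
  have nz: "1 - \<i> * of_real T \<noteq> (0::complex)" by (simp add: complex_eq_iff)
  have c: "cis (arctan T) = of_real (cos (arctan T)) * (1 + \<i> * of_real T)"
    by (simp add: complex_eq_iff cos_arctan sin_arctan)
  have c': "cis (- arctan T) = of_real (cos (arctan T)) * (1 - \<i> * of_real T)"
    by (simp add: complex_eq_iff cos_arctan sin_arctan)
  have "cis (2 * arctan T) * cis (- arctan T) = cis (arctan T)" by (simp add: cis_mult)
  then have "of_real (cos (arctan T)) * (cis (2 * arctan T) * (1 - \<i> * of_real T))
      = of_real (cos (arctan T)) * (1 + \<i> * of_real T)"
    unfolding c c' by (simp only: mult_ac)
  moreover have "complex_of_real (cos (arctan T)) \<noteq> 0" using cos_arctan_not_zero by simp
  ultimately have "cis (2 * arctan T) * (1 - \<i> * of_real T) = 1 + \<i> * of_real T"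
    by (simp only: mult_cancel_left) simp
  then show ?thesis using nz by (simp add: field_simps)
qed

text \<open>In the Cayley coordinate \<open>T = tan (\<sigma> / 2)\<close> the factor with real zero
  \<open>\<rho>\<close> is the dilation of \<open>T\<close> by
  \<open>(1 + \<rho>) / (1 - \<rho>)\<close>. This identifies the angles up to a multiple of
  \<open>2 * pi\<close>.\<close>

lemma blaschke_angle_arctan:
  assumes \<rho>: "\<bar>\<rho>\<bar> < 1" and s: "0 < \<sigma>" "\<sigma> < pi"
  shows "blaschke_angle (of_real \<rho>) \<sigma> = 2 * arctan ((1 + \<rho>) / (1 - \<rho>) * tan (\<sigma> / 2))"
proof -
  define T where "T = tan (\<sigma> / 2)"
  define S where "S = (1 + \<rho>) / (1 - \<rho>) * T"
  have T: "0 < T" unfolding T_def using s by (intro tan_gt_zero) auto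
  have S: "0 < S" unfolding S_def using T \<rho> by simp
  have nr: "norm (complex_of_real \<rho>) < 1" using \<rho> by simp
  have at: "arctan T = \<sigma> / 2" unfolding T_def using s by (intro arctan_tan) auto
  have cs: "cis \<sigma> = (1 + \<i> * of_real T) / (1 - \<i> * of_real T)" unfolding cayley_cis at by simp
  have nz: "1 - \<i> * of_real T \<noteq> (0::complex)" "1 - \<i> * of_real S \<noteq> (0::complex)" by (simp_all add: complex_eq_iff)
  have r1: "complex_of_real (1 - \<rho>) \<noteq> 0" using \<rho> by (simp del: of_real_diff)
  have S': "complex_of_real (1 - \<rho>) * of_real S = of_real (1 + \<rho>) * of_real T"
  proof -
    have "(1 - \<rho>) * S = (1 + \<rho>) * T" using \<rho> unfolding S_def by simp
    from arg_cong[OF this, of complex_of_real] show ?thesis by (simp only: of_real_mult)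
  qed
  have mc: "(1 - \<i> * of_real T) * cis \<sigma> = 1 + \<i> * of_real T" unfolding cs using nz(1) by simp
  have "cis (blaschke_angle (of_real \<rho>) \<sigma>) = (cis \<sigma> - of_real \<rho>) / (1 - of_real \<rho> * cis \<sigma>)"
    using blaschke_factor_cis[OF nr, of \<sigma>] by simp
  also have "\<dots> = ((1 - \<i> * of_real T) * (cis \<sigma> - of_real \<rho>)) / ((1 - \<i> * of_real T) * (1 - of_real \<rho> * cis \<sigma>))"
    using nz(1) by simp
  also have "(1 - \<i> * of_real T) * (cis \<sigma> - of_real \<rho>) = of_real (1 - \<rho>) + \<i> * (of_real (1 + \<rho>) * of_real T)"
    unfolding right_diff_distrib[of _ "cis \<sigma>"] mc by (simp add: algebra_simps)
  also have "(1 - \<i> * of_real T) * (1 - of_real \<rho> * cis \<sigma>) = of_real (1 - \<rho>) - \<i> * (of_real (1 + \<rho>) * of_real T)"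
  proof -
    have "(1 - \<i> * of_real T) * (1 - of_real \<rho> * cis \<sigma>)
        = (1 - \<i> * of_real T) - of_real \<rho> * ((1 - \<i> * of_real T) * cis \<sigma>)"
      by (simp add: algebra_simps)
    also note mc
    finally show ?thesis by (simp add: algebra_simps)
  qed
  also have "(of_real (1 - \<rho>) + \<i> * (of_real (1 + \<rho>) * of_real T)) / (of_real (1 - \<rho>) - \<i> * (of_real (1 + \<rho>) * of_real T))
      = (of_real (1 - \<rho>) * (1 + \<i> * of_real S)) / (of_real (1 - \<rho>) * (1 - \<i> * of_real S))"
    unfolding S'[symmetric] by (simp add: algebra_simps)
  also have "\<dots> = cis (2 * arctan S)" using r1 cayley_cis[of S] by simp
  finally have "cis (blaschke_angle (of_real \<rho>) \<sigma> - 2 * arctan S) = 1"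
    by (simp add: cis_divide[symmetric])
  then obtain k :: int where k: "blaschke_angle (of_real \<rho>) \<sigma> - 2 * arctan S = 2 * pi * of_int k"
    unfolding cis_eq_1_iff by blast
  have "\<bar>Im (Ln (1 - of_real \<rho> * cis (- \<sigma>)))\<bar> < pi / 2"
    by (rule Re_Ln_pos_lt_imp[OF Re_one_minus_mult_cis[OF nr]])
  then have b: "\<sigma> - pi < blaschke_angle (of_real \<rho>) \<sigma>" "blaschke_angle (of_real \<rho>) \<sigma> < \<sigma> + pi"
    unfolding blaschke_angle_def by argo+
  have a: "0 < arctan S" "arctan S < pi / 2" using S arctan_ubound[of S] by auto
  \<comment> \<open>The bounds \<open>a\<close> and \<open>b\<close> keep the difference strictly
    between \<open>- 2 * pi\<close> and \<open>2 * pi\<close>, which leaves only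
    \<open>k = 0\<close>.\<close>
  have "2 * pi * of_int k < 2 * pi * 1" unfolding k[symmetric] using a b s by argo
  then have "(of_int k :: real) < 1" by (rule mult_left_less_imp_less) simp
  moreover have "2 * pi * (-1) < 2 * pi * of_int k" unfolding k[symmetric] using a b s by argo
  then have "-1 < (of_int k :: real)" by (rule mult_left_less_imp_less) simp
  ultimately have "k = 0" by linarith
  then show ?thesis using k by (simp add: S_def T_def)
qed

lemma blaschke_angle_real_pos:
  assumes "\<bar>\<rho>\<bar> < 1" "0 < \<sigma>" "\<sigma> < pi" shows "0 < blaschke_angle (of_real \<rho>) \<sigma>"
proof -
  have "0 < tan (\<sigma> / 2)" using assms by (intro tan_gt_zero) auto
  then show ?thesis unfolding blaschke_angle_arctan[OF assms] using assms(1) by simp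
qed

text \<open>Rotation by \<open>- \<gamma>\<close> moves the centre of the arc to \<open>1\<close>
  and the zero to \<open>a * cis (- \<gamma>)\<close>; this is the shape in which the two estimates
  apply.\<close>

lemma blaschke_angle_increment:
  "blaschke_angle a (\<gamma> + \<sigma>) - blaschke_angle a (\<gamma> - \<sigma>)
    = 2 * \<sigma> + 2 * (Im (Ln (1 - (a * cis (- \<gamma>)) * cis (- \<sigma>))) - Im (Ln (1 - (a * cis (- \<gamma>)) * cis \<sigma>)))"
proof -
  have "(a * cis (- \<gamma>)) * cis (- \<sigma>) = a * cis (- (\<gamma> + \<sigma>))" "(a * cis (- \<gamma>)) * cis \<sigma> = a * cis (- (\<gamma> - \<sigma>))"
    by (simp_all add: mult.assoc cis_mult)
  then show ?thesis by (simp only: blaschke_angle_def) simp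
qed

lemma increment_upper:
  assumes r: "norm a \<le> r" "r < 1" and s: "0 < \<sigma>" "\<sigma> < pi"
  shows "blaschke_angle a (\<gamma> + \<sigma>) - blaschke_angle a (\<gamma> - \<sigma>) \<le> 2 * blaschke_angle (of_real r) \<sigma>"
    and "blaschke_angle a (\<gamma> + \<sigma>) - blaschke_angle a (\<gamma> - \<sigma>) = 2 * blaschke_angle (of_real r) \<sigma>
      \<Longrightarrow> a = of_real r * cis \<gamma>"
proof -
  have nb: "norm (a * cis (- \<gamma>)) \<le> r" using r by (simp add: norm_mult)
  show "blaschke_angle a (\<gamma> + \<sigma>) - blaschke_angle a (\<gamma> - \<sigma>) \<le> 2 * blaschke_angle (of_real r) \<sigma>"
    unfolding blaschke_angle_increment unfolding blaschke_angle_def using arg_diff_upper(1)[OF nb r(2) s] by argo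
  assume "blaschke_angle a (\<gamma> + \<sigma>) - blaschke_angle a (\<gamma> - \<sigma>) = 2 * blaschke_angle (of_real r) \<sigma>"
  then have "a * cis (- \<gamma>) = of_real r"
    unfolding blaschke_angle_increment unfolding blaschke_angle_def by (intro arg_diff_upper(2)[OF nb r(2) s]) argo
  then have "a * cis (- \<gamma>) * cis \<gamma> = of_real r * cis \<gamma>" by simp
  then show "a = of_real r * cis \<gamma>" by (simp add: mult.assoc cis_mult)
qed

lemma increment_lower:
  assumes r: "norm a \<le> r" "r < 1" and s: "0 < \<sigma>" "\<sigma> < pi"
  shows "2 * blaschke_angle (of_real (- r)) \<sigma> \<le> blaschke_angle a (\<gamma> + \<sigma>) - blaschke_angle a (\<gamma> - \<sigma>)"
    and "blaschke_angle a (\<gamma> + \<sigma>) - blaschke_angle a (\<gamma> - \<sigma>) = 2 * blaschke_angle (of_real (- r)) \<sigma>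
      \<Longrightarrow> a = of_real (- r) * cis \<gamma>"
proof -
  have nb: "norm (a * cis (- \<gamma>)) \<le> r" using r by (simp add: norm_mult)
  show "2 * blaschke_angle (of_real (- r)) \<sigma> \<le> blaschke_angle a (\<gamma> + \<sigma>) - blaschke_angle a (\<gamma> - \<sigma>)"
    unfolding blaschke_angle_increment unfolding blaschke_angle_def using arg_diff_lower(1)[OF nb r(2) s] by argo
  assume "blaschke_angle a (\<gamma> + \<sigma>) - blaschke_angle a (\<gamma> - \<sigma>) = 2 * blaschke_angle (of_real (- r)) \<sigma>"
  then have "a * cis (- \<gamma>) = of_real (- r)"
    unfolding blaschke_angle_increment unfolding blaschke_angle_def by (intro arg_diff_lower(2)[OF nb r(2) s]) argo
  then have "a * cis (- \<gamma>) * cis \<gamma> = of_real (- r) * cis \<gamma>" by simp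
  then show "a = of_real (- r) * cis \<gamma>" by (simp add: mult.assoc cis_mult)
qed

lemma increment_real:
  assumes "\<bar>\<rho>\<bar> < 1"
  shows "blaschke_angle (of_real \<rho> * cis \<gamma>) (\<gamma> + \<sigma>) - blaschke_angle (of_real \<rho> * cis \<gamma>) (\<gamma> - \<sigma>)
    = 2 * blaschke_angle (of_real \<rho>) \<sigma>"
proof -
  have "norm (complex_of_real \<rho>) < 1" using assms by simp
  note p = Re_one_minus_mult_cis[OF this, of "- \<sigma>"]
  have 1: "of_real \<rho> * cis \<gamma> * cis (- \<gamma>) = of_real \<rho>" by (simp add: mult.assoc cis_mult)
  have eq: "1 - of_real \<rho> * cis \<sigma> = cnj (1 - of_real \<rho> * cis (- \<sigma>))" by (simp add: cis_cnj)
  have e: "Im (Ln (1 - of_real \<rho> * cis \<sigma>)) = - Im (Ln (1 - of_real \<rho> * cis (- \<sigma>)))"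
    unfolding eq by (rule Im_Ln_cnj[OF p])
  show ?thesis unfolding blaschke_angle_increment 1 e unfolding blaschke_angle_def by simp
qed

section \<open>Roots of the pre-vertex equation on the circle\<close>

definition unit_roots :: "nat \<Rightarrow> (nat \<Rightarrow> complex) \<Rightarrow> complex set" where
  "unit_roots n a = {z. norm z = 1 \<and> z * blaschke n a z = 1}"

context
  fixes n :: nat and a :: "nat \<Rightarrow> complex"
  assumes a: "\<forall>k\<in>{1..n}. norm (a k) < 1"
begin

text \<open>The lower estimate with \<open>r = norm (a k)\<close> already shows that no factor
  decreases over an arc shorter than the circle; the summand \<open>x\<close> makes the growth
  strict.\<close>

lemma root_angle_strict:
  assumes "x < y" "y \<le> x + 2 * pi" shows "root_angle n a x < root_angle n a y"
proof (cases "y = x + 2 * pi")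
  case True
  then show ?thesis by (simp add: root_angle_period add_pos_nonneg)
next
  case False
  define \<sigma> where "\<sigma> = (y - x) / 2"
  define \<gamma> where "\<gamma> = (x + y) / 2"
  have xy: "x = \<gamma> - \<sigma>" "y = \<gamma> + \<sigma>" by (simp_all add: \<sigma>_def \<gamma>_def field_simps)
  have s: "0 < \<sigma>" "\<sigma> < pi" using assms False by (auto simp: \<sigma>_def)
  have "blaschke_angle (a k) x \<le> blaschke_angle (a k) y" if "k \<in> {1..n}" for k
  proof -
    have "0 < blaschke_angle (of_real (- norm (a k))) \<sigma>"
      using bspec[OF a that] s by (intro blaschke_angle_real_pos) auto
    then show ?thesis
      using increment_lower(1)[OF order_refl bspec[OF a that] s, of \<gamma>] unfolding xy by linarith
  qed
  then have "(\<Sum>k=1..n. blaschke_angle (a k) x) \<le> (\<Sum>k=1..n. blaschke_angle (a k) y)" by (rule sum_mono)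
  then show ?thesis using assms(1) by (simp add: root_angle_def)
qed

lemma cis_in_unit_roots: "cis x \<in> unit_roots n a \<longleftrightarrow> (\<exists>m::int. root_angle n a x = 2 * pi * of_int m)"
  using cis_root_angle[OF a, where x = x] by (simp add: unit_roots_def cis_eq_1_iff)

lemma unit_root_at:
  assumes "x < y" "root_angle n a x \<le> 2 * pi * of_int m" "2 * pi * of_int m \<le> root_angle n a y"
  obtains z where "x \<le> z" "z \<le> y" "root_angle n a z = 2 * pi * of_int m"
  using IVT'[of "root_angle n a" x "2 * pi * of_int m" y] assms root_angle_cont[OF a] by auto

text \<open>Over one period \<open>root_angle\<close> increases continuously by
  \<open>2 * pi * real (n + 1)\<close>. A half-open interval of that length contains exactly
  \<open>n + 1\<close> multiples of \<open>2 * pi\<close>, and each is attained exactly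
  once.\<close>

lemma card_unit_roots: "card (unit_roots n a) = n + 1"
proof -
  let ?A = "root_angle n a"
  \<comment> \<open>Numbers the first multiple of \<open>2 * pi\<close> at or above the starting
    value, so the multiples attained are those from \<open>m0\<close> to
    \<open>m0 + int n\<close>.\<close>
  define m0 where "m0 = \<lceil>?A 0 / (2 * pi)\<rceil>"
  have h: "?A 0 / (2 * pi) \<le> of_int m0" "of_int m0 - 1 < ?A 0 / (2 * pi)" unfolding m0_def by linarith+
  have m0: "?A 0 \<le> 2 * pi * of_int m0" "2 * pi * (of_int m0 - 1) < ?A 0"
    using h by (auto simp: pos_divide_le_eq pos_less_divide_eq mult.commute)
  have per: "?A (2 * pi) = ?A 0 + 2 * pi * real (n + 1)" using root_angle_period[of n a 0] by simp
  have "\<exists>z. 0 \<le> z \<and> z < 2 * pi \<and> ?A z = 2 * pi * of_int (m0 + int j)" if "j \<in> {..n}" for j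
  proof -
    have j: "real j \<le> real n" using that by simp
    have "?A 0 \<le> 2 * pi * of_int (m0 + int j)" using m0(1) by (simp add: distrib_left add_increasing2)
    moreover have "2 * pi * of_int (m0 + int j) < ?A (2 * pi)"
    proof -
      have "2 * pi * of_int (m0 + int j) \<le> 2 * pi * ((of_int m0 - 1) + real (n + 1))"
        using j by (intro mult_left_mono) auto
      also have "\<dots> < ?A (2 * pi)" unfolding per using m0(2) by (simp only: distrib_left)
      finally show ?thesis .
    qed
    ultimately obtain z where z: "0 \<le> z" "z \<le> 2 * pi" "?A z = 2 * pi * of_int (m0 + int j)"
      using unit_root_at[of 0 "2 * pi" "m0 + int j"] by force
    then have "z \<noteq> 2 * pi" using \<open>2 * pi * of_int (m0 + int j) < ?A (2 * pi)\<close> by auto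
    then show ?thesis using z by (intro exI[of _ z]) simp
  qed
  then have "\<forall>j\<in>{..n}. \<exists>z. 0 \<le> z \<and> z < 2 * pi \<and> ?A z = 2 * pi * of_int (m0 + int j)" by blast
  from bchoice[OF this] obtain x where
    x: "\<And>j. j \<in> {..n} \<Longrightarrow> 0 \<le> x j" "\<And>j. j \<in> {..n} \<Longrightarrow> x j < 2 * pi"
    "\<And>j. j \<in> {..n} \<Longrightarrow> ?A (x j) = 2 * pi * of_int (m0 + int j)" by blast
  have A2: "Arg2pi (cis y) = y" if "0 \<le> y" "y < 2 * pi" for y
    by (rule Arg2pi_unique[of 1]) (use that in \<open>auto simp: cis_conv_exp\<close>)
  have "inj_on (\<lambda>j. cis (x j)) {..n}"
  proof (rule inj_onI)
    fix i j assume ij: "i \<in> {..n}" "j \<in> {..n}" "cis (x i) = cis (x j)"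
    have "x i = Arg2pi (cis (x i))" using A2[OF x(1,2)[OF ij(1)]] by (rule sym)
    also have "\<dots> = Arg2pi (cis (x j))" using ij(3) by (rule arg_cong)
    also have "\<dots> = x j" by (rule A2[OF x(1,2)[OF ij(2)]])
    finally have "x i = x j" .
    then have "2 * pi * of_int (m0 + int i) = 2 * pi * of_int (m0 + int j)"
      unfolding x(3)[OF ij(1), symmetric] x(3)[OF ij(2), symmetric] by (rule arg_cong)
    then show "i = j" by simp
  qed
  then have "card ((\<lambda>j. cis (x j)) ` {..n}) = n + 1" by (simp add: card_image)
  moreover have "unit_roots n a = (\<lambda>j. cis (x j)) ` {..n}"
  proof (intro set_eqI iffI)
    fix z assume "z \<in> (\<lambda>j. cis (x j)) ` {..n}"
    then obtain j where j: "j \<in> {..n}" "z = cis (x j)" by blast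
    then show "z \<in> unit_roots n a" using x(3)[OF j(1)] cis_in_unit_roots by blast
  next
    fix z assume z: "z \<in> unit_roots n a"
    define y where "y = Arg2pi z"
    have zy: "z = cis y" "0 \<le> y" "y < 2 * pi"
      using Arg2pi_eq[of z] z Arg2pi_ge_0 Arg2pi_lt_2pi by (auto simp: y_def unit_roots_def cis_conv_exp)
    then obtain m :: int where m: "?A y = 2 * pi * of_int m" using z cis_in_unit_roots by blast
    have "?A 0 \<le> ?A y" using root_angle_strict[of 0 y] zy by (cases "y = 0") auto
    then have "2 * pi * (of_int m0 - 1) < 2 * pi * of_int m" using m m0(2) by linarith
    then have "of_int m0 - 1 < (of_int m :: real)" by (rule mult_left_less_imp_less) simp
    then have "m0 \<le> m" by linarith
    have "?A y < ?A (2 * pi)" using root_angle_strict[of y "2 * pi"] zy by simp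
    then have "2 * pi * of_int m < 2 * pi * (of_int m0 + real (n + 1))"
      using m m0(1) unfolding per distrib_left by linarith
    then have "of_int m < of_int m0 + real (n + 1)" by (rule mult_left_less_imp_less) simp
    then have "m < m0 + int n + 1" by linarith
    define j where "j = nat (m - m0)"
    have j: "j \<in> {..n}" "m = m0 + int j" using \<open>m0 \<le> m\<close> \<open>m < m0 + int n + 1\<close> by (auto simp: j_def)
    have e: "?A y = ?A (x j)" using m j x(3)[OF j(1)] by simp
    have "y = x j"
    proof (rule ccontr)
      assume "y \<noteq> x j"
      then show False
        using e root_angle_strict[of y "x j"] root_angle_strict[of "x j" y] zy x(1,2)[OF j(1)]
        by (cases y "x j" rule: linorder_cases) auto
    qed
    then show "z \<in> (\<lambda>j. cis (x j)) ` {..n}" using zy(1) j by blast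
  qed
  ultimately show ?thesis by simp
qed

end

section \<open>Consecutive pre-vertices\<close>

lemma separation_cis:
  assumes "0 \<le> y - x" "y - x < 2 * pi" shows "separation (cis x) (cis y) = y - x"
proof -
  have eq: "cnj (cis x) * cis y = cis (y - x)" by (simp add: cis_cnj cis_mult)
  show ?thesis unfolding separation_def eq
    by (rule Arg2pi_unique[of 1]) (use assms in \<open>auto simp: cis_conv_exp\<close>)
qed

lemma separation_decomp:
  assumes "norm u = 1" "norm v = 1" "u \<noteq> v" "u = cis x"
  shows "v = cis (x + separation u v)" "0 < separation u v" "separation u v < 2 * pi"
proof -
  let ?s = "separation u v"
  have n: "norm (cnj u * v) = 1" using assms by (simp add: norm_mult)
  have c: "cis ?s = cnj u * v" unfolding separation_def by (rule cis_Arg2pi[OF n])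
  have "cis (x + ?s) = (u * cnj u) * v" by (simp only: cis_mult[symmetric] c assms(4)[symmetric] mult.assoc)
  then show v: "v = cis (x + ?s)" using assms(1) by (simp add: complex_norm_square[symmetric])
  have "?s \<noteq> 0" using v assms(3,4) by auto
  then show "0 < ?s" "?s < 2 * pi"
    using Arg2pi_ge_0[of "cnj u * v"] Arg2pi_lt_2pi[of "cnj u * v"] by (simp_all add: separation_def)
qed

lemma prevertices_unit_roots:
  assumes "2 \<le> n" "\<forall>k\<in>{1..n}. norm (a k) < 1" "sc_with_blaschke n a f"
  shows "prevertices f = unit_roots n a"
  by (rule prevertices_of_sc[OF assms(1) _ unit_roots_def card_unit_roots[OF assms(2)] assms(3)])
     (use assms(2) in blast)

context
  fixes n :: nat and a :: "nat \<Rightarrow> complex" and f :: "complex \<Rightarrow> complex"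
  assumes n: "2 \<le> n" and a: "\<forall>k\<in>{1..n}. norm (a k) < 1" and sc: "sc_with_blaschke n a f"
begin

text \<open>The values of \<open>root_angle\<close> at \<open>u\<close> and \<open>v\<close> are
  multiples of \<open>2 * pi\<close>. If they differed by more than one step, continuity would
  produce a root between them, closer to \<open>u\<close> than \<open>v\<close>. The arc is returned
  by centre and half-length, as the estimates require.\<close>

lemma consecutive_imp_increment:
  assumes con: "consecutive f u v"
  obtains \<gamma> \<sigma> where "0 < \<sigma>" "\<sigma> < pi" "u = cis (\<gamma> - \<sigma>)" "v = cis (\<gamma> + \<sigma>)" "separation u v = 2 * \<sigma>"
    "root_angle n a (\<gamma> + \<sigma>) - root_angle n a (\<gamma> - \<sigma>) = 2 * pi"
proof -
  note pv = prevertices_unit_roots[OF n a sc]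
  note strict = root_angle_strict[OF a]
  note unit = cis_in_unit_roots[OF a]
  let ?A = "root_angle n a"
  have uv: "u \<in> unit_roots n a" "v \<in> unit_roots n a" "u \<noteq> v"
    and min: "\<And>w. w \<in> unit_roots n a \<Longrightarrow> w \<noteq> u \<Longrightarrow> separation u v \<le> separation u w"
    using con unfolding consecutive_def pv by blast+
  have nuv: "norm u = 1" "norm v = 1" using uv by (auto simp: unit_roots_def)
  define x where "x = Arg2pi u"
  define s where "s = separation u v"
  have u: "u = cis x" unfolding x_def by (rule cis_Arg2pi[OF nuv(1), symmetric])
  note dec = separation_decomp[OF nuv uv(3) u, folded s_def]
  obtain m1 :: int where m1: "?A x = 2 * pi * of_int m1" using uv(1) unit u by blast
  obtain m2 :: int where m2: "?A (x + s) = 2 * pi * of_int m2" using uv(2) unit dec(1) by blast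
  have "?A x < ?A (x + s)" using dec by (intro strict) auto
  then have "2 * pi * of_int m1 < 2 * pi * of_int m2" unfolding m1 m2 .
  then have "of_int m1 < (of_int m2 :: real)" by (rule mult_left_less_imp_less) simp
  then have lt: "m1 + 1 \<le> m2" by simp
  have "m2 = m1 + 1"
  proof (rule ccontr)
    assume "m2 \<noteq> m1 + 1"
    then have "(of_int (m1 + 1) :: real) < of_int m2" using lt by linarith
    then have l2: "2 * pi * of_int (m1 + 1) < ?A (x + s)" unfolding m2 by (intro mult_strict_left_mono) auto
    have l1: "?A x < 2 * pi * of_int (m1 + 1)" unfolding m1 by (intro mult_strict_left_mono) auto
    have xs: "x < x + s" using dec by simp
    obtain z where z: "x \<le> z" "z \<le> x + s" "?A z = 2 * pi * of_int (m1 + 1)"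
      by (rule unit_root_at[OF a xs less_imp_le[OF l1] less_imp_le[OF l2]])
    have "z \<noteq> x" "z \<noteq> x + s" using z(3) l1 l2 by auto
    then have zs: "x < z" "z < x + s" using z by auto
    have "separation u (cis z) = z - x" unfolding u by (rule separation_cis) (use zs dec in auto)
    moreover have "cis z \<in> unit_roots n a" using z(3) unit by blast
    moreover have "cis z \<noteq> u"
    proof
      assume "cis z = u"
      then have "separation u (cis z) = 0" unfolding u using separation_cis[of x x] by simp
      then show False using calculation(1) zs by simp
    qed
    ultimately show False using min[of "cis z"] zs by (simp add: s_def)
  qed
  then have inc: "?A (x + s) - ?A x = 2 * pi" unfolding m1 m2 by (simp add: algebra_simps)
  show ?thesis
  proof (rule that[of "s / 2" "x + s / 2"])
    have e: "x + s / 2 + s / 2 = x + s" "x + s / 2 - s / 2 = x" by simp_all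
    show "u = cis (x + s / 2 - s / 2)" "v = cis (x + s / 2 + s / 2)" unfolding e using u dec(1) by simp_all
    show "?A (x + s / 2 + s / 2) - ?A (x + s / 2 - s / 2) = 2 * pi" unfolding e by (rule inc)
  qed (use dec in \<open>auto simp: s_def\<close>)
qed

text \<open>By strict monotonicity a root inside the arc would need a multiple of
  \<open>2 * pi\<close> strictly between two neighbouring ones.\<close>

lemma increment_imp_consecutive:
  assumes s: "0 < \<sigma>" "\<sigma> < pi" and u: "cis (\<gamma> - \<sigma>) \<in> unit_roots n a" and v: "cis (\<gamma> + \<sigma>) \<in> unit_roots n a"
    and inc: "root_angle n a (\<gamma> + \<sigma>) - root_angle n a (\<gamma> - \<sigma>) = 2 * pi"
  shows "consecutive f (cis (\<gamma> - \<sigma>)) (cis (\<gamma> + \<sigma>))" "separation (cis (\<gamma> - \<sigma>)) (cis (\<gamma> + \<sigma>)) = 2 * \<sigma>"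
proof -
  note pv = prevertices_unit_roots[OF n a sc]
  let ?A = "root_angle n a"
  let ?x = "\<gamma> - \<sigma>"
  have "separation (cis ?x) (cis (\<gamma> + \<sigma>)) = (\<gamma> + \<sigma>) - ?x" by (rule separation_cis) (use s in auto)
  then show sep: "separation (cis ?x) (cis (\<gamma> + \<sigma>)) = 2 * \<sigma>" by simp
  have "2 * \<sigma> \<le> separation (cis ?x) w" if w: "w \<in> unit_roots n a" "w \<noteq> cis ?x" for w
  proof (rule ccontr)
    assume less: "\<not> 2 * \<sigma> \<le> separation (cis ?x) w"
    define s' where "s' = separation (cis ?x) w"
    have nw: "norm w = 1" using w by (simp add: unit_roots_def)
    note dec = separation_decomp[OF norm_cis nw w(2)[symmetric] refl, folded s'_def]
    have s': "s' < 2 * \<sigma>" using less by (simp add: s'_def)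
    have 1: "?A ?x < ?A (?x + s')" using dec by (intro root_angle_strict[OF a]) auto
    have 2: "?A (?x + s') < ?A (\<gamma> + \<sigma>)" using dec s' s by (intro root_angle_strict[OF a]) auto
    obtain m1 :: int where m1: "?A ?x = 2 * pi * of_int m1" using u cis_in_unit_roots[OF a] by blast
    have "cis (?x + s') \<in> unit_roots n a" using w(1) dec(1) by simp
    then obtain m2 :: int where m2: "?A (?x + s') = 2 * pi * of_int m2" using cis_in_unit_roots[OF a] by blast
    have "2 * pi * of_int m1 < 2 * pi * of_int m2" using 1 unfolding m1 m2 .
    then have "of_int m1 < (of_int m2 :: real)" by (rule mult_left_less_imp_less) simp
    moreover have "2 * pi * of_int m2 < 2 * pi * of_int (m1 + 1)"
      using 2 inc unfolding m1 m2 of_int_add distrib_left by simp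
    then have "of_int m2 < (of_int (m1 + 1) :: real)" by (rule mult_left_less_imp_less) simp
    ultimately show False unfolding of_int_less_iff by simp
  qed
  moreover have "cis ?x \<noteq> cis (\<gamma> + \<sigma>)"
  proof
    assume e: "cis ?x = cis (\<gamma> + \<sigma>)"
    have "separation (cis ?x) (cis ?x) = 0" using separation_cis[of ?x ?x] by simp
    then show False using sep s unfolding e by simp
  qed
  ultimately show "consecutive f (cis ?x) (cis (\<gamma> + \<sigma>))"
    unfolding consecutive_def pv sep using u v by blast
qed

end

section \<open>Symmetric configurations\<close>

lemma symmetric_value:
  assumes c: "norm c = 1" and \<rho>: "\<bar>\<rho>\<bar> < 1" and a: "\<And>k. k \<in> {1..n} \<Longrightarrow> a k = of_real \<rho> * c"
  shows "(cis x * c) * blaschke n a (cis x * c)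
    = c ^ (n + 1) * cis (x + real n * blaschke_angle (of_real \<rho>) x)"
proof -
  have cc: "cnj c * c = 1" using c complex_norm_square[of c] by (simp add: mult.commute)
  have nr: "norm (complex_of_real \<rho>) < 1" using \<rho> by simp
  \<comment> \<open>Rotating by \<open>c\<close> reduces every factor to the one with zero
    \<open>\<rho>\<close> at the cost of one factor \<open>c\<close>; together with the leading
    \<open>z\<close> these make up \<open>c ^ (n + 1)\<close>.\<close>
  have "blaschke n a (cis x * c) = (\<Prod>k=1..n. c * cis (blaschke_angle (of_real \<rho>) x))"
    unfolding blaschke_def
  proof (intro prod.cong refl)
    fix k assume k: "k \<in> {1..n}"
    have 1: "cis x * c - a k = c * (cis x - of_real \<rho>)" by (simp add: a[OF k] algebra_simps)
    have "cnj (a k) * (cis x * c) = of_real \<rho> * ((cnj c * c) * cis x)" by (simp add: a[OF k] mult_ac)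
    then have 2: "1 - cnj (a k) * (cis x * c) = 1 - cnj (of_real \<rho>) * cis x" unfolding cc by simp
    show "(cis x * c - a k) / (1 - cnj (a k) * (cis x * c)) = c * cis (blaschke_angle (of_real \<rho>) x)"
      unfolding 1 2 blaschke_factor_cis[OF nr, symmetric] by simp
  qed
  also have "\<dots> = c ^ n * cis (real n * blaschke_angle (of_real \<rho>) x)"
    unfolding prod_constant card_atLeastAtMost diff_Suc_1 power_mult_distrib Complex.DeMoivre ..
  finally show ?thesis by (simp add: cis_mult[symmetric] mult_ac)
qed

text \<open>At \<open>cis \<theta> * c\<close> the two halves \<open>c ^ (n + 1) = -1\<close> and
  \<open>cis pi = -1\<close> multiply to \<open>1\<close>, and oddness of the angle does the same at
  \<open>cis (- \<theta>) * c\<close>. Twice the angle equation is the increment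
  \<open>2 * pi\<close> between them.\<close>

lemma symmetric_consecutive:
  assumes n: "2 \<le> n" and c: "norm c = 1" "c ^ (n + 1) = -1" and \<rho>: "\<bar>\<rho>\<bar> < 1"
    and \<theta>: "0 < \<theta>" "\<theta> < pi" "\<theta> + real n * blaschke_angle (of_real \<rho>) \<theta> = pi"
    and sc: "sc_with_blaschke n (\<lambda>k. of_real \<rho> * c) f"
  shows "consecutive f (cis (- \<theta>) * c) (cis \<theta> * c)" "separation (cis (- \<theta>) * c) (cis \<theta> * c) = 2 * \<theta>"
proof -
  define \<gamma> where "\<gamma> = Arg2pi c"
  have g: "c = cis \<gamma>" unfolding \<gamma>_def by (rule cis_Arg2pi[OF c(1), symmetric])
  have e: "cis (- \<theta>) * c = cis (\<gamma> - \<theta>)" "cis \<theta> * c = cis (\<gamma> + \<theta>)" unfolding g cis_mult by (simp_all add: add.commute)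
  have na: "\<forall>k\<in>{1..n}. norm (of_real \<rho> * c) < 1" using c \<rho> by (simp add: norm_mult)
  have v: "cis (\<gamma> + \<theta>) \<in> unit_roots n (\<lambda>k. of_real \<rho> * c)"
    unfolding e[symmetric] unit_roots_def mem_Collect_eq symmetric_value[OF c(1) \<rho> refl] \<theta>(3) c(2)
    using c(1) by (simp add: norm_mult)
  have "- \<theta> + real n * blaschke_angle (of_real \<rho>) (- \<theta>) = - pi"
    unfolding blaschke_angle_real_odd[OF \<rho>] using \<theta>(3) by simp
  then have u: "cis (\<gamma> - \<theta>) \<in> unit_roots n (\<lambda>k. of_real \<rho> * c)"
    unfolding e[symmetric] unit_roots_def mem_Collect_eq symmetric_value[OF c(1) \<rho> refl] c(2)
    using c(1) by (simp add: norm_mult cis_cnj[symmetric])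
  have "root_angle n (\<lambda>k. of_real \<rho> * c) (\<gamma> + \<theta>) - root_angle n (\<lambda>k. of_real \<rho> * c) (\<gamma> - \<theta>)
      = 2 * \<theta> + (\<Sum>k=1..n. blaschke_angle (of_real \<rho> * c) (\<gamma> + \<theta>) - blaschke_angle (of_real \<rho> * c) (\<gamma> - \<theta>))"
    by (simp add: root_angle_def right_diff_distrib)
  also have "\<dots> = 2 * (\<theta> + real n * blaschke_angle (of_real \<rho>) \<theta>)"
    unfolding g increment_real[OF \<rho>] by simp
  finally have inc: "root_angle n (\<lambda>k. of_real \<rho> * c) (\<gamma> + \<theta>) - root_angle n (\<lambda>k. of_real \<rho> * c) (\<gamma> - \<theta>) = 2 * pi"
    unfolding \<theta>(3) .
  show "consecutive f (cis (- \<theta>) * c) (cis \<theta> * c)" "separation (cis (- \<theta>) * c) (cis \<theta> * c) = 2 * \<theta>"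
    unfolding e by (rule increment_imp_consecutive[OF n na sc \<theta>(1,2) u v inc])+
qed

section \<open>The two angle equations\<close>

lemma angle_equation_mono:
  assumes "\<bar>\<rho>\<bar> < 1" "0 < x" "x < y" "y < pi"
  shows "x + real n * blaschke_angle (of_real \<rho>) x < y + real n * blaschke_angle (of_real \<rho>) y"
proof -
  have "tan (x / 2) < tan (y / 2)" using assms by (intro tan_monotone) auto
  then have "(1 + \<rho>) / (1 - \<rho>) * tan (x / 2) < (1 + \<rho>) / (1 - \<rho>) * tan (y / 2)"
    using assms(1) by (intro mult_strict_left_mono) auto
  then have "blaschke_angle (of_real \<rho>) x \<le> blaschke_angle (of_real \<rho>) y"
    using assms by (subst (1 2) blaschke_angle_arctan) (auto simp: arctan_less_iff less_imp_le)
  then have "real n * blaschke_angle (of_real \<rho>) x \<le> real n * blaschke_angle (of_real \<rho>) y"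
    by (intro mult_left_mono) auto
  then show ?thesis using assms(3) by linarith
qed

lemma angle_equation_iff:
  assumes "\<bar>\<rho>\<bar> < 1" "0 < \<theta>" "\<theta> < pi"
  shows "pi = \<theta> + 2 * real n * arctan ((1 + \<rho>) / (1 - \<rho>) * tan (\<theta> / 2))
    \<longleftrightarrow> \<theta> + real n * blaschke_angle (of_real \<rho>) \<theta> = pi"
  unfolding blaschke_angle_arctan[OF assms] by (auto simp: mult_ac)

text \<open>\<open>X\<close> is a witness at which the right-hand side already exceeds
  \<open>pi\<close>, chosen below \<open>pi\<close> so that the tangent is continuous on
  \<open>{0..X}\<close>. \<open>Y\<close> only fixes the interval in which uniqueness is
  claimed.\<close>

lemma angle_equation_ex1:
  assumes \<rho>: "\<bar>\<rho>\<bar> < 1" and X: "0 < X" "X < pi" "X \<le> Y" "Y \<le> pi"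
    and big: "pi < X + 2 * real n * arctan ((1 + \<rho>) / (1 - \<rho>) * tan (X / 2))"
  shows "\<exists>!\<theta>. 0 < \<theta> \<and> \<theta> < Y \<and> pi = \<theta> + 2 * real n * arctan ((1 + \<rho>) / (1 - \<rho>) * tan (\<theta> / 2))"
proof (rule ex_ex1I)
  let ?g = "\<lambda>\<theta>. \<theta> + 2 * real n * arctan ((1 + \<rho>) / (1 - \<rho>) * tan (\<theta> / 2))"
  have "continuous_on {0..X} ?g"
  proof (intro continuous_intros ballI)
    fix x assume "x \<in> {0..X}"
    then have "0 < cos (x / 2)" using X by (intro cos_gt_zero_pi) auto
    then show "cos (x / 2) \<noteq> 0" by simp
  qed simp
  then obtain \<theta> where t: "0 \<le> \<theta>" "\<theta> \<le> X" "?g \<theta> = pi"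
    using IVT'[of ?g 0 pi X] big X by force
  have "\<theta> \<noteq> 0" using t(3) by auto
  moreover have "\<theta> \<noteq> X" using t(3) big by auto
  ultimately show "\<exists>\<theta>. 0 < \<theta> \<and> \<theta> < Y \<and> pi = ?g \<theta>" using t X by (intro exI[of _ \<theta>]) auto
next
  fix x y assume "0 < x \<and> x < Y \<and> pi = x + 2 * real n * arctan ((1 + \<rho>) / (1 - \<rho>) * tan (x / 2))"
    "0 < y \<and> y < Y \<and> pi = y + 2 * real n * arctan ((1 + \<rho>) / (1 - \<rho>) * tan (y / 2))"
  then have x: "0 < x" "x < pi" "x + real n * blaschke_angle (of_real \<rho>) x = pi"
    and y: "0 < y" "y < pi" "y + real n * blaschke_angle (of_real \<rho>) y = pi"
    using X angle_equation_iff[OF \<rho>, of x n] angle_equation_iff[OF \<rho>, of y n] by auto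
  show "x = y"
  proof (rule ccontr)
    assume "x \<noteq> y"
    then show False
      using angle_equation_mono[OF \<rho> x(1) _ y(2), of n] angle_equation_mono[OF \<rho> y(1) _ x(2), of n] x(3) y(3)
      by (cases x y rule: linorder_cases) auto
  qed
qed

section \<open>Extremal separations\<close>

lemma sum_le_eq:
  fixes f g :: "'a \<Rightarrow> real"
  assumes "finite A" "\<And>k. k \<in> A \<Longrightarrow> f k \<le> g k" "sum g A \<le> sum f A" "k \<in> A" shows "f k = g k"
proof (rule ccontr)
  assume "f k \<noteq> g k"
  then have "f k < g k" using assms(2,4) by force
  then have "sum f A < sum g A" using assms by (intro sum_strict_mono_ex1) auto
  then show False using assms(3) by simp
qed

lemma symmetric_centre_power:
  assumes \<rho>: "\<bar>\<rho>\<bar> < 1" and a: "\<And>k. k \<in> {1..n} \<Longrightarrow> a k = of_real \<rho> * cis \<gamma>"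
    and v: "cis (\<gamma> + \<sigma>) \<in> unit_roots n a" and eq: "\<sigma> + real n * blaschke_angle (of_real \<rho>) \<sigma> = pi"
  shows "cis \<gamma> ^ (n + 1) = -1"
proof -
  have e: "cis (\<gamma> + \<sigma>) = cis \<sigma> * cis \<gamma>" by (simp add: cis_mult add.commute)
  have "(cis \<sigma> * cis \<gamma>) * blaschke n a (cis \<sigma> * cis \<gamma>) = 1" using v unfolding e unit_roots_def by simp
  moreover have "(cis \<sigma> * cis \<gamma>) * blaschke n a (cis \<sigma> * cis \<gamma>)
      = cis \<gamma> ^ (n + 1) * cis (\<sigma> + real n * blaschke_angle (of_real \<rho>) \<sigma>)"
    by (rule symmetric_value[OF norm_cis \<rho>]) (rule a)
  ultimately have "cis \<gamma> ^ (n + 1) * cis pi = 1" unfolding eq by simp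
  then have "- (cis \<gamma> ^ (n + 1)) = 1" by simp
  then show ?thesis by (metis minus_minus)
qed

text \<open>\<open>s = 1\<close> treats the minimum and \<open>s = -1\<close> the maximum, where the
  extremal zeros are \<open>- r\<close> times the centre and all inequalities reverse. The
  increments over the arc total \<open>2 * pi\<close>, so the estimate for each factor compares
  \<open>pi\<close> with the left-hand side of the angle equation at the half-length
  \<open>\<sigma>\<close>; its monotonicity then compares \<open>\<sigma>\<close> with
  \<open>\<theta>\<close>.\<close>

lemma separation_bounds:
  assumes n: "2 \<le> n" and r: "0 \<le> r" "r < 1" and a: "\<forall>k\<in>{1..n}. norm (a k) \<le> r"
    and sc: "sc_with_blaschke n a f" and con: "consecutive f u v"
    and s: "s = 1 \<or> s = -1"
    and \<theta>: "0 < \<theta>" "\<theta> < pi" "\<theta> + real n * blaschke_angle (of_real (s * r)) \<theta> = pi"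
  shows "s * (2 * \<theta>) \<le> s * separation u v"
    and "separation u v = 2 * \<theta> \<Longrightarrow> \<exists>c. c ^ (n + 1) = -1 \<and> (\<forall>k\<in>{1..n}. a k = of_real (s * r) * c)
      \<and> u = cis (- \<theta>) * c \<and> v = cis \<theta> * c"
proof -
  have a1: "\<forall>k\<in>{1..n}. norm (a k) < 1" using a r by force
  obtain \<gamma> \<sigma> where g: "0 < \<sigma>" "\<sigma> < pi" "u = cis (\<gamma> - \<sigma>)" "v = cis (\<gamma> + \<sigma>)" "separation u v = 2 * \<sigma>"
    "root_angle n a (\<gamma> + \<sigma>) - root_angle n a (\<gamma> - \<sigma>) = 2 * pi"
    by (rule consecutive_imp_increment[OF n a1 sc con])
  define d where "d = (\<lambda>k. blaschke_angle (a k) (\<gamma> + \<sigma>) - blaschke_angle (a k) (\<gamma> - \<sigma>))"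
  define B where "B = 2 * blaschke_angle (of_real (s * r)) \<sigma>"
  have \<rho>: "\<bar>s * r\<bar> < 1" using s r by auto
  have sumd: "2 * \<sigma> + sum d {1..n} = 2 * pi"
    using g(6) by (simp add: root_angle_def d_def sum_subtractf algebra_simps)
  have dB: "s * d k \<le> s * B" "d k = B \<Longrightarrow> a k = of_real (s * r) * cis \<gamma>" if k: "k \<in> {1..n}" for k
    using s increment_upper[OF bspec[OF a k] r(2) g(1,2), of \<gamma>] increment_lower[OF bspec[OF a k] r(2) g(1,2), of \<gamma>]
    unfolding d_def B_def by auto
  have "(\<Sum>k=1..n. s * d k) \<le> (\<Sum>k=1..n. s * B)" by (intro sum_mono dB)
  then have le: "s * sum d {1..n} \<le> s * (real n * B)" by (simp add: sum_distrib_left mult_ac)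
  have le': "s * pi \<le> s * (\<sigma> + real n * blaschke_angle (of_real (s * r)) \<sigma>)"
  proof -
    have "sum d {1..n} = 2 * pi - 2 * \<sigma>" using sumd by simp
    then show ?thesis using le s unfolding B_def by (auto simp: algebra_simps)
  qed
  show "s * (2 * \<theta>) \<le> s * separation u v"
  proof (rule ccontr)
    assume "\<not> s * (2 * \<theta>) \<le> s * separation u v"
    then have "s = 1 \<and> \<sigma> < \<theta> \<or> s = -1 \<and> \<theta> < \<sigma>" using s g(5) by auto
    then show False
      using angle_equation_mono[OF \<rho> g(1) _ \<theta>(2), of n] angle_equation_mono[OF \<rho> \<theta>(1) _ g(2), of n] \<theta>(3) le'
      by auto
  qed
  assume "separation u v = 2 * \<theta>"
  then have st: "\<sigma> = \<theta>" using g(5) by simp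
  have tot: "sum d {1..n} = real n * B"
    using sumd \<theta>(3) unfolding st B_def by (simp add: algebra_simps)
  have ak: "a k = of_real (s * r) * cis \<gamma>" if k: "k \<in> {1..n}" for k
  proof -
    \<comment> \<open>With equal totals and an inequality in each term, every factor is extremal;
      the equality case then puts all zeros at the same point.\<close>
    have "(\<Sum>k=1..n. s * B) \<le> (\<Sum>k=1..n. s * d k)"
      unfolding sum_distrib_left[symmetric] tot by simp
    from sum_le_eq[OF finite_atLeastAtMost dB(1) this k] have "s * d k = s * B" by simp
    then have "d k = B" using s by auto
    then show ?thesis by (rule dB(2)[OF k])
  qed
  have "v \<in> unit_roots n a"
    using con prevertices_unit_roots[OF n a1 sc] unfolding consecutive_def by simp
  then have "cis (\<gamma> + \<theta>) \<in> unit_roots n a" unfolding g(4) st .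
  then have "cis \<gamma> ^ (n + 1) = -1"
    by (intro symmetric_centre_power[OF \<rho> _ _ \<theta>(3), where a = a] ak)
  moreover have "u = cis (- \<theta>) * cis \<gamma>" "v = cis \<theta> * cis \<gamma>"
    unfolding g(3,4) st cis_mult by (simp_all add: add.commute)
  ultimately show "\<exists>c. c ^ (n + 1) = -1 \<and> (\<forall>k\<in>{1..n}. a k = of_real (s * r) * c)
      \<and> u = cis (- \<theta>) * c \<and> v = cis \<theta> * c" using ak by blast
qed

lemma norm_root_minus_one:
  assumes "c ^ (n + 1) = (-1 :: complex)" shows "norm c = 1"
proof -
  have "norm c ^ (n + 1) = 1" by (metis assms norm_minus_cancel norm_one norm_power)
  then show ?thesis using power_eq_imp_eq_base[of "norm c" "n + 1" 1] by simp
qed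

text \<open>By the equality case of \<open>separation_bounds\<close>, another extremal pair would
  come from some \<open>c'\<close> with the same zeros. For \<open>r > 0\<close> the common zero
  determines \<open>c'\<close>, so the pair is unique.\<close>

lemma extremal_configuration:
  assumes n: "2 \<le> n" and r: "0 \<le> r" "r < 1" and s: "s = 1 \<or> s = -1"
    and \<theta>: "0 < \<theta>" "\<theta> < pi" "\<theta> + real n * blaschke_angle (of_real (s * r)) \<theta> = pi"
    and c: "c ^ (n + 1) = -1"
  shows "\<exists>f. sc_with_blaschke n (\<lambda>k. of_real (s * r) * c) f"
    and "sc_with_blaschke n (\<lambda>k. of_real (s * r) * c) f \<Longrightarrow>
      consecutive f (cis (- \<theta>) * c) (cis \<theta> * c) \<and> separation (cis (- \<theta>) * c) (cis \<theta> * c) = 2 * \<theta>"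
    and "sc_with_blaschke n (\<lambda>k. of_real (s * r) * c) f \<Longrightarrow> 0 < r \<Longrightarrow> consecutive f u v \<Longrightarrow>
      (u, v) \<noteq> (cis (- \<theta>) * c, cis \<theta> * c) \<Longrightarrow> s * (2 * \<theta>) < s * separation u v"
proof -
  have nc: "norm c = 1" by (rule norm_root_minus_one[OF c])
  have \<rho>: "\<bar>s * r\<bar> < 1" using s r by auto
  have nr: "norm (of_real (s * r) * c) \<le> r" using s r nc by (auto simp: norm_mult)
  have a: "\<forall>k\<in>{1..n}. norm (of_real (s * r) * c) \<le> r" using nr by blast
  have a1: "\<forall>k\<in>{1..n}. norm (of_real (s * r) * c) < 1" using nr r(2) by auto
  show "\<exists>f. sc_with_blaschke n (\<lambda>k. of_real (s * r) * c) f"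
    by (rule sc_exists[OF n _ unit_roots_def card_unit_roots[OF a1]]) (use a1 in blast)
  assume sc: "sc_with_blaschke n (\<lambda>k. of_real (s * r) * c) f"
  show "consecutive f (cis (- \<theta>) * c) (cis \<theta> * c) \<and> separation (cis (- \<theta>) * c) (cis \<theta> * c) = 2 * \<theta>"
    using symmetric_consecutive[OF n nc c \<rho> \<theta> sc] by blast
  assume r0: "0 < r" and con: "consecutive f u v" and ne: "(u, v) \<noteq> (cis (- \<theta>) * c, cis \<theta> * c)"
  note b = separation_bounds[OF n r a sc con s \<theta>]
  have "separation u v \<noteq> 2 * \<theta>"
  proof
    assume "separation u v = 2 * \<theta>"
    from b(2)[OF this] obtain c' where c': "\<forall>k\<in>{1..n}. of_real (s * r) * c = of_real (s * r) * c'"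
      "u = cis (- \<theta>) * c'" "v = cis \<theta> * c'" by blast
    have "of_real (s * r) * c = of_real (s * r) * c'" using c'(1) n by force
    moreover have "complex_of_real (s * r) \<noteq> 0" using s r0 by auto
    ultimately have "c = c'" by (simp only: mult_cancel_left) simp
    then show False using ne c'(2,3) by simp
  qed
  then have "s * separation u v \<noteq> s * (2 * \<theta>)" using s by auto
  with b(1) show "s * (2 * \<theta>) < s * separation u v" by linarith
qed

lemma extremal_separation:
  assumes n: "2 \<le> n" and r: "0 \<le> r" "r < 1" and s: "s = 1 \<or> s = -1"
    and \<theta>: "0 < \<theta>" "\<theta> < pi" "\<theta> + real n * blaschke_angle (of_real (s * r)) \<theta> = pi"
  shows "2 * \<theta> \<in> separations n r" and "x \<in> separations n r \<Longrightarrow> s * (2 * \<theta>) \<le> s * x"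
proof -
  define c where "c = cis (pi / real (n + 1))"
  have c: "c ^ (n + 1) = -1" unfolding c_def Complex.DeMoivre by simp
  have nr: "norm (of_real (s * r) * c) \<le> r" using s r by (auto simp: norm_mult c_def)
  obtain f where f: "sc_with_blaschke n (\<lambda>k. of_real (s * r) * c) f"
    using extremal_configuration(1)[OF n r s \<theta> c] by blast
  have "consecutive f (cis (- \<theta>) * c) (cis \<theta> * c)" "separation (cis (- \<theta>) * c) (cis \<theta> * c) = 2 * \<theta>"
    using extremal_configuration(2)[OF n r s \<theta> c f] by blast+
  then show "2 * \<theta> \<in> separations n r"
    unfolding separations_def using f nr by (intro CollectI exI[of _ f] exI conjI) auto
  assume "x \<in> separations n r"
  then obtain f a u v where x: "x = separation u v" and h: "sc_with_blaschke n a f"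
    "\<forall>k\<in>{1..n}. norm (a k) \<le> r" "consecutive f u v"
    unfolding separations_def by blast
  show "s * (2 * \<theta>) \<le> s * x" unfolding x by (rule separation_bounds(1)[OF n r h(2,1,3) s \<theta>])
qed

text \<open>For the maximum the zeros are \<open>- r * c\<close> with
  \<open>c ^ (n + 1) = -1\<close>; the substitution \<open>c = - d\<close> turns them into
  \<open>r * d\<close> with the stated condition on \<open>d\<close>.\<close>

lemma minus_power_Suc_eq:
  fixes d :: complex shows "(- d) ^ (n + 1) = -1 \<longleftrightarrow> d ^ (n + 1) = (-1) ^ n"
proof -
  define e :: complex where "e = (-1) ^ n"
  define D where "D = d ^ (n + 1)"
  have "(- d) ^ (n + 1) = (-1) ^ (n + 1) * D" unfolding D_def by (rule power_minus)
  then have neg: "(- d) ^ (n + 1) = - (e * D)" by (simp add: e_def)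
  have ee: "e * e = 1" unfolding e_def by (simp flip: power_mult_distrib)
  have "- (e * D) = -1 \<longleftrightarrow> D = e"
  proof
    assume "- (e * D) = -1"
    then have "e * (e * D) = e" by simp
    then show "D = e" by (simp only: mult.assoc[symmetric] ee mult_1)
  qed (simp add: ee)
  then show ?thesis unfolding neg D_def e_def .
qed

text \<open>Both halves are the estimates with sign \<open>s\<close>, for \<open>1\<close> and
  \<open>-1\<close>. Strictness for the other pairs is claimed for \<open>0 < r\<close>, because for
  \<open>r = 0\<close> the pre-vertices are the roots of unity of order \<open>n + 1\<close> and all
  separations agree. The last clause of each half is the equality case: an extremal separation
  occurs only in a symmetric configuration.\<close>

theorem theorem6:
  fixes n :: nat and r :: real
  assumes "2 \<le> n" and "0 \<le> r" and "r < 1"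
  shows
    "(\<forall>f a. sc_with_blaschke n a f \<and> (\<forall>k\<in>{1..n}. norm (a k) \<le> r) \<longrightarrow>
        prevertices f = {z. norm z = 1 \<and> z * blaschke n a z = 1} \<and> card (prevertices f) = n + 1)
     \<and>
     (\<exists>!\<theta>::real. 0 < \<theta> \<and> \<theta> < pi / 2 \<and>
        pi = \<theta> + 2 * real n * arctan ((1 + r) / (1 - r) * tan (\<theta> / 2)))
     \<and>
     (\<forall>\<theta>::real. 0 < \<theta> \<and> \<theta> < pi / 2 \<and>
        pi = \<theta> + 2 * real n * arctan ((1 + r) / (1 - r) * tan (\<theta> / 2)) \<longrightarrow>
        2 * \<theta> \<in> separations n r \<and> (\<forall>s\<in>separations n r. 2 * \<theta> \<le> s) \<and>
        (\<forall>c::complex. c ^ (n + 1) = -1 \<longrightarrow>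
           (\<exists>f. sc_with_blaschke n (\<lambda>k. of_real r * c) f) \<and>
           (\<forall>f. sc_with_blaschke n (\<lambda>k. of_real r * c) f \<longrightarrow>
              consecutive f (cis (- \<theta>) * c) (cis \<theta> * c) \<and>
              separation (cis (- \<theta>) * c) (cis \<theta> * c) = 2 * \<theta> \<and>
              (0 < r \<longrightarrow> (\<forall>u v. consecutive f u v \<and> (u, v) \<noteq> (cis (- \<theta>) * c, cis \<theta> * c) \<longrightarrow>
                 2 * \<theta> < separation u v)))) \<and>
        (\<forall>f a u v. sc_with_blaschke n a f \<and> (\<forall>k\<in>{1..n}. norm (a k) \<le> r) \<and>
           consecutive f u v \<and> separation u v = 2 * \<theta> \<longrightarrow>
           (\<exists>c::complex. c ^ (n + 1) = -1 \<and> (\<forall>k\<in>{1..n}. a k = of_real r * c) \<and>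
              u = cis (- \<theta>) * c \<and> v = cis \<theta> * c)))
     \<and>
     (\<exists>!\<psi>::real. 0 < \<psi> \<and> \<psi> < pi \<and>
        pi = \<psi> + 2 * real n * arctan ((1 - r) / (1 + r) * tan (\<psi> / 2)))
     \<and>
     (\<forall>\<psi>::real. 0 < \<psi> \<and> \<psi> < pi \<and>
        pi = \<psi> + 2 * real n * arctan ((1 - r) / (1 + r) * tan (\<psi> / 2)) \<longrightarrow>
        2 * \<psi> \<in> separations n r \<and> (\<forall>s\<in>separations n r. s \<le> 2 * \<psi>) \<and>
        (\<forall>d::complex. d ^ (n + 1) = (-1) ^ n \<longrightarrow>
           (\<exists>f. sc_with_blaschke n (\<lambda>k. of_real r * d) f) \<and>
           (\<forall>f. sc_with_blaschke n (\<lambda>k. of_real r * d) f \<longrightarrow>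
              consecutive f (- (cis (- \<psi>) * d)) (- (cis \<psi> * d)) \<and>
              separation (- (cis (- \<psi>) * d)) (- (cis \<psi> * d)) = 2 * \<psi> \<and>
              (0 < r \<longrightarrow> (\<forall>u v. consecutive f u v \<and>
                   (u, v) \<noteq> (- (cis (- \<psi>) * d), - (cis \<psi> * d)) \<longrightarrow>
                 separation u v < 2 * \<psi>)))) \<and>
        (\<forall>f a u v. sc_with_blaschke n a f \<and> (\<forall>k\<in>{1..n}. norm (a k) \<le> r) \<and>
           consecutive f u v \<and> separation u v = 2 * \<psi> \<longrightarrow>
           (\<exists>d::complex. d ^ (n + 1) = (-1) ^ n \<and> (\<forall>k\<in>{1..n}. a k = of_real r * d) \<and>
              u = - (cis (- \<psi>) * d) \<and> v = - (cis \<psi> * d))))"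
proof -
  note n = assms(1) and r = assms(2,3)
  have ar: "\<bar>r\<bar> < 1" "\<bar>- r\<bar> < 1" using r by auto
  have K: "(1 - r) / (1 + r) = (1 + - r) / (1 - - r)" by simp
  show ?thesis
  proof (intro conjI, goal_cases)
    case 1
    show ?case
    proof (intro allI impI)
      fix f a assume h: "sc_with_blaschke n a f \<and> (\<forall>k\<in>{1..n}. norm (a k) \<le> r)"
      then have a: "\<forall>k\<in>{1..n}. norm (a k) < 1" using r by force
      show "prevertices f = {z. norm z = 1 \<and> z * blaschke n a z = 1} \<and> card (prevertices f) = n + 1"
        using prevertices_unit_roots[OF n a conjunct1[OF h]] card_unit_roots[OF a] by (simp add: unit_roots_def)
    qed
  next
    case 2
    show ?case
    \<comment> \<open>At \<open>pi / 2\<close> the tangent is \<open>1\<close> and the arctangent at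
      least \<open>pi / 4\<close>, so for \<open>n \<ge> 2\<close> the right-hand side is at least
      \<open>3 * pi / 2\<close>.\<close>
    proof (rule angle_equation_ex1[OF ar(1), where X = "pi / 2"])
      have "1 \<le> (1 + r) / (1 - r)" using r by (simp add: le_divide_eq)
      then have "pi / 4 \<le> arctan ((1 + r) / (1 - r))" unfolding arctan_one[symmetric] by (rule arctan_monotone')
      then have "2 * 2 * (pi / 4) \<le> 2 * real n * arctan ((1 + r) / (1 - r))"
        using n by (intro mult_mono) auto
      moreover have tan: "tan (pi / 2 / 2) = 1" using tan_45 by simp
      ultimately show "pi < pi / 2 + 2 * real n * arctan ((1 + r) / (1 - r) * tan (pi / 2 / 2))"
        using pi_gt_zero unfolding tan mult_1_right by argo
    qed auto
  next
    case 3
    show ?case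
    proof (intro allI impI, goal_cases)
      case (1 \<theta>)
      have s: "(1::real) = 1 \<or> (1::real) = -1" by simp
      have t1: "0 < \<theta>" "\<theta> < pi" using 1 pi_gt_zero by auto
      have t2: "\<theta> + real n * blaschke_angle (of_real (1 * r)) \<theta> = pi"
        using angle_equation_iff[OF ar(1) t1, of n] 1 by simp
      note X = extremal_separation[OF n r s t1 t2, unfolded mult_1]
      note Y = extremal_configuration[OF n r s t1 t2, unfolded mult_1]
      note W = separation_bounds(2)[OF n r _ _ _ s t1 t2, unfolded mult_1]
      show ?case
      proof (intro conjI, goal_cases)
        case 1 show ?case by (rule X(1))
      next
        case 2 show ?case using X(2) by blast
      next
        case 3 show ?case using Y by blast
      next
        case 4 show ?case using W by blast
      qed
    qed
  next
    case 4
    show ?case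
      unfolding K
    \<comment> \<open>Chosen to make the argument of the arctangent equal to \<open>1\<close>: its
      term is then at least \<open>pi\<close> for \<open>n \<ge> 2\<close>, and \<open>X\<close>
      itself is positive.\<close>
    proof (rule angle_equation_ex1[OF ar(2), where X = "2 * arctan ((1 + r) / (1 - r))"])
      let ?S = "(1 + r) / (1 - r)"
      have S: "0 < ?S" using r by simp
      have a: "0 < arctan ?S" "arctan ?S < pi / 2" using S arctan_ubound[of ?S] by (simp, simp)
      then show "0 < 2 * arctan ?S" "2 * arctan ?S < pi" "2 * arctan ?S \<le> pi" by simp_all
      have tan: "(1 + - r) / (1 - - r) * tan (2 * arctan ?S / 2) = 1" using r by (simp add: tan_arctan)
      have "2 * 2 * (pi / 4) \<le> 2 * real n * (pi / 4)" using n by (intro mult_right_mono) auto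
      then show "pi < 2 * arctan ?S + 2 * real n * arctan ((1 + - r) / (1 - - r) * tan (2 * arctan ?S / 2))"
        using a(1) unfolding tan arctan_one by argo
    qed simp
  next
    case 5
    show ?case
    proof (intro allI impI, goal_cases)
      case (1 \<psi>)
      have s: "(-1::real) = 1 \<or> (-1::real) = -1" by simp
      have t1: "0 < \<psi>" "\<psi> < pi" using 1 by auto
      have t2: "\<psi> + real n * blaschke_angle (of_real (-1 * r)) \<psi> = pi"
        using angle_equation_iff[OF ar(2) t1, of n] 1 unfolding K by simp
      note X = extremal_separation[OF n r s t1 t2]
      note Y = extremal_configuration[OF n r s t1 t2]
      note W = separation_bounds(2)[OF n r _ _ _ s t1 t2]
      have neg: "of_real (-1 * r) * - d = of_real r * d" "cis x * - d = - (cis x * d)" for d x by simp_all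
      show ?case
      proof (intro conjI, goal_cases)
        case 1 show ?case by (rule X(1))
      next
        case 2 show ?case using X(2) by force
      next
        case 3
        show ?case
        proof (intro allI impI, goal_cases)
          case (1 d)
          \<comment> \<open>The configuration is applied with centre \<open>- d\<close>;
            \<open>neg\<close> then moves the signs to the zeros and the pre-vertices of the
            statement.\<close>
          then have "(- d) ^ (n + 1) = -1" by (simp only: minus_power_Suc_eq)
          note Yd = Y[OF this, unfolded neg]
          have lt: "-1 * (2 * \<psi>) < -1 * x \<longleftrightarrow> x < 2 * \<psi>" for x :: real by simp
          show ?case using Yd(1,2) Yd(3)[unfolded lt] by blast
        qed
      next
        case 4
        show ?case
        proof (intro allI impI, elim conjE)
          fix f a u v
          assume h: "sc_with_blaschke n a f" "\<forall>k\<in>{1..n}. norm (a k) \<le> r" "consecutive f u v" "separation u v = 2 * \<psi>"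
          obtain c where c: "c ^ (n + 1) = -1" "\<forall>k\<in>{1..n}. a k = of_real (-1 * r) * c"
            "u = cis (- \<psi>) * c" "v = cis \<psi> * c"
            using W[OF h(2,1,3,4)] by blast
          have "(- c) ^ (n + 1) = (-1) ^ n" unfolding minus_power_Suc_eq[symmetric] minus_minus by (rule c(1))
          moreover have "\<forall>k\<in>{1..n}. a k = of_real r * (- c)" using c(2) by simp
          moreover have "u = - (cis (- \<psi>) * (- c))" "v = - (cis \<psi> * (- c))" using c(3,4) by simp_all
          ultimately show "\<exists>d::complex. d ^ (n + 1) = (-1) ^ n \<and> (\<forall>k\<in>{1..n}. a k = of_real r * d) \<and>
              u = - (cis (- \<psi>) * d) \<and> v = - (cis \<psi> * d)" by blast
        qed
      qed
    qed
  qed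
qed

end
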